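(* Let $n\ge2$, $p>0$ and $m\in\{1,\dots,n-1\}$. Let $h_0\in C^+(S^{n-1})$ and $f\in C(S^{n-1})$, and for sufficiently small $\delta>0$ and $t\in(-\delta,\delta)$ let $$h_t(v)=\bigl(h_0(v)^p+tf(v)+o(t,v)\bigr)^{1/p},\qquad v\in S^{n-1},$$ where $o(0,\cdot)=0$ and $\lim_{t\to0}o(t,\cdot)/t=0$ uniformly on $S^{n-1}$. Let $$K_t=\{x\in\mathbb{R}^n: x\cdot v\le h_t(v)\text{ for all }v\in S^{n-1}\},\qquad t\in(-\delta,\delta).$$ Then $$\lim_{t\to0}\frac{\widetilde{\Psi}_m(K_t)-\widetilde{\Psi}_m(K_0)}{t}=\frac{n}{p}\int_{S^{n-1}}f(u)\,d\widetilde{C}_{p,m}^a(K_0,u).$$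
   Context: $C(S^{n-1})$ and $C^+(S^{n-1})$ are the continuous, respectively positive continuous, functions on $S^{n-1}$. $\mathcal{K}^n_{(o)}$ is the set of compact convex sets in $\mathbb{R}^n$ containing the origin in their interior (in particular $K_0\in\mathcal{K}^n_{(o)}$). $G(n,m)$ is the Grassmannian of $m$-dimensional linear subspaces of $\mathbb{R}^n$ with Haar probability measure $\nu_m$; $\omega_j$ is the volume of the unit ball in $\mathbb{R}^j$; $|L|$ is the $m$-dimensional volume of a set $L$ contained in an $m$-dimensional subspace. For a compact convex $K$ containing the origin, $$\widetilde{\Psi}_m(K)=\int_{G(n,m)}|K\cap\xi|^n\,d\nu_m(\xi).$$ For $K\in\mathcal{K}^n_{(o)}$: $\rho_K(u)=\max\{t\ge 0: tu\in K\}$; for $\mathcal{H}^{n-1}$-almost every $u\in S^{n-1}$ there is a unique outer unit normal $\nu_K(\rho_K(u)u)$ of $K$ at $\rho_K(u)u$. For Borel $\eta\subset S^{n-1}$, $\boldsymbol{\alpha}_K^*(\eta)$ is the set of $u\in S^{n-1}$ such that some $v\in\eta$ is an outer unit normal of $K$ at $\rho_K(u)u$. The $m$-dimensional dual Radon transform of $F:G(n,m)\to\mathbb{R}$ is $$\mathcal{R}_m^*F(u)=\frac{m\omega_m}{n\omega_n}\int_{G_u(n-1,m-1)}F(\operatorname{span}\{u,\zeta\})\,d\nu_{m-1}(\zeta),\quad u\in S^{n-1},$$ where $G_u(n-1,m-1)$ is the Grassmannian of $(m-1)$-dimensional subspaces of $u^\perp$ with Haar probability measure $\nu_{m-1}$.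 $\mathcal{R}_m^*(|K\cap\cdot|^{n-1})$ is this transform applied to $F(\xi)=|K\cap\xi|^{n-1}$. For $p\in\mathbb{R}$, $$\widetilde{C}_{p,m}^a(K,\eta)=\int_{\boldsymbol{\alpha}_K^*(\eta)}\bigl(u\cdot\nu_K(\rho_K(u)u)\bigr)^{-p}\rho_K(u)^{m-p}\,\mathcal{R}_m^*(|K\cap\cdot|^{n-1})(u)\,du,$$ where $du$ is spherical Lebesgue measure. *)

theory Defs
  imports "HOL-Probability.Probability"
begin

text \<open>Lebesgue measure of the subspace \<open>\<xi>\<close>, of dimension \<open>dim \<xi>\<close>, as a Borel measure on the ambient
  space concentrated on \<open>\<xi>\<close>: Lebesgue measure on \<open>\<real>\<^sup>B\<close> is transported by the linear isometry
  given by an orthonormal basis \<open>B\<close> of \<open>\<xi>\<close>. The result does not depend on the choice of \<open>B\<close>.\<close>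

definition orthonormal_basis_of :: "(real^'n) set \<Rightarrow> (real^'n) set \<Rightarrow> bool" where
  "orthonormal_basis_of B \<xi> \<longleftrightarrow> pairwise orthogonal B \<and> (\<forall>b\<in>B. norm b = 1) \<and> span B = \<xi>"

definition subspace_lborel :: "(real^'n) set \<Rightarrow> (real^'n) measure" where
  "subspace_lborel \<xi> = (let B = (SOME B. orthonormal_basis_of B \<xi>) in
     distr (Pi\<^sub>M B (\<lambda>_. lborel)) borel (\<lambda>x. \<Sum>b\<in>B. x b *\<^sub>R b))"

definition section_vol :: "(real^'n) set \<Rightarrow> (real^'n) set \<Rightarrow> real" where
  "section_vol K \<xi> = measure (subspace_lborel \<xi>) (K \<inter> \<xi>)"

text \<open>Spherical Lebesgue measure: the measure of a Borel set \<open>\<eta>\<close> of unit vectors is \<open>n\<close> times the volume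
  of the cone \<open>{t u | 0 < t \<le> 1, u \<in> \<eta>}\<close>. The completion is needed because the reverse radial
  Gauss image of a Borel set is in general only measurable up to null sets.\<close>

definition sphere_lebesgue :: "(real^'n) measure" where
  "sphere_lebesgue = completion (scale_measure (of_nat CARD('n))
     (distr (restrict_space lborel (cball 0 1 - {0})) (restrict_space borel (sphere 0 1)) sgn))"

definition grassmannian :: "(real^'n) set \<Rightarrow> nat \<Rightarrow> (real^'n) set set" where
  "grassmannian V k = {\<xi>. subspace \<xi> \<and> \<xi> \<subseteq> V \<and> dim \<xi> = k}"

text \<open>The Grassmannian carries the topology induced by the embedding that sends a subspace to the
  matrix of the orthogonal projection onto it; the following is its Borel sigma-algebra.\<close>

definition grassmannian_borel :: "(real^'n) set \<Rightarrow> nat \<Rightarrow> (real^'n) set measure" where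
  "grassmannian_borel V k =
     vimage_algebra (grassmannian V k) (\<lambda>\<xi>. matrix (closest_point \<xi>)) borel"

text \<open>For a subspace \<open>V\<close> and \<open>k \<le> dim V\<close>, the unique Borel probability measure invariant under
  the orthogonal group of \<open>V\<close>; every element of that group is the restriction of an orthogonal
  transformation of the ambient space that preserves \<open>V\<close>.\<close>

definition grassmannian_haar :: "(real^'n) set \<Rightarrow> nat \<Rightarrow> (real^'n) set measure" where
  "grassmannian_haar V k = (THE \<nu>. sets \<nu> = sets (grassmannian_borel V k) \<and> prob_space \<nu> \<and>
     (\<forall>T. orthogonal_transformation T \<and> T ` V = V \<longrightarrow> distr \<nu> \<nu> ((`) T) = \<nu>))"

definition dual_quermass :: "nat \<Rightarrow> (real^'n) set \<Rightarrow> real" where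
  "dual_quermass m K = (LINT \<xi>|grassmannian_haar UNIV m. section_vol K \<xi> ^ CARD('n))"

definition dual_radon :: "nat \<Rightarrow> ((real^'n) set \<Rightarrow> real) \<Rightarrow> real^'n \<Rightarrow> real" where
  "dual_radon m F u =
     (real m * unit_ball_vol (real m)) / (real CARD('n) * unit_ball_vol (real CARD('n))) *
     (LINT \<zeta>|grassmannian_haar {x. orthogonal u x} (m - 1). F (span (insert u \<zeta>)))"

definition wulff_shape :: "(real^'n \<Rightarrow> real) \<Rightarrow> (real^'n) set" where
  "wulff_shape h = {x. \<forall>v\<in>sphere 0 1. x \<bullet> v \<le> h v}"

definition radial_fun :: "(real^'n) set \<Rightarrow> real^'n \<Rightarrow> real" where
  "radial_fun K u = (GREATEST t. 0 \<le> t \<and> t *\<^sub>R u \<in> K)"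

definition outer_unit_normals :: "(real^'n) set \<Rightarrow> real^'n \<Rightarrow> (real^'n) set" where
  "outer_unit_normals K x = {v \<in> sphere 0 1. \<forall>y\<in>K. y \<bullet> v \<le> x \<bullet> v}"

text \<open>Meaningful only at boundary points with a unique outer unit normal, i.e. at \<open>\<rho>\<^sub>K(u) u\<close> for
  almost every \<open>u\<close>.\<close>

definition outer_unit_normal :: "(real^'n) set \<Rightarrow> real^'n \<Rightarrow> real^'n" where
  "outer_unit_normal K x = (THE v. v \<in> outer_unit_normals K x)"

definition reverse_radial_gauss_image :: "(real^'n) set \<Rightarrow> (real^'n) set \<Rightarrow> (real^'n) set" where
  "reverse_radial_gauss_image K \<eta> =
     {u \<in> sphere 0 1. \<exists>v\<in>\<eta>. v \<in> outer_unit_normals K (radial_fun K u *\<^sub>R u)}"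

text \<open>The affine dual curvature measure, a Borel measure on the unit sphere. Its density is
  nonnegative, so the integral defining it is taken as a nonnegative one.\<close>

definition affine_dual_curvature :: "real \<Rightarrow> nat \<Rightarrow> (real^'n) set \<Rightarrow> (real^'n) measure" where
  "affine_dual_curvature p m K =
     measure_of (sphere 0 1) (sets (restrict_space borel (sphere 0 1)))
       (\<lambda>\<eta>. set_nn_integral sphere_lebesgue (reverse_radial_gauss_image K \<eta>)
          (\<lambda>u. ennreal (
              (u \<bullet> outer_unit_normal K (radial_fun K u *\<^sub>R u)) powr (- p)
            * radial_fun K u powr (real m - p)
            * dual_radon m (\<lambda>\<xi>. section_vol K \<xi> ^ (CARD('n) - 1)) u)))"

end

(* Writing h_t^p = h_0^p + t f + o(t), the p-th power of the radial function of K_t in direction u is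
   the largest a with a max(0, u.v)^p <= h_t(v)^p for all v. Hence an envelope argument gives its
   t-derivative whenever K_0 has a unique outer normal at the boundary point in direction u, and this
   is the case for almost all u: the second differences of the gauge function integrate to O(e^2).
   Dominated convergence then yields the derivative of |K_t intersected with xi|, of its n-th power, and of the
   integral over the Grassmannian. To reach the curvature measure one disintegrates the flag manifold
   of pairs (u, xi) in two ways, first choosing xi or first choosing u; both orders give the unique
   rotation invariant probability measure.

   Subspaces are represented by their orthogonal projections, and the Haar measures by random
   projections obtained from independent random vectors by the Gram-Schmidt process. *)

theory Submission
  imports Defs
begin

subsection \<open>Uniqueness of invariant measures\<close>

text \<open>\<open>grassmannian_haar\<close> is a definite description, so nothing can be computed
  from it before both existence and uniqueness are known. The topology of the Grassmannian is given
  by projection matrices, which form a bounded subset of a Euclidean space; the uniqueness argument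
  takes place there. Polar coordinates are avoided. For \<open>y\<close> uniform in the unit ball,
  \<open>n \<omega>_n\<close> times the law of \<open>sgn y\<close> is spherical measure, and if
  \<open>A\<close> projects onto an m-plane, \<open>sgn (A *v y)\<close> is a uniform direction in
  that plane. A section volume is thus \<open>\<omega>_m\<close> times an expectation of the m-th
  power of the radial function, an expression that makes sense for every matrix \<open>A\<close>.
  The p-th powers are the right coordinates because the support constraint is linear in them and the
  variation affine up to o(t). The factor \<open>n\<close> comes from the n-th power of the section
  volume, and \<open>m / p\<close> from writing the m-th power of the radial function as the power
  \<open>m / p\<close> of its p-th power. The normalisation
  \<open>m \<omega>_m / (n \<omega>_n)\<close> of the Radon transform and the mass
  \<open>n \<omega>_n\<close> of the sphere then cancel against \<open>m \<omega>_m\<close>.\<close>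

lemma borel_measure_eq_of_lipschitz:
  fixes \<mu> \<nu> :: "'a::metric_space measure"
  assumes "prob_space \<mu>" "prob_space \<nu>" and sets: "sets \<mu> = sets borel" "sets \<nu> = sets borel"
    and eq: "\<And>f L. L \<ge> 0 \<Longrightarrow> (\<And>x y. \<bar>f x - f y\<bar> \<le> L * dist x y) \<Longrightarrow> (\<And>x. 0 \<le> f x \<and> f x \<le> (1::real))
              \<Longrightarrow> (\<integral>x. f x \<partial>\<mu>) = (\<integral>x. f x \<partial>\<nu>)"
  shows "\<mu> = \<nu>"
proof -
  interpret \<mu>: prob_space \<mu> by fact
  interpret \<nu>: prob_space \<nu> by fact
  have closed_eq: "emeasure \<mu> C = emeasure \<nu> C" if C: "closed C" for C
  proof (cases "C = {}")
    case False
    \<comment> \<open>Lipschitz tents of slope k shrink to the indicator of \<open>C\<close>,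
      because a point off a closed set has positive distance from it. The empty set is split off
      since \<open>infdist x {}\<close> is 0.\<close>
    define f where "f = (\<lambda>k::nat. \<lambda>x. max 0 (1 - real k * infdist x C))"
    have lip: "\<bar>f k x - f k y\<bar> \<le> real k * dist x y" for k x y
    proof -
      have "\<bar>infdist x C - infdist y C\<bar> \<le> dist x y"
        by (metis abs_diff_le_iff dist_commute infdist_triangle_abs)
      hence "\<bar>real k * infdist x C - real k * infdist y C\<bar> \<le> real k * dist x y"
        by (metis abs_mult abs_of_nat mult_left_mono of_nat_0_le_iff right_diff_distrib)
      thus ?thesis unfolding f_def by linarith
    qed
    have bnd: "0 \<le> f k x \<and> f k x \<le> 1" for k x
      unfolding f_def by (auto simp: infdist_nonneg)
    have meas: "f k \<in> borel_measurable borel" for k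
      unfolding f_def by (intro borel_measurable_continuous_onI continuous_intros)
    have lim: "(\<lambda>k. f k x) \<longlonglongrightarrow> indicator C x" for x
    proof (cases "x \<in> C")
      case True thus ?thesis by (simp add: f_def)
    next
      case x: False
      hence pos: "infdist x C > 0"
        using False C in_closed_iff_infdist_zero infdist_nonneg by (metis less_eq_real_def)
      have "eventually (\<lambda>k. f k x = 0) sequentially"
      proof -
        obtain k0 where k0: "1 < real k0 * infdist x C" using pos reals_Archimedean3 by blast
        have "f k x = 0" if "k \<ge> k0" for k
        proof -
          have "real k0 * infdist x C \<le> real k * infdist x C"
            using that pos by (intro mult_right_mono) auto
          thus ?thesis using k0 by (simp add: f_def)
        qed
        thus ?thesis by (auto simp: eventually_sequentially)
      qed
      thus ?thesis using x by (simp add: tendsto_eventually)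
    qed
    have "(\<lambda>k. \<integral>x. f k x \<partial>\<mu>) \<longlonglongrightarrow> (\<integral>x. indicator C x \<partial>\<mu>)"
      by (rule integral_dominated_convergence[where w="\<lambda>_. 1"])
        (use C meas bnd lim in \<open>auto simp: sets measurable_cong_sets[OF sets(1) refl]\<close>)
    moreover have "(\<lambda>k. \<integral>x. f k x \<partial>\<nu>) \<longlonglongrightarrow> (\<integral>x. indicator C x \<partial>\<nu>)"
      by (rule integral_dominated_convergence[where w="\<lambda>_. 1"])
        (use C meas bnd lim in \<open>auto simp: sets measurable_cong_sets[OF sets(2) refl]\<close>)
    moreover have "(\<integral>x. f k x \<partial>\<mu>) = (\<integral>x. f k x \<partial>\<nu>)" for k
      by (rule eq[of "real k"]) (use lip bnd in auto)
    ultimately have "(\<integral>x. indicator C x \<partial>\<mu>) = (\<integral>x. indicator C x \<partial>\<nu> :: real)"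
      using LIMSEQ_unique by simp
    thus ?thesis
      using C sets by (simp add: \<mu>.emeasure_eq_measure \<nu>.emeasure_eq_measure space_borel
          sets_eq_imp_space_eq[OF sets(1)] sets_eq_imp_space_eq[OF sets(2)])
  qed simp
  show ?thesis
  proof (rule measure_eqI_generator_eq[where E="Collect closed" and \<Omega>=UNIV and A="\<lambda>_. UNIV"])
    show "Int_stable (Collect closed)" by (auto simp: Int_stable_def)
    show "sets \<mu> = sigma_sets UNIV (Collect closed)" "sets \<nu> = sigma_sets UNIV (Collect closed)"
      using sets by (simp_all add: borel_eq_closed)
  qed (use closed_eq in \<open>auto\<close>)
qed

text \<open>Christensen's argument: both measures give equal mass to all balls of the same radius centred
  in \<open>X\<close>, so integrating \<open>f x\<close> against the invariant kernel \<open>dist x y < \<epsilon>\<close> compares the two integrals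
  of a Lipschitz function up to \<open>L \<epsilon>\<close>.\<close>

lemma invariant_measure_unique:
  fixes \<mu> \<nu> :: "'a::euclidean_space measure"
  assumes bX: "bounded X"
    and \<mu>: "prob_space \<mu>" "sets \<mu> = sets borel" "AE x in \<mu>. x \<in> X"
    and \<nu>: "prob_space \<nu>" "sets \<nu> = sets borel" "AE x in \<nu>. x \<in> X"
    and meas: "\<And>g. g \<in> \<Gamma> \<Longrightarrow> g \<in> borel_measurable borel"
    and iso: "\<And>g x y. g \<in> \<Gamma> \<Longrightarrow> x \<in> X \<Longrightarrow> y \<in> X \<Longrightarrow> dist (g x) (g y) = dist x y"
    and inv: "\<And>g. g \<in> \<Gamma> \<Longrightarrow> distr \<mu> borel g = \<mu>" "\<And>g. g \<in> \<Gamma> \<Longrightarrow> distr \<nu> borel g = \<nu>"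
    and trans: "\<And>x y. x \<in> X \<Longrightarrow> y \<in> X \<Longrightarrow> \<exists>g\<in>\<Gamma>. g x = y"
  shows "\<mu> = \<nu>"
proof -
  interpret \<mu>: prob_space \<mu> by fact
  interpret \<nu>: prob_space \<nu> by fact
  interpret P: pair_prob_space \<mu> \<nu> ..
  note [measurable_cong] = \<mu>(2) \<nu>(2)
  \<comment> \<open>Transitivity moves one centre to the other, invariance keeps the mass, and
    isometry on \<open>X\<close> makes the preimage of a ball a ball up to a null set. A generic
    \<open>M\<close> is used so that the fact applies to both measures.\<close>
  have ball_eq: "measure M (ball x e) = measure M (ball y e)"
    if M: "prob_space M" "sets M = sets borel" "AE x in M. x \<in> X" "\<And>g. g \<in> \<Gamma> \<Longrightarrow> distr M borel g = M"
      and xy: "x \<in> X" "y \<in> X" for M x y e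
  proof -
    obtain g where g: "g \<in> \<Gamma>" "g x = y" using trans xy by blast
    note [measurable_cong] = M(2)
    have [measurable]: "g \<in> borel_measurable borel" using meas g by blast
    interpret M: prob_space M by fact
    have "measure M (ball y e) = measure (distr M borel g) (ball y e)" using M(4)[OF g(1)] by simp
    also have "\<dots> = measure M (g -` ball y e \<inter> space M)"
      by (rule measure_distr) auto
    also have "\<dots> = measure M (ball x e)"
    proof (rule M.finite_measure_eq_AE)
      show "AE z in M. (z \<in> g -` ball y e \<inter> space M) = (z \<in> ball x e)"
        using M(3)
      proof eventually_elim
        case (elim z)
        thus ?case using iso[OF g(1) xy(1) elim] g(2) sets_eq_imp_space_eq[OF M(2)] by auto
      qed
    qed (measurable, use M(2) in auto)
    finally show ?thesis ..
  qed
  \<comment> \<open>Finitely many balls of radius \<open>e\<close> centred in \<open>X\<close> cover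
    its closure, and all have the same mass; were this mass zero, \<open>M\<close> would
    vanish.\<close>
  have pos: "measure M (ball x e) > 0"
    if M: "prob_space M" "sets M = sets borel" "AE x in M. x \<in> X" "\<And>g. g \<in> \<Gamma> \<Longrightarrow> distr M borel g = M"
      and xy: "x \<in> X" "e > 0" for M x e
  proof -
    interpret M: prob_space M by fact
    have "compact (closure X)" using bX by simp
    then obtain F where F: "finite F" "F \<subseteq> X" "closure X \<subseteq> (\<Union>c\<in>F. ball c e)"
    proof (rule compactE_image[of _ X "\<lambda>c. ball c e"])
      show "closure X \<subseteq> (\<Union>c\<in>X. ball c e)"
        using xy(2) by (auto simp: closure_approachable)
    qed auto
    have U: "(\<Union>c\<in>F. ball c e) \<in> sets M" unfolding M(2) by (intro borel_open open_UN) auto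
    have "AE x in M. x \<in> (\<Union>c\<in>F. ball c e)"
      using M(3)
    proof eventually_elim
      case (elim x) thus ?case using F(3) closure_subset[of X] by blast
    qed
    hence "1 = measure M (\<Union>c\<in>F. ball c e)" using M.prob_eq_1[OF U] by simp
    also have "\<dots> \<le> (\<Sum>c\<in>F. measure M (ball c e))"
      by (rule M.finite_measure_subadditive_finite) (simp_all add: F M(2) image_subset_iff)
    also have "\<dots> = card F * measure M (ball x e)"
      using ball_eq[OF M _ xy(1)] F(2) by (simp add: subset_eq)
    finally show ?thesis
      by (smt (verit) measure_nonneg mult_eq_0_iff mult_zero_right)
  qed
  have "\<exists>x. x \<in> X"
  proof (rule ccontr)
    assume "\<nexists>x. x \<in> X" hence "AE x in \<mu>. False" using \<mu>(3) by auto
    thus False by (simp add: \<mu>.emeasure_space_1)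
  qed
  then obtain x0 where x0: "x0 \<in> X" ..
  show ?thesis
  proof (rule borel_measure_eq_of_lipschitz[OF \<mu>(1) \<nu>(1) \<mu>(2) \<nu>(2)])
    fix f :: "'a \<Rightarrow> real" and L :: real
    assume L: "L \<ge> 0" "\<And>x y. \<bar>f x - f y\<bar> \<le> L * dist x y" and bnd: "\<And>x. 0 \<le> f x \<and> f x \<le> 1"
    have "L-lipschitz_on UNIV f" using L by (intro lipschitz_onI) (auto simp: dist_real_def)
    hence [measurable]: "f \<in> borel_measurable borel"
      by (intro borel_measurable_continuous_onI lipschitz_on_continuous_on)
    have key: "\<bar>(\<integral>x. f x \<partial>\<mu>) - (\<integral>x. f x \<partial>\<nu>)\<bar> \<le> L * e" if e: "e > 0" for e
    proof -
      \<comment> \<open>The strict inequality makes \<open>E\<close> open, so that the kernel is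
        Borel on the product.\<close>
      define E where "E = {z::'a \<times> 'a. dist (fst z) (snd z) < e}"
      define k where "k = (\<lambda>x y. indicator E (x,y) :: real)"
      have "open E" unfolding E_def by (intro open_Collect_less continuous_intros)
      hence [measurable]: "E \<in> sets (borel \<Otimes>\<^sub>M borel)"
        unfolding borel_prod by (rule borel_open)
      have [measurable]: "(\<lambda>(x,y). k x y) \<in> borel_measurable (borel \<Otimes>\<^sub>M borel)" unfolding k_def by measurable
      define c where "c = measure \<nu> (ball x0 e)"
      have c\<nu>: "(\<integral>y. k x y \<partial>\<nu>) = c" if "x \<in> X" for x
      proof -
        have "(\<integral>y. k x y \<partial>\<nu>) = (\<integral>y. indicator (ball x e) y \<partial>\<nu>)"
          by (rule Bochner_Integration.integral_cong) (auto simp: k_def E_def indicator_def)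
        thus ?thesis using ball_eq[OF \<nu> inv(2) that x0] \<nu>(2) unfolding c_def
          by (simp add: sets_eq_imp_space_eq[OF \<nu>(2)])
      qed
      define d where "d = measure \<mu> (ball x0 e)"
      have c\<mu>: "(\<integral>x. k x y \<partial>\<mu>) = d" if "y \<in> X" for y
      proof -
        have "(\<integral>x. k x y \<partial>\<mu>) = (\<integral>x. indicator (ball y e) x \<partial>\<mu>)"
          by (rule Bochner_Integration.integral_cong) (auto simp: k_def E_def indicator_def dist_commute)
        thus ?thesis using ball_eq[OF \<mu> inv(1) that x0] \<mu>(2) unfolding d_def
          by (simp add: sets_eq_imp_space_eq[OF \<mu>(2)])
      qed
      have int: "integrable (\<mu> \<Otimes>\<^sub>M \<nu>) (\<lambda>(x,y). g x y * k x y)"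
        if [measurable]: "(\<lambda>(x,y). g x y) \<in> borel_measurable (borel \<Otimes>\<^sub>M borel)" and b: "\<And>x y. \<bar>g x y\<bar> \<le> 1" for g
      proof (rule P.integrable_const_bound[where B=1])
        show "AE x in \<mu> \<Otimes>\<^sub>M \<nu>. norm (case x of (x, y) \<Rightarrow> g x y * k x y) \<le> 1"
          using b by (auto simp: k_def E_def indicator_def)
      qed measurable
      have fub1: "(\<integral>z. (case z of (x,y) \<Rightarrow> g x y) \<partial>(\<mu> \<Otimes>\<^sub>M \<nu>)) = (\<integral>x. (\<integral>y. g x y \<partial>\<nu>) \<partial>\<mu>)"
        if "integrable (\<mu> \<Otimes>\<^sub>M \<nu>) (\<lambda>(x,y). g x y)" for g :: "'a \<Rightarrow> 'a \<Rightarrow> real"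
        using P.integral_fst'[OF that] by simp
      have fub2: "(\<integral>z. (case z of (x,y) \<Rightarrow> g x y) \<partial>(\<mu> \<Otimes>\<^sub>M \<nu>)) = (\<integral>y. (\<integral>x. g x y \<partial>\<mu>) \<partial>\<nu>)"
        if "integrable (\<mu> \<Otimes>\<^sub>M \<nu>) (\<lambda>(x,y). g x y)" for g :: "'a \<Rightarrow> 'a \<Rightarrow> real"
        using P.integral_snd[OF that] by simp
      have I1: "(\<integral>z. (case z of (x,y) \<Rightarrow> f x * k x y) \<partial>(\<mu> \<Otimes>\<^sub>M \<nu>)) = c * (\<integral>x. f x \<partial>\<mu>)"
      proof -
        have "(\<integral>z. (case z of (x,y) \<Rightarrow> f x * k x y) \<partial>(\<mu> \<Otimes>\<^sub>M \<nu>)) = (\<integral>x. (\<integral>y. f x * k x y \<partial>\<nu>) \<partial>\<mu>)"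
          by (rule fub1) (use bnd in \<open>auto intro!: int\<close>)
        also have "\<dots> = (\<integral>x. f x * c \<partial>\<mu>)"
        proof (rule integral_cong_AE)
          show "AE x in \<mu>. (\<integral>y. f x * k x y \<partial>\<nu>) = f x * c"
            using \<mu>(3) by eventually_elim (simp add: c\<nu>)
        qed measurable
        finally show ?thesis by (simp add: mult.commute)
      qed
      have I2: "(\<integral>z. (case z of (x,y) \<Rightarrow> f y * k x y) \<partial>(\<mu> \<Otimes>\<^sub>M \<nu>)) = d * (\<integral>x. f x \<partial>\<nu>)"
      proof -
        have "(\<integral>z. (case z of (x,y) \<Rightarrow> f y * k x y) \<partial>(\<mu> \<Otimes>\<^sub>M \<nu>)) = (\<integral>y. (\<integral>x. f y * k x y \<partial>\<mu>) \<partial>\<nu>)"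
          by (rule fub2) (use bnd in \<open>auto intro!: int\<close>)
        also have "\<dots> = (\<integral>x. f x * d \<partial>\<nu>)"
        proof (rule integral_cong_AE)
          show "AE y in \<nu>. (\<integral>x. f y * k x y \<partial>\<mu>) = f y * d"
            using \<nu>(3) by eventually_elim (simp add: c\<mu>)
        qed measurable
        finally show ?thesis by (simp add: mult.commute)
      qed
      have J1: "(\<integral>z. (case z of (x,y) \<Rightarrow> 1 * k x y) \<partial>(\<mu> \<Otimes>\<^sub>M \<nu>)) = c"
      proof -
        have "(\<integral>z. (case z of (x,y) \<Rightarrow> 1 * k x y) \<partial>(\<mu> \<Otimes>\<^sub>M \<nu>)) = (\<integral>x. (\<integral>y. 1 * k x y \<partial>\<nu>) \<partial>\<mu>)"
          by (rule fub1[OF int]) auto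
        also have "\<dots> = (\<integral>x. c \<partial>\<mu>)"
        proof (rule integral_cong_AE)
          show "AE x in \<mu>. (\<integral>y. 1 * k x y \<partial>\<nu>) = c"
            using \<mu>(3) by eventually_elim (simp add: c\<nu>)
        qed measurable
        finally show ?thesis by (simp add: \<mu>.prob_space)
      qed
      have J2: "(\<integral>z. (case z of (x,y) \<Rightarrow> 1 * k x y) \<partial>(\<mu> \<Otimes>\<^sub>M \<nu>)) = d"
      proof -
        have "(\<integral>z. (case z of (x,y) \<Rightarrow> 1 * k x y) \<partial>(\<mu> \<Otimes>\<^sub>M \<nu>)) = (\<integral>y. (\<integral>x. 1 * k x y \<partial>\<mu>) \<partial>\<nu>)"
          by (rule fub2[OF int]) auto
        also have "\<dots> = (\<integral>x. d \<partial>\<nu>)"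
        proof (rule integral_cong_AE)
          show "AE y in \<nu>. (\<integral>x. 1 * k x y \<partial>\<mu>) = d"
            using \<nu>(3) by eventually_elim (simp add: c\<mu>)
        qed measurable
        finally show ?thesis by (simp add: \<nu>.prob_space)
      qed
      \<comment> \<open>The mass of the kernel, integrated in the two orders. Without this equality
        the factors in front of the two integrals of \<open>f\<close> could not be cancelled
        together.\<close>
      have cd: "d = c" using J1 J2 by simp
      have cpos: "c > 0" unfolding c_def using pos[OF \<nu> inv(2) x0 e] by simp
      have "c * \<bar>(\<integral>x. f x \<partial>\<mu>) - (\<integral>x. f x \<partial>\<nu>)\<bar>
          = \<bar>(\<integral>z. (case z of (x,y) \<Rightarrow> f x * k x y) \<partial>(\<mu> \<Otimes>\<^sub>M \<nu>)) - (\<integral>z. (case z of (x,y) \<Rightarrow> f y * k x y) \<partial>(\<mu> \<Otimes>\<^sub>M \<nu>))\<bar>"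
        unfolding I1 I2 cd using cpos by (simp add: abs_mult right_diff_distrib[symmetric])
      also have "\<dots> = \<bar>\<integral>z. (case z of (x,y) \<Rightarrow> f x * k x y) - (case z of (x,y) \<Rightarrow> f y * k x y) \<partial>(\<mu> \<Otimes>\<^sub>M \<nu>)\<bar>"
        by (subst Bochner_Integration.integral_diff) (use bnd in \<open>auto intro!: int\<close>)
      also have "\<dots> \<le> (\<integral>z. L * e * (case z of (x,y) \<Rightarrow> 1 * k x y) \<partial>(\<mu> \<Otimes>\<^sub>M \<nu>))"
      proof (rule order_trans[OF integral_abs_bound integral_mono])
        show "integrable (\<mu> \<Otimes>\<^sub>M \<nu>) (\<lambda>z. \<bar>(case z of (x,y) \<Rightarrow> f x * k x y) - (case z of (x,y) \<Rightarrow> f y * k x y)\<bar>)"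
          by (intro integrable_abs Bochner_Integration.integrable_diff) (use bnd in \<open>auto intro!: int\<close>)
        show "integrable (\<mu> \<Otimes>\<^sub>M \<nu>) (\<lambda>z. L * e * (case z of (x,y) \<Rightarrow> 1 * k x y))"
          by (intro integrable_mult_right int) auto
        show "\<bar>(case z of (x,y) \<Rightarrow> f x * k x y) - (case z of (x,y) \<Rightarrow> f y * k x y)\<bar>
            \<le> L * e * (case z of (x,y) \<Rightarrow> 1 * k x y)" for z
        proof (cases z)
          case (Pair x y)
          show ?thesis
          proof (cases "dist x y < e")
            case True
            have "L * dist x y \<le> L * e" using True L(1) by (intro mult_left_mono) auto
            thus ?thesis using Pair True L(2)[of x y] by (auto simp: k_def E_def)
          qed (simp add: Pair k_def E_def)
        qed
      qed
      also have "\<dots> = c * (L * e)" by (subst integral_mult_right_zero, subst J1) simp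
      finally show ?thesis using cpos by simp
    qed
    have "\<bar>(\<integral>x. f x \<partial>\<mu>) - (\<integral>x. f x \<partial>\<nu>)\<bar> \<le> 0"
    proof (rule field_le_epsilon)
      fix e :: real assume e: "e > 0"
      \<comment> \<open>Dividing by \<open>L + 1\<close> instead of \<open>L\<close> covers constant
        functions.\<close>
      have "\<bar>(\<integral>x. f x \<partial>\<mu>) - (\<integral>x. f x \<partial>\<nu>)\<bar> \<le> L * (e / (L + 1))"
        by (rule key) (use e L(1) in \<open>simp add: add_nonneg_pos\<close>)
      also have "\<dots> \<le> e" using L(1) e by (simp add: field_simps)
      finally show "\<bar>(\<integral>x. f x \<partial>\<mu>) - (\<integral>x. f x \<partial>\<nu>)\<bar> \<le> 0 + e" by simp
    qed
    thus "(\<integral>x. f x \<partial>\<mu>) = (\<integral>x. f x \<partial>\<nu>)" by simp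
  qed
qed

subsection \<open>Rotation invariance and orthonormal bases\<close>

lemma nn_integral_lborel_translate:
  fixes f :: "'a::euclidean_space \<Rightarrow> ennreal"
  assumes [measurable]: "f \<in> borel_measurable borel"
  shows "(\<integral>\<^sup>+y. f (c + y) \<partial>lborel) = (\<integral>\<^sup>+y. f y \<partial>lborel)"
proof -
  have "(\<integral>\<^sup>+y. f y \<partial>lborel) = (\<integral>\<^sup>+y. f y \<partial>distr lborel borel ((+) c))" by (simp add: lborel_distr_plus)
  also have "\<dots> = (\<integral>\<^sup>+y. f (c + y) \<partial>lborel)" by (rule nn_integral_distr) auto
  finally show ?thesis ..
qed

lemma measurable_orthogonal_transformation:
  fixes T :: "'a::euclidean_space \<Rightarrow> 'a"
  assumes "orthogonal_transformation T"
  shows "T \<in> borel_measurable borel"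
  by (intro borel_measurable_continuous_onI linear_continuous_on)
     (use assms orthogonal_transformation_linear linear_conv_bounded_linear in blast)

text \<open>Both sides are evaluated through the convolution of \<open>B\<close> with the unit ball, which is the
  only set whose rotation invariance is used.\<close>

lemma lborel_distr_orthogonal:
  fixes T :: "'a::euclidean_space \<Rightarrow> 'a"
  assumes T: "orthogonal_transformation T"
  shows "distr lborel borel T = lborel"
proof (rule measure_eqI)
  fix B assume "B \<in> sets (distr lborel borel T)"
  hence B[measurable]: "B \<in> sets borel" by simp
  have [measurable]: "T \<in> borel_measurable borel" by (rule measurable_orthogonal_transformation[OF T])
  have lin: "linear T" using T by (rule orthogonal_transformation_linear)
  define A where "A = (ball 0 1 :: 'a set)"
  have [measurable]: "A \<in> sets borel" by (simp add: A_def)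
  have surj: "\<exists>x'. x = T x'" for x using orthogonal_transformation_surj[OF T] by (metis surjD)
  \<comment> \<open>The sign is chosen to match \<open>x - T y = T (x' - y)\<close>: membership of
    this point in \<open>A\<close> becomes membership of a translate of \<open>y\<close> in
    \<open>A\<close>.\<close>
  have TA: "T z \<in> A \<longleftrightarrow> - z \<in> A" for z by (simp add: A_def orthogonal_transformation_norm[OF T])
  have posA: "emeasure lborel A \<noteq> 0" "emeasure lborel A \<noteq> \<infinity>"
    using emeasure_lborel_ball_finite[of 0 1] open_ball
    by (auto simp: A_def emeasure_ball ennreal_eq_0_iff not_le)
  have "emeasure lborel A * emeasure (distr lborel borel T) B = (\<integral>\<^sup>+x. indicator A x * emeasure (distr lborel borel T) B \<partial>lborel)"
    by (simp add: nn_integral_multc)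
  also have "\<dots> = (\<integral>\<^sup>+x. (\<integral>\<^sup>+y. indicator A x * indicator B (x + T y) \<partial>lborel) \<partial>lborel)"
  proof (rule nn_integral_cong)
    fix x :: 'a
    obtain x' where x': "x = T x'" using surj by blast
    have "(\<integral>\<^sup>+y. indicator B (x + T y) \<partial>lborel) = (\<integral>\<^sup>+y. indicator B (T (x' + y)) \<partial>lborel)"
      by (simp add: x' linear_add[OF lin])
    also have "\<dots> = (\<integral>\<^sup>+y. indicator B (T y) \<partial>lborel)"
      by (rule nn_integral_lborel_translate) measurable
    also have "\<dots> = (\<integral>\<^sup>+y. indicator B y \<partial>distr lborel borel T)"
      by (rule nn_integral_distr[symmetric]) measurable
    finally show "indicator A x * emeasure (distr lborel borel T) B = (\<integral>\<^sup>+y. indicator A x * indicator B (x + T y) \<partial>lborel)"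
      by (simp add: nn_integral_cmult)
  qed
  also have "\<dots> = (\<integral>\<^sup>+y. (\<integral>\<^sup>+x. indicator A x * indicator B (x + T y) \<partial>lborel) \<partial>lborel)"
    by (rule lborel_pair.Fubini'[symmetric]) measurable
  also have "\<dots> = (\<integral>\<^sup>+y. (\<integral>\<^sup>+x. indicator A (x - T y) * indicator B x \<partial>lborel) \<partial>lborel)"
  proof (rule nn_integral_cong)
    fix y :: 'a
    have "(\<integral>\<^sup>+x. indicator A x * indicator B (x + T y) \<partial>lborel)
        = (\<integral>\<^sup>+x. indicator A ((T y + x) - T y) * indicator B (T y + x) \<partial>lborel)"
      by (simp add: add.commute)
    also have "\<dots> = (\<integral>\<^sup>+x. indicator A (x - T y) * indicator B x \<partial>lborel)"
      by (rule nn_integral_lborel_translate[of "\<lambda>z. indicator A (z - T y) * indicator B z"]) measurable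
    finally show "(\<integral>\<^sup>+x. indicator A x * indicator B (x + T y) \<partial>lborel) = \<dots>" .
  qed
  also have "\<dots> = (\<integral>\<^sup>+x. (\<integral>\<^sup>+y. indicator A (x - T y) * indicator B x \<partial>lborel) \<partial>lborel)"
    by (rule lborel_pair.Fubini') measurable
  also have "\<dots> = (\<integral>\<^sup>+x. emeasure lborel A * indicator B x \<partial>lborel)"
  proof (rule nn_integral_cong)
    fix x :: 'a
    obtain x' where x': "x = T x'" using surj by blast
    have "x - T y \<in> A \<longleftrightarrow> - x' + y \<in> A" for y
      unfolding x' linear_diff[OF lin, symmetric] TA by simp
    hence "(\<integral>\<^sup>+y. indicator A (x - T y) \<partial>lborel) = (\<integral>\<^sup>+y. indicator A (- x' + y) \<partial>lborel)"
      by (intro nn_integral_cong) (simp add: indicator_def)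
    also have "\<dots> = (\<integral>\<^sup>+y. indicator A y \<partial>lborel)"
      by (rule nn_integral_lborel_translate) measurable
    finally show "(\<integral>\<^sup>+y. indicator A (x - T y) * indicator B x \<partial>lborel) = emeasure lborel A * indicator B x"
      by (simp add: nn_integral_multc)
  qed
  also have "\<dots> = emeasure lborel A * emeasure lborel B" by (simp add: nn_integral_cmult)
  finally show "emeasure (distr lborel borel T) B = emeasure lborel B"
    using posA by (simp add: ennreal_mult_cancel_left)
qed simp

section \<open>The uniform distribution on the unit ball\<close>

definition unif_ball :: "'a::euclidean_space measure" where
  "unif_ball = uniform_measure lborel (cball 0 1)"

lemma emeasure_cball_bounds:
  "emeasure lborel (cball 0 1 :: 'a::euclidean_space set) \<noteq> 0"
  "emeasure lborel (cball 0 1 :: 'a::euclidean_space set) \<noteq> \<infinity>"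
  using emeasure_lborel_cball_finite[of "0::'a" 1]
  by (auto simp: emeasure_cball ennreal_eq_0_iff not_le)

lemma sets_unif_ball [measurable_cong, simp]: "sets unif_ball = sets borel"
  by (simp add: unif_ball_def)

lemma space_unif_ball [simp]: "space unif_ball = UNIV"
  by (simp add: unif_ball_def)

lemma prob_space_unif_ball: "prob_space unif_ball"
  unfolding unif_ball_def by (rule prob_space_uniform_measure[OF emeasure_cball_bounds])

lemma AE_unif_ballI: "AE x in lborel. P x \<Longrightarrow> AE x in unif_ball. P x"
  unfolding unif_ball_def by (rule AE_uniform_measureI) auto

lemma distr_unif_ball_orthogonal:
  fixes T :: "'a::euclidean_space \<Rightarrow> 'a"
  assumes T: "orthogonal_transformation T"
  shows "distr unif_ball borel T = unif_ball"
proof (rule measure_eqI)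
  fix B assume "B \<in> sets (distr unif_ball borel T)"
  hence B[measurable]: "B \<in> sets borel" by simp
  have [measurable]: "T \<in> borel_measurable borel" by (rule measurable_orthogonal_transformation[OF T])
  have "emeasure lborel (cball 0 1 \<inter> T -` B) = emeasure lborel (T -` (cball 0 1 \<inter> B) \<inter> space lborel)"
    by (rule arg_cong[where f="emeasure lborel"]) (auto simp: orthogonal_transformation_norm[OF T])
  also have "\<dots> = emeasure (distr lborel borel T) (cball 0 1 \<inter> B)"
    by (rule emeasure_distr[symmetric]) auto
  finally show "emeasure (distr unif_ball borel T) B = emeasure unif_ball B"
    using measurable_sets_borel[of T borel B]
    by (simp add: emeasure_distr unif_ball_def emeasure_uniform_measure lborel_distr_orthogonal[OF T])
qed simp

text \<open>Puts random vectors in general position: almost surely no Gram-Schmidt step meets a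
  vector already in the span.\<close>

lemma AE_lborel_not_in_subspace:
  fixes S :: "'a::euclidean_space set"
  assumes "subspace S" "S \<noteq> UNIV"
  shows "AE y in lborel. y \<notin> S"
proof -
  have "dim S < DIM('a)"
    using assms by (metis dim_eq_full dim_subset_UNIV le_neq_implies_less span_eq_iff)
  hence "negligible S" by (rule negligible_lowdim)
  moreover have "S \<in> sets borel" using closed_subspace[OF assms(1)] by auto
  ultimately have "S \<in> null_sets lborel"
    by (simp add: negligible_iff_null_sets null_sets_completion_iff)
  thus ?thesis by (rule AE_not_in)
qed

lemmas AE_unif_ball_not_in_subspace = AE_unif_ballI[OF AE_lborel_not_in_subspace]

lemma AE_unif_ball_nonzero: "AE y in unif_ball. (y :: real^'n) \<noteq> 0"
proof -
  have "AE y in unif_ball. (y :: real^'n) \<notin> {0}"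
    by (rule AE_unif_ball_not_in_subspace) (auto intro!: exI[of _ "1::real^'n"])
  thus ?thesis by simp
qed

lemma AE_lborel_norm_neq: "AE x in lborel. norm (x :: 'a::euclidean_space) \<noteq> 1"
proof -
  have "negligible (sphere (0::'a) 1)" by (rule negligible_sphere)
  hence "sphere (0::'a) 1 \<in> null_sets lborel" by (simp add: negligible_iff_null_sets null_sets_completion_iff)
  hence "AE x in lborel. x \<notin> sphere (0::'a) 1" by (rule AE_not_in)
  thus ?thesis by simp
qed

section \<open>Orthonormal bases and orthogonal maps between them\<close>

lemma orthonormal_basis_ofD:
  assumes "orthonormal_basis_of B \<xi>"
  shows "finite B" "independent B" "card B = dim \<xi>" "0 \<notin> B" "B \<subseteq> \<xi>" "span B = \<xi>"
    "pairwise orthogonal B" "\<And>b. b \<in> B \<Longrightarrow> norm b = 1"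
proof -
  show *: "pairwise orthogonal B" "\<And>b. b \<in> B \<Longrightarrow> norm b = 1" "span B = \<xi>" "0 \<notin> B"
    using assms by (auto simp: orthonormal_basis_of_def)
  show "independent B" using * pairwise_orthogonal_independent by blast
  thus "finite B" by (rule independent_imp_finite)
  show "card B = dim \<xi>" using \<open>independent B\<close> *(3) dim_eq_card_independent[of B] dim_span[of B] by simp
  show "B \<subseteq> \<xi>" using *(3) span_superset by blast
qed

lemma orthonormal_basis_inner:
  assumes "orthonormal_basis_of B \<xi>" "b \<in> B" "c \<in> B"
  shows "b \<bullet> c = (if b = c then 1 else 0)"
  using orthonormal_basis_ofD(7,8)[OF assms(1)] assms(2,3)
  by (auto simp: pairwise_def orthogonal_def norm_eq_1)

lemma orthonormal_basis_exists: "subspace \<xi> \<Longrightarrow> \<exists>B. orthonormal_basis_of B \<xi>"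
  unfolding orthonormal_basis_of_def by (metis orthonormal_basis_subspace)

text \<open>An orthonormal basis of the orthogonal complement of \<open>V\<close> in
  \<open>W\<close> is adjoined; a dimension count shows that the union spans
  \<open>W\<close>.\<close>

lemma orthonormal_basis_extend:
  assumes B: "orthonormal_basis_of B V" and V: "V \<subseteq> W" "subspace W"
  obtains C where "orthonormal_basis_of C W" "B \<subseteq> C"
proof -
  note D = orthonormal_basis_ofD[OF B]
  define W' where "W' = {y \<in> W. \<forall>x\<in>V. orthogonal x y}"
  have sV: "subspace V" using D(6) subspace_span by blast
  have "subspace W'"
    using V(2) unfolding W'_def subspace_def by (auto simp: orthogonal_def inner_add_right)
  then obtain C where C: "orthonormal_basis_of C W'" using orthonormal_basis_exists by blast
  note E = orthonormal_basis_ofD[OF C]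
  have orth: "orthogonal x y" if "x \<in> B" "y \<in> C" for x y
    using that D(5) E(5) unfolding W'_def by blast
  have pw: "pairwise orthogonal (B \<union> C)"
    unfolding pairwise_def
  proof (intro ballI impI)
    fix x y assume "x \<in> B \<union> C" "y \<in> B \<union> C" "x \<noteq> y"
    thus "orthogonal x y"
      using pairwiseD[OF D(7), of x y] pairwiseD[OF E(7), of x y] orth[of x y] orth[of y x]
      by (auto simp: orthogonal_commute[of x y])
  qed
  have n: "\<forall>b\<in>B \<union> C. norm b = 1" using D(8) E(8) by auto
  have sub: "span (B \<union> C) \<subseteq> W"
    using D(5) E(5) V by (intro span_minimal) (auto simp: W'_def)
  have "dim (span (B \<union> C)) = dim B + dim C"
    using dim_orthogonal_sum[of B C] orth by (simp add: orthogonal_def)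
  also have "\<dots> = dim V + dim W'" using D(6) E(6) by (metis dim_span)
  also have "\<dots> = dim W"
    using dim_subspace_orthogonal_to_vectors[OF sV V(2) V(1)] unfolding W'_def by simp
  finally have "span (B \<union> C) = W"
    by (intro subspace_dim_equal sub V subspace_span) simp
  hence "orthonormal_basis_of (B \<union> C) W" using pw n by (simp add: orthonormal_basis_of_def)
  thus thesis by (rule that) auto
qed

lemma orthonormal_basis_expansion:
  assumes "orthonormal_basis_of B UNIV"
  shows "(\<Sum>b\<in>B. (x \<bullet> b) *\<^sub>R b) = x"
  using orthonormal_basis_ofD[OF assms] by (intro orthonormal_basis_expand) auto

lemma orthogonal_transformation_of_bases:
  assumes B: "orthonormal_basis_of B UNIV" and C: "orthonormal_basis_of C UNIV"
    and \<phi>: "bij_betw \<phi> B C"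
  obtains T where "orthogonal_transformation T" "\<And>b. b \<in> B \<Longrightarrow> T b = \<phi> b"
proof
  define T where "T = (\<lambda>x. \<Sum>b\<in>B. (x \<bullet> b) *\<^sub>R \<phi> b)"
  note D = orthonormal_basis_ofD[OF B]
  have inner: "\<phi> b \<bullet> \<phi> c = (if b = c then 1 else 0)" if "b \<in> B" "c \<in> B" for b c
    using orthonormal_basis_inner[OF C, of "\<phi> b" "\<phi> c"] that \<phi>
    by (auto simp: bij_betw_def inj_on_def)
  show "orthogonal_transformation T"
    unfolding orthogonal_transformation_def
  proof (intro conjI allI)
    show "linear T" unfolding T_def
      by (rule linearI) (simp_all add: inner_add_left scaleR_add_left sum.distrib scaleR_sum_right)
    fix x y
    have "T x \<bullet> T y = (\<Sum>b\<in>B. \<Sum>c\<in>B. (x \<bullet> b) * (y \<bullet> c) * (\<phi> b \<bullet> \<phi> c))"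
    proof -
      have "\<phi> b \<bullet> T y = (\<Sum>c\<in>B. (y \<bullet> c) * (\<phi> b \<bullet> \<phi> c))" for b
        by (simp add: T_def inner_sum_right)
      moreover have "T x \<bullet> T y = (\<Sum>b\<in>B. (x \<bullet> b) * (\<phi> b \<bullet> T y))"
        by (subst T_def) (simp add: inner_sum_left)
      ultimately show ?thesis by (simp add: sum_distrib_left mult_ac)
    qed
    also have "\<dots> = (\<Sum>b\<in>B. \<Sum>c\<in>B. if c = b then (x \<bullet> b) * (y \<bullet> c) else 0)"
      by (intro sum.cong) (auto simp: inner)
    also have "\<dots> = (\<Sum>b\<in>B. (x \<bullet> b) * (y \<bullet> b))" using D(1) by (simp add: sum.delta)
    also have "\<dots> = x \<bullet> (\<Sum>b\<in>B. (y \<bullet> b) *\<^sub>R b)" by (simp add: inner_sum_right mult.commute)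
    finally show "T x \<bullet> T y = x \<bullet> y" by (simp add: orthonormal_basis_expansion[OF B])
  qed
  show "T b = \<phi> b" if "b \<in> B" for b
  proof -
    have "T b = (\<Sum>c\<in>B. if c = b then \<phi> c else 0)"
      unfolding T_def using orthonormal_basis_inner[OF B that] by (intro sum.cong) auto
    thus ?thesis using D(1) that by simp
  qed
qed

text \<open>Bases of the smaller space, the larger space and the whole space, each extending the
  preceding one, are matched block by block. This supplies the transitivity needed for uniqueness of
  invariant measures: with a plane inside \<open>V\<close> for Grassmannians, and with a line inside
  a plane for flags.\<close>

lemma orthogonal_transformation_nested_subspaces:
  fixes V W V' W' :: "(real^'n) set"
  assumes sub: "subspace V" "subspace W" "subspace V'" "subspace W'"
    and le: "V \<subseteq> W" "V' \<subseteq> W'" and dims: "dim V = dim V'" "dim W = dim W'"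
  obtains T where "orthogonal_transformation T" "T ` V = V'" "T ` W = W'"
proof -
  obtain B1 where B1: "orthonormal_basis_of B1 V" using orthonormal_basis_exists[OF sub(1)] by blast
  obtain B2 where B2: "orthonormal_basis_of B2 W" "B1 \<subseteq> B2"
    using orthonormal_basis_extend[OF B1 le(1) sub(2)] by blast
  obtain B3 where B3: "orthonormal_basis_of B3 UNIV" "B2 \<subseteq> B3"
    using orthonormal_basis_extend[OF B2(1) subset_UNIV subspace_UNIV] by blast
  note B = B1 B2(1) B3(1) B2(2) B3(2)
  obtain C1 where C1: "orthonormal_basis_of C1 V'" using orthonormal_basis_exists[OF sub(3)] by blast
  obtain C2 where C2: "orthonormal_basis_of C2 W'" "C1 \<subseteq> C2"
    using orthonormal_basis_extend[OF C1 le(2) sub(4)] by blast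
  obtain C3 where C3: "orthonormal_basis_of C3 UNIV" "C2 \<subseteq> C3"
    using orthonormal_basis_extend[OF C2(1) subset_UNIV subspace_UNIV] by blast
  note C = C1 C2(1) C3(1) C2(2) C3(2)
  have fin: "finite B1" "finite B2" "finite B3" "finite C1" "finite C2" "finite C3"
    using B(1-3) C(1-3) by (simp_all add: orthonormal_basis_ofD(1))
  have cards: "card B1 = card C1" "card B2 = card C2" "card B3 = card C3"
    using B(1-3) C(1-3) dims by (simp_all add: orthonormal_basis_ofD(3))
  obtain f where f: "bij_betw f B1 C1" using fin cards(1) finite_same_card_bij by blast
  obtain g where g: "bij_betw g (B2 - B1) (C2 - C1)"
    using fin cards B(4) C(4) finite_same_card_bij[of "B2 - B1" "C2 - C1"] by (auto simp: card_Diff_subset)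
  obtain k where k: "bij_betw k (B3 - B2) (C3 - C2)"
    using fin cards B(5) C(5) finite_same_card_bij[of "B3 - B2" "C3 - C2"] by (auto simp: card_Diff_subset)
  define \<phi> where "\<phi> = (\<lambda>x. if x \<in> B1 then f x else if x \<in> B2 then g x else k x)"
  have b1: "bij_betw \<phi> B1 C1"
    using f by (subst bij_betw_cong[where g=f]) (auto simp: \<phi>_def)
  have "bij_betw \<phi> (B2 - B1) (C2 - C1)"
    using g by (subst bij_betw_cong[where g=g]) (auto simp: \<phi>_def)
  hence b2: "bij_betw \<phi> B2 C2"
    using bij_betw_combine[OF b1, of "B2 - B1" "C2 - C1"] B(4) C(4) by (simp add: Un_absorb1)
  have "bij_betw \<phi> (B3 - B2) (C3 - C2)"
    using k B(4) by (subst bij_betw_cong[where g=k]) (auto simp: \<phi>_def)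
  hence b3: "bij_betw \<phi> B3 C3"
    using bij_betw_combine[OF b2, of "B3 - B2" "C3 - C2"] B(5) C(5) by (simp add: Un_absorb1)
  obtain T where T: "orthogonal_transformation T" "\<And>b. b \<in> B3 \<Longrightarrow> T b = \<phi> b"
    using orthogonal_transformation_of_bases[OF B(3) C(3) b3] by blast
  have lin: "linear T" using T(1) by (rule orthogonal_transformation_linear)
  have "T ` B1 = \<phi> ` B1" "T ` B2 = \<phi> ` B2"
    using B(4,5) by (auto intro!: image_cong T(2))
  hence "T ` B1 = C1" "T ` B2 = C2"
    using bij_betw_imp_surj_on[OF b1] bij_betw_imp_surj_on[OF b2] by simp_all
  hence "T ` span B1 = span C1" "T ` span B2 = span C2"
    using linear_span_image[OF lin] by metis+
  hence "T ` V = V'" "T ` W = W'"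
    using B(1,2) C(1,2) by (simp_all add: orthonormal_basis_ofD(6))
  thus thesis using that T(1) by blast
qed

subsection \<open>Projection matrices\<close>

definition is_proj :: "real^'n^'n \<Rightarrow> bool" where
  "is_proj A \<longleftrightarrow> transpose A = A \<and> A ** A = A"

abbreviation proj_mat :: "(real^'n) set \<Rightarrow> real^'n^'n" where
  "proj_mat \<xi> \<equiv> matrix (closest_point \<xi>)"

lemma is_projD:
  assumes "is_proj A"
  shows "A *v (A *v x) = A *v x" "(A *v x) \<bullet> y = x \<bullet> (A *v y)"
proof -
  show "A *v (A *v x) = A *v x" using assms by (simp add: is_proj_def matrix_vector_mul_assoc)
  have "A *v x = x v* A" using assms by (metis is_proj_def transpose_matrix_vector)
  thus "(A *v x) \<bullet> y = x \<bullet> (A *v y)" by (simp add: dot_lmul_matrix)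
qed

lemma is_projI:
  fixes A :: "real^'n^'n"
  assumes "\<And>x y. (A *v x) \<bullet> y = x \<bullet> (A *v y)" "\<And>x. A *v (A *v x) = A *v x"
  shows "is_proj A"
proof -
  have "transpose A *v x = A *v x" for x
  proof (rule vector_eq_rdot[THEN iffD1], rule allI)
    show "(transpose A *v x) \<bullet> y = (A *v x) \<bullet> y" for y using assms(1) by (simp add: dot_lmul_matrix)
  qed
  thus ?thesis using assms(2) by (simp add: is_proj_def matrix_eq matrix_vector_mul_assoc)
qed

text \<open>By Pythagoras, an error orthogonal to the subspace can only be enlarged by moving within
  the subspace. Later projections are identified through this criterion.\<close>

lemma closest_point_eqI:
  fixes \<xi> :: "'a::euclidean_space set"
  assumes "subspace \<xi>" "y \<in> \<xi>" and orth: "\<And>z. z \<in> \<xi> \<Longrightarrow> (x - y) \<bullet> z = 0"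
  shows "closest_point \<xi> x = y"
proof (rule closest_point_unique[symmetric])
  show "\<forall>z\<in>\<xi>. dist x y \<le> dist x z"
  proof
    fix z assume "z \<in> \<xi>"
    hence "(x - y) \<bullet> (y - z) = 0" using orth assms(1,2) subspace_diff by blast
    hence "(norm (x - z))\<^sup>2 = (norm (x - y))\<^sup>2 + (norm (y - z))\<^sup>2"
      using norm_add_Pythagorean[of "x - y" "y - z"] by (simp add: orthogonal_def)
    hence "(norm (x - y))\<^sup>2 \<le> (norm (x - z))\<^sup>2" by simp
    thus "dist x y \<le> dist x z" by (simp add: dist_norm)
  qed
qed (use assms in \<open>auto intro: closed_subspace subspace_imp_convex\<close>)

lemma closest_point_orthonormal_basis:
  assumes B: "orthonormal_basis_of B \<xi>"
  shows "closest_point \<xi> x = (\<Sum>b\<in>B. (x \<bullet> b) *\<^sub>R b)"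
proof (rule closest_point_eqI)
  note D = orthonormal_basis_ofD[OF B]
  show sub: "subspace \<xi>" using D(6) subspace_span by blast
  show "(\<Sum>b\<in>B. (x \<bullet> b) *\<^sub>R b) \<in> \<xi>"
    using D(5) by (intro subspace_sum[OF sub] subspace_scale[OF sub]) auto
  fix z assume "z \<in> \<xi>"
  hence "z \<in> span B" using D(6) by simp
  thus "(x - (\<Sum>b\<in>B. (x \<bullet> b) *\<^sub>R b)) \<bullet> z = 0"
  proof (induction rule: span_induct)
    case base show ?case by (simp add: subspace_def inner_add_right)
  next
    case (step c)
    have "(\<Sum>b\<in>B. (x \<bullet> b) *\<^sub>R b) \<bullet> c = (\<Sum>b\<in>B. if b = c then x \<bullet> c else 0)"
      using orthonormal_basis_inner[OF B _ step] unfolding inner_sum_left by (intro sum.cong) auto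
    thus ?case using D(1) step by (simp add: inner_diff_left)
  qed
qed

lemma proj_mat_vector:
  assumes "subspace \<xi>"
  shows "proj_mat \<xi> *v x = closest_point \<xi> x"
proof -
  obtain B where "orthonormal_basis_of B \<xi>" using orthonormal_basis_exists assms by blast
  hence "linear (closest_point \<xi>)"
    by (intro linearI) (simp_all add: closest_point_orthonormal_basis inner_add_left scaleR_add_left
        sum.distrib scaleR_sum_right)
  thus ?thesis by (metis matrix_vector_mul(2))
qed

lemma proj_mat_basis:
  assumes "orthonormal_basis_of B \<xi>"
  shows "proj_mat \<xi> *v x = (\<Sum>b\<in>B. (x \<bullet> b) *\<^sub>R b)"
proof -
  have "subspace \<xi>" using orthonormal_basis_ofD(6)[OF assms] subspace_span by blast
  thus ?thesis by (simp add: proj_mat_vector closest_point_orthonormal_basis[OF assms])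
qed

lemma proj_mat_in: "subspace \<xi> \<Longrightarrow> proj_mat \<xi> *v x \<in> \<xi>"
  by (metis closed_subspace closest_point_in_set empty_iff proj_mat_vector subspace_0)

lemma proj_mat_fix: "subspace \<xi> \<Longrightarrow> proj_mat \<xi> *v x = x \<longleftrightarrow> x \<in> \<xi>"
  by (metis closed_subspace closest_point_refl empty_iff proj_mat_vector subspace_0)

lemma range_proj_mat: "subspace \<xi> \<Longrightarrow> range ((*v) (proj_mat \<xi>)) = \<xi>"
  using proj_mat_in proj_mat_fix by (metis image_subset_iff rangeI subsetI subset_antisym)

lemma is_proj_proj_mat:
  assumes "subspace \<xi>" shows "is_proj (proj_mat \<xi>)"
proof -
  obtain B where B: "orthonormal_basis_of B \<xi>" using orthonormal_basis_exists assms by blast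
  show ?thesis
  proof (rule is_projI)
    show "(proj_mat \<xi> *v x) \<bullet> y = x \<bullet> (proj_mat \<xi> *v y)" for x y
      by (simp add: proj_mat_basis[OF B] inner_sum_left inner_sum_right inner_commute mult.commute)
    show "proj_mat \<xi> *v (proj_mat \<xi> *v x) = proj_mat \<xi> *v x" for x
      using proj_mat_fix[OF assms] proj_mat_in[OF assms] by blast
  qed
qed

lemma proj_mat_range:
  assumes A: "is_proj A"
  shows "proj_mat (range ((*v) A)) = A"
proof -
  have sub: "subspace (range ((*v) A))" by (intro linear_subspace_image) auto
  have "proj_mat (range ((*v) A)) *v x = A *v x" for x
    unfolding proj_mat_vector[OF sub]
  proof (rule closest_point_eqI[OF sub])
    fix z assume "z \<in> range ((*v) A)"
    then obtain y where y: "z = A *v y" by blast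
    show "(x - A *v x) \<bullet> z = 0"
      unfolding y is_projD(2)[OF A, symmetric] by (simp add: matrix_vector_mult_diff_distrib is_projD(1)[OF A])
  qed simp
  thus ?thesis by (simp add: matrix_eq)
qed

text \<open>The trace is continuous in the matrix, so that prescribing the dimension becomes a
  closed condition. The identity follows by summing the squares of the coordinates of an orthonormal
  basis in the other order.\<close>

lemma trace_proj_mat:
  fixes \<xi> :: "(real^'n) set"
  assumes "subspace \<xi>"
  shows "trace (proj_mat \<xi>) = real (dim \<xi>)"
proof -
  obtain B where B: "orthonormal_basis_of B \<xi>" using orthonormal_basis_exists assms by blast
  have "proj_mat \<xi> $ i $ i = (\<Sum>b\<in>B. b $ i * b $ i)" for i
    by (simp add: matrix_def closest_point_orthonormal_basis[OF B] inner_axis')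
  hence "trace (proj_mat \<xi>) = (\<Sum>b\<in>B. b \<bullet> b)"
    unfolding trace_def inner_vec_def inner_real_def by (simp only: ) (rule sum.swap)
  also have "\<dots> = real (dim \<xi>)"
    using orthonormal_basis_ofD(3,8)[OF B] by (simp add: dot_square_norm)
  finally show ?thesis .
qed

lemma is_proj_trace: "is_proj A \<Longrightarrow> trace A = real (dim (range ((*v) A)))"
  using trace_proj_mat[of "range ((*v) A)"] by (simp add: proj_mat_range linear_subspace_image)

text \<open>A matrix of nonzero trace is not zero, so its kernel is a proper subspace. Hence
  \<open>sgn (A *v x)\<close> is almost surely a unit vector.\<close>

lemma AE_lborel_matrix_vector_nonzero:
  fixes A :: "real^'n^'n"
  assumes "trace A \<noteq> 0"
  shows "AE x in lborel. A *v x \<noteq> 0"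
proof -
  have "subspace {x. A *v x = 0}"
    by (auto simp: subspace_def matrix_vector_right_distrib matrix_vector_mult_scaleR)
  moreover have "{x. A *v x = 0} \<noteq> UNIV"
  proof
    assume "{x. A *v x = 0} = UNIV"
    hence "A *v x = 0 *v x" for x by auto
    hence "A = 0" by (simp add: matrix_eq)
    thus False using assms by (simp add: trace_def)
  qed
  ultimately have "AE x in lborel. x \<notin> {x. A *v x = 0}" by (rule AE_lborel_not_in_subspace)
  thus ?thesis by simp
qed

lemma AE_lborel_proj_nonzero:
  fixes \<xi> :: "(real^'n) set"
  assumes "subspace \<xi>" "dim \<xi> \<ge> 1"
  shows "AE x in lborel. proj_mat \<xi> *v x \<noteq> 0"
proof (rule AE_lborel_matrix_vector_nonzero)
  show "trace (proj_mat \<xi>) \<noteq> 0"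
    unfolding trace_proj_mat[OF assms(1)] of_nat_eq_0_iff using assms(2) by (metis not_one_le_zero)
qed

section \<open>Conjugation of projections by orthogonal maps\<close>

definition conj_mat :: "(real^'n \<Rightarrow> real^'n) \<Rightarrow> real^'n^'n \<Rightarrow> real^'n^'n" where
  "conj_mat T A = matrix T ** A ** transpose (matrix T)"

lemma orthogonal_matrix_vector:
  fixes T :: "real^'n \<Rightarrow> real^'n"
  assumes T: "orthogonal_transformation T"
  shows "matrix T *v x = T x" "transpose (matrix T) *v (T x) = x"
proof -
  show *: "matrix T *v x = T x"
    using orthogonal_transformation_linear[OF T] by (metis matrix_vector_mul(2))
  have "transpose (matrix T) ** matrix T = mat 1"
    using T by (simp add: orthogonal_transformation_matrix orthogonal_matrix_def)
  thus "transpose (matrix T) *v (T x) = x"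
    by (metis * matrix_vector_mul_assoc matrix_vector_mul_lid)
qed

lemma conj_mat_vector:
  assumes T: "orthogonal_transformation T"
  shows "conj_mat T A *v (T x) = T (A *v x)"
  unfolding conj_mat_def matrix_vector_mul_assoc[symmetric]
  by (simp only: orthogonal_matrix_vector[OF T])

lemma conj_mat_eqI:
  assumes T: "orthogonal_transformation T" and B: "\<And>x. B *v (T x) = T (A *v x)"
  shows "conj_mat T A = B"
proof -
  have "conj_mat T A *v z = B *v z" for z
    using orthogonal_transformation_surj[OF T] conj_mat_vector[OF T] B by (metis surjD)
  thus ?thesis by (simp add: matrix_eq)
qed

text \<open>Translates the action of \<open>T\<close> on subspaces into an action on matrices, with
  the transpose of \<open>matrix T\<close> serving as its inverse.\<close>

lemma proj_mat_image:
  assumes T: "orthogonal_transformation T" and \<xi>: "subspace \<xi>"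
  shows "proj_mat (T ` \<xi>) = conj_mat T (proj_mat \<xi>)"
proof (rule conj_mat_eqI[OF T, symmetric])
  fix x
  have sub: "subspace (T ` \<xi>)"
    using T \<xi> orthogonal_transformation_linear linear_subspace_image by blast
  show "proj_mat (T ` \<xi>) *v T x = T (proj_mat \<xi> *v x)"
    unfolding proj_mat_vector[OF sub]
  proof (rule closest_point_eqI[OF sub])
    show "T (proj_mat \<xi> *v x) \<in> T ` \<xi>" using proj_mat_in[OF \<xi>] by blast
    fix z assume "z \<in> T ` \<xi>"
    then obtain y where y: "z = T y" "y \<in> \<xi>" by blast
    have "(x - proj_mat \<xi> *v x) \<bullet> y = (x - proj_mat \<xi> *v x) \<bullet> (proj_mat \<xi> *v y)"
      by (simp only: proj_mat_fix[OF \<xi>, THEN iffD2, OF y(2)])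
    also have "\<dots> = 0"
      unfolding is_projD(2)[OF is_proj_proj_mat[OF \<xi>], symmetric]
      by (simp add: matrix_vector_mult_diff_distrib is_projD(1)[OF is_proj_proj_mat[OF \<xi>]])
    finally show "(T x - T (proj_mat \<xi> *v x)) \<bullet> z = 0"
      unfolding y(1) linear_diff[OF orthogonal_transformation_linear[OF T], symmetric]
      using T by (simp add: orthogonal_transformation_def)
  qed
qed

lemma conj_mat_diff: "conj_mat T (A - B) = conj_mat T A - conj_mat T B"
  and conj_mat_add: "conj_mat T (A + B) = conj_mat T A + conj_mat T B"
proof -
  have "conj_mat T (A + B) = conj_mat T A + conj_mat T B" for A B
    by (simp add: matrix_eq conj_mat_def matrix_vector_mul_assoc[symmetric]
        matrix_vector_mult_add_rdistrib matrix_vector_right_distrib)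
  from this[of "A - B" B] this[of A B] show "conj_mat T (A - B) = conj_mat T A - conj_mat T B"
    "conj_mat T (A + B) = conj_mat T A + conj_mat T B" by auto
qed

lemma norm_vec_sq: "(norm (x::'a::real_inner^'n))\<^sup>2 = (\<Sum>i\<in>UNIV. (norm (x $ i))\<^sup>2)"
  by (simp add: power2_norm_eq_inner inner_vec_def)

lemma norm_transpose: "norm (transpose A) = norm (A :: real^'n^'n)"
proof -
  have "(norm (transpose A))\<^sup>2 = (norm A)\<^sup>2"
    unfolding norm_vec_sq transpose_def by simp (rule sum.swap)
  thus ?thesis by simp
qed

lemma norm_mult_transpose_orthogonal:
  fixes T :: "real^'n \<Rightarrow> real^'n"
  assumes T: "orthogonal_transformation T"
  shows "norm (A ** transpose (matrix T)) = norm A"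
proof -
  have "(A ** transpose (matrix T)) $ i = matrix T *v (A $ i)" for i
    by (simp add: vec_eq_iff matrix_matrix_mult_def matrix_vector_mult_def transpose_def mult.commute)
  hence "(norm (A ** transpose (matrix T)))\<^sup>2 = (norm A)\<^sup>2"
    unfolding norm_vec_sq[of A] norm_vec_sq[of "A ** transpose (matrix T)"]
    by (simp only: orthogonal_matrix_vector[OF T] orthogonal_transformation_norm[OF T])
  thus ?thesis by simp
qed

text \<open>The norm on \<open>real^'n^'n\<close> is the Frobenius norm, which depends only on the
  norms of the rows. Right multiplication rotates the rows; left multiplication is reduced to it by
  transposing.\<close>

lemma norm_conj_mat:
  assumes T: "orthogonal_transformation T"
  shows "norm (conj_mat T A) = norm A"
proof -
  have "norm (conj_mat T A) = norm (matrix T ** A)"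
    unfolding conj_mat_def by (rule norm_mult_transpose_orthogonal[OF T])
  also have "\<dots> = norm (transpose A ** transpose (matrix T))"
    by (metis norm_transpose matrix_transpose_mul)
  also have "\<dots> = norm A" by (simp add: norm_mult_transpose_orthogonal[OF T] norm_transpose)
  finally show ?thesis .
qed

lemma dist_conj_mat:
  "orthogonal_transformation T \<Longrightarrow> dist (conj_mat T A) (conj_mat T B) = dist A B"
  by (simp add: dist_norm norm_conj_mat flip: conj_mat_diff)

lemma is_proj_norm_le:
  assumes "is_proj A" shows "norm (A *v x) \<le> norm x"
proof (cases "A *v x = 0")
  case False
  have "norm (A *v x) * norm (A *v x) = x \<bullet> (A *v x)"
    using is_projD[OF assms] by (metis power2_eq_square power2_norm_eq_inner)
  also have "\<dots> \<le> norm x * norm (A *v x)" by (rule norm_cauchy_schwarz)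
  finally show ?thesis using False by simp
qed simp

text \<open>Each entry is a coordinate of the image of a basis vector, and projections do not
  increase norms. Boundedness is what gives finite covers by small balls in the uniqueness
  argument.\<close>

lemma bounded_is_proj: "bounded {A :: real^'n^'n. is_proj A}"
proof (rule boundedI)
  fix A :: "real^'n^'n" assume "A \<in> {A. is_proj A}"
  hence A: "is_proj A" by simp
  have "\<bar>A $ i $ j\<bar> \<le> 1" for i j
  proof -
    have "A $ i $ j = (A *v axis j 1) $ i" by (simp add: matrix_vector_mult_basis column_def)
    thus ?thesis
      using component_le_norm_cart[of "A *v axis j 1" i] is_proj_norm_le[OF A, of "axis j 1"] by simp
  qed
  hence "norm (A $ i) \<le> real CARD('n)" for i
    using norm_le_l1_cart[of "A $ i"] sum_bounded_above[of UNIV "\<lambda>j. \<bar>A $ i $ j\<bar>" 1] by auto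
  hence "(\<Sum>i\<in>UNIV. norm (A $ i)) \<le> real CARD('n) * real CARD('n)"
    using sum_bounded_above[of UNIV "\<lambda>i. norm (A $ i)" "real CARD('n)"] by auto
  thus "norm A \<le> real CARD('n) * real CARD('n)"
    using L2_set_le_sum[of UNIV "\<lambda>i. norm (A $ i)"] unfolding norm_vec_def by auto
qed

section \<open>Continuity and measurability of matrix operations\<close>

lemma continuous_on_matrix_mult [continuous_intros]:
  fixes f g :: "'a::topological_space \<Rightarrow> real^'n^'n"
  assumes "continuous_on S f" "continuous_on S g"
  shows "continuous_on S (\<lambda>x. f x ** g x)"
  unfolding matrix_matrix_mult_def by (intro continuous_intros assms)

lemma continuous_on_matrix_vector_mult [continuous_intros]:
  fixes f :: "'a::topological_space \<Rightarrow> real^'n^'n"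
  assumes "continuous_on S f" "continuous_on S g"
  shows "continuous_on S (\<lambda>x. f x *v g x)"
  unfolding matrix_vector_mult_def by (intro continuous_intros assms)

lemma closed_is_proj_trace: "closed {A :: real^'n^'n. is_proj A \<and> trace A = c}"
  unfolding is_proj_def trace_def transpose_def
  by (intro closed_Collect_conj closed_Collect_eq continuous_intros)

lemma borel_measurable_conj_mat [measurable]: "conj_mat T \<in> borel_measurable borel"
  unfolding conj_mat_def[abs_def] by (intro borel_measurable_continuous_onI continuous_intros)

lemma borel_measurable_matrix_vector_mult [measurable (raw)]:
  fixes f :: "'a \<Rightarrow> real^'n^'n"
  assumes [measurable]: "f \<in> borel_measurable M" "g \<in> borel_measurable M"
  shows "(\<lambda>x. f x *v g x) \<in> borel_measurable M"
proof -
  have "(\<lambda>z::(real^'n^'n) \<times> (real^'n). fst z *v snd z) \<in> borel_measurable borel"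
    by (intro borel_measurable_continuous_onI continuous_intros)
  hence [measurable]: "(\<lambda>z::(real^'n^'n) \<times> (real^'n). fst z *v snd z) \<in> borel_measurable (borel \<Otimes>\<^sub>M borel)"
    by (simp add: borel_prod)
  have "(\<lambda>x. (\<lambda>z. fst z *v snd z) (f x, g x)) \<in> borel_measurable M" by measurable
  thus ?thesis by simp
qed

section \<open>One Gram-Schmidt step in terms of projections\<close>

text \<open>The orthogonal projection onto the line spanned by \<open>w\<close>; it is zero for \<open>w = 0\<close>, since \<open>1 / 0 = 0\<close>.\<close>

definition dyad :: "real^'n \<Rightarrow> real^'n^'n" where
  "dyad w = (1 / (w \<bullet> w)) *\<^sub>R (\<chi> i j. w $ i * w $ j)"

lemma dyad_vector: "dyad w *v x = ((w \<bullet> x) / (w \<bullet> w)) *\<^sub>R w"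
  by (simp add: vec_eq_iff dyad_def matrix_vector_mult_def inner_vec_def sum_distrib_right
      sum_distrib_left sum_divide_distrib mult_ac)

lemma borel_measurable_dyad [measurable (raw)]:
  assumes [measurable]: "g \<in> borel_measurable M"
  shows "(\<lambda>x. dyad (g x)) \<in> borel_measurable M"
proof -
  have [measurable]: "(\<lambda>w::real^'n. (\<chi> i j. w $ i * w $ j) :: real^'n^'n) \<in> borel_measurable borel"
    by (intro borel_measurable_continuous_onI continuous_intros)
  have "(\<lambda>w::real^'n. dyad w) \<in> borel_measurable borel" unfolding dyad_def by measurable
  thus ?thesis using assms by measurable
qed

lemma dyad_orthogonal:
  assumes T: "orthogonal_transformation T"
  shows "dyad (T w) = conj_mat T (dyad w)"
  by (rule conj_mat_eqI[OF T, symmetric])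
     (use T in \<open>simp add: dyad_vector orthogonal_transformation_def linear_scale\<close>)

lemma trace_dyad: "w \<noteq> 0 \<Longrightarrow> trace (dyad w) = 1"
  by (simp add: trace_def dyad_def sum_divide_distrib[symmetric] flip: inner_vec_def)
     (simp add: inner_vec_def sum_divide_distrib[symmetric])

text \<open>The line of the component of \<open>y\<close> orthogonal to the range of
  \<open>A\<close> is added. If \<open>A\<close> is a projection and \<open>y\<close> lies in its
  range, that component is zero and \<open>A\<close> stays as it is, because
  \<open>dyad 0 = 0\<close>.\<close>

definition extend_proj :: "real^'n^'n \<Rightarrow> real^'n \<Rightarrow> real^'n^'n" where
  "extend_proj A y = A + dyad (y - A *v y)"

lemma borel_measurable_extend_proj [measurable (raw)]:
  assumes [measurable]: "f \<in> borel_measurable M" "g \<in> borel_measurable M"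
  shows "(\<lambda>x. extend_proj (f x) (g x)) \<in> borel_measurable M"
  unfolding extend_proj_def by measurable

lemma extend_proj_orthogonal:
  assumes T: "orthogonal_transformation T"
  shows "extend_proj (conj_mat T A) (T y) = conj_mat T (extend_proj A y)"
proof -
  have "T y - conj_mat T A *v T y = T (y - A *v y)"
    by (simp add: conj_mat_vector[OF T] linear_diff[OF orthogonal_transformation_linear[OF T]])
  thus ?thesis by (simp add: extend_proj_def dyad_orthogonal[OF T] conj_mat_add)
qed

text \<open>The new direction \<open>w\<close> is orthogonal to the range of \<open>A\<close>, so
  all mixed terms vanish. The identity \<open>extend_proj A y ** A = A\<close> encodes that the old
  range is contained in the new one.\<close>

lemma extend_proj:
  assumes A: "is_proj A" and y: "y \<notin> range ((*v) A)"
  shows "is_proj (extend_proj A y)" "trace (extend_proj A y) = trace A + 1"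
    "extend_proj A y ** A = A"
proof -
  define w where "w = y - A *v y"
  have w0: "w \<noteq> 0" using y by (auto simp: w_def)
  have Aw: "A *v w = 0" by (simp add: w_def matrix_vector_mult_diff_distrib is_projD(1)[OF A])
  have wA: "w \<bullet> (A *v x) = 0" for x by (metis A Aw inner_zero_left is_projD(2))
  have ev: "extend_proj A y *v x = A *v x + ((w \<bullet> x) / (w \<bullet> w)) *\<^sub>R w" for x
    by (simp add: extend_proj_def w_def[symmetric] matrix_vector_mult_add_rdistrib dyad_vector)
  show "is_proj (extend_proj A y)"
  proof (rule is_projI)
    show "(extend_proj A y *v x) \<bullet> z = x \<bullet> (extend_proj A y *v z)" for x z
      using is_projD(2)[OF A, of x z]
      by (simp add: ev inner_add_left inner_add_right inner_commute mult.commute)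
    show "extend_proj A y *v (extend_proj A y *v x) = extend_proj A y *v x" for x
      using w0 by (simp add: ev inner_add_left inner_add_right is_projD(1)[OF A] Aw wA
          matrix_vector_right_distrib matrix_vector_mult_scaleR)
  qed
  show "trace (extend_proj A y) = trace A + 1"
    by (simp add: extend_proj_def w_def[symmetric] trace_add trace_dyad[OF w0])
  have "(extend_proj A y ** A) *v x = A *v x" for x
    by (simp add: ev wA is_projD(1)[OF A] flip: matrix_vector_mul_assoc)
  thus "extend_proj A y ** A = A" by (simp add: matrix_eq)
qed

subsection \<open>Random projections\<close>

text \<open>If \<open>A\<close> projects onto \<open>\<xi>\<close>, this is the law of the projection onto the sum of \<open>\<xi>\<close> and the span of \<open>k\<close>
  independent random vectors. The Haar measure on the \<open>k\<close>-planes of \<open>V\<close> is obtained with the projection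
  onto the orthogonal complement of \<open>V\<close> in place of \<open>A\<close>, the same process giving \<open>span {u, \<zeta>}\<close> in the
  dual Radon transform.\<close>

primrec random_extension :: "nat \<Rightarrow> real^'n^'n \<Rightarrow> (real^'n^'n) measure" where
  "random_extension 0 A = return borel A"
| "random_extension (Suc k) A = unif_ball \<bind> (\<lambda>y. random_extension k (extend_proj A y))"

lemma unif_ball_in_prob_algebra [measurable]: "unif_ball \<in> space (prob_algebra borel)"
  by (simp add: space_prob_algebra prob_space_unif_ball)

lemma random_extension_measurable [measurable]:
  "random_extension k \<in> borel \<rightarrow>\<^sub>M prob_algebra (borel :: (real^'n^'n) measure)"
proof (induction k)
  case 0
  have "random_extension 0 = return (borel :: (real^'n^'n) measure)" by (rule ext) simp
  thus ?case by simp
next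
  case (Suc k)
  note [measurable] = Suc
  have "(\<lambda>A::real^'n^'n. unif_ball \<bind> (\<lambda>y. random_extension k (extend_proj A y))) \<in> borel \<rightarrow>\<^sub>M prob_algebra borel"
    by measurable
  thus ?case by (simp add: fun_eq_iff[symmetric] cong: measurable_cong)
qed

lemma random_extension_prob_algebra: "random_extension k A \<in> space (prob_algebra borel)"
  using measurable_space[OF random_extension_measurable] by simp

lemma sets_random_extension [measurable_cong, simp]: "sets (random_extension k A) = sets borel"
  and prob_space_random_extension: "prob_space (random_extension k A)"
  using random_extension_prob_algebra[of k A] by (auto simp: space_prob_algebra)

lemma space_random_extension [simp]: "space (random_extension k A) = UNIV"
  using sets_eq_imp_space_eq[OF sets_random_extension] by simp

lemma random_extension_subprob [measurable]:
  "random_extension k \<in> borel \<rightarrow>\<^sub>M subprob_algebra (borel :: (real^'n^'n) measure)"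
  by (rule measurable_prob_algebraD) measurable

lemma random_extension_step_measurable [measurable]:
  "(\<lambda>y. random_extension k (extend_proj A y)) \<in> unif_ball \<rightarrow>\<^sub>M subprob_algebra (borel :: (real^'n^'n) measure)"
  by (rule measurable_compose[OF _ random_extension_subprob]) measurable

text \<open>Closedness makes this event Borel, as the almost-everywhere rules for
  \<open>return\<close> and \<open>bind\<close> require.\<close>

lemma closed_projection_extensions:
  fixes A :: "real^'n^'n"
  shows "closed {B. is_proj B \<and> trace B = c \<and> B ** A = A}"
proof -
  have "closed {B. B ** A = A}" by (intro closed_Collect_eq continuous_intros)
  moreover have "{B :: real^'n^'n. is_proj B \<and> trace B = c \<and> B ** A = A}
      = {B. is_proj B \<and> trace B = c} \<inter> {B. B ** A = A}" by blast
  ultimately show ?thesis using closed_is_proj_trace by auto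
qed

text \<open>One Gram-Schmidt step commutes with conjugation if \<open>y\<close> is replaced by
  \<open>T y\<close>, and the uniform law on the ball does not notice this replacement.\<close>

lemma distr_random_extension_conj:
  assumes T: "orthogonal_transformation T"
  shows "distr (random_extension k A) borel (conj_mat T) = random_extension k (conj_mat T A)"
proof (induction k arbitrary: A)
  case 0 show ?case by (simp add: distr_return)
next
  case (Suc k)
  have [measurable]: "T \<in> borel_measurable borel" by (rule measurable_orthogonal_transformation[OF T])
  have "distr (random_extension (Suc k) A) borel (conj_mat T)
      = unif_ball \<bind> (\<lambda>y. distr (random_extension k (extend_proj A y)) borel (conj_mat T))"
    by (simp only: random_extension.simps, rule distr_bind[where K=borel]) (simp_all, measurable)
  also have "\<dots> = unif_ball \<bind> (\<lambda>y. random_extension k (extend_proj (conj_mat T A) (T y)))"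
    by (simp add: Suc extend_proj_orthogonal[OF T])
  also have "\<dots> = distr unif_ball borel T \<bind> (\<lambda>y. random_extension k (extend_proj (conj_mat T A) y))"
    by (rule bind_distr[where K=borel, symmetric]) (simp_all, measurable)
  also have "\<dots> = random_extension (Suc k) (conj_mat T A)"
    by (simp add: distr_unif_ball_orthogonal[OF T])
  finally show ?case .
qed

text \<open>As long as the rank is below the dimension of the space, the next vector almost surely
  avoids the range, so the rank grows by one; \<open>d + k \<le> CARD('n)\<close> guarantees this at
  each of the \<open>k\<close> steps.\<close>

lemma AE_random_extension:
  fixes A :: "real^'n^'n"
  assumes "is_proj A" "trace A = real d" "d + k \<le> CARD('n)"
  shows "AE B in random_extension k A. is_proj B \<and> trace B = real (d + k) \<and> B ** A = A"
  using assms
proof (induction k arbitrary: A d)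
  case 0
  have "Measurable.pred borel (\<lambda>B::real^'n^'n. is_proj B \<and> trace B = real d \<and> B ** A = A)"
    using borel_closed[OF closed_projection_extensions] by (simp add: pred_def)
  thus ?case unfolding random_extension.simps by (subst AE_return) (use 0 in \<open>auto simp: is_proj_def\<close>)
next
  case (Suc k)
  have ne: "range ((*v) A) \<noteq> UNIV"
    using Suc.prems is_proj_trace[OF Suc.prems(1)] by (auto simp: dim_UNIV)
  have "AE y in unif_ball. y \<notin> range ((*v) A)"
    by (rule AE_unif_ball_not_in_subspace[OF _ ne]) (auto intro: linear_subspace_image)
  hence "AE y in unif_ball. AE B in random_extension k (extend_proj A y).
      is_proj B \<and> trace B = real (d + Suc k) \<and> B ** A = A"
  proof eventually_elim
    case (elim y)
    note e = extend_proj[OF Suc.prems(1) elim]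
    have "AE B in random_extension k (extend_proj A y). is_proj B \<and> trace B = real (Suc d + k)
        \<and> B ** extend_proj A y = extend_proj A y"
      using Suc.prems by (intro Suc.IH e(1)) (auto simp: e(2))
    thus ?case
    proof eventually_elim
      case (elim B)
      have "B ** A = B ** (extend_proj A y ** A)" by (simp add: e(3))
      also have "\<dots> = (B ** extend_proj A y) ** A" by (rule matrix_mul_assoc)
      also have "\<dots> = A" using elim e(3) by metis
      finally show ?case using elim by simp
    qed
  qed
  thus ?case
    by (simp only: random_extension.simps, subst AE_bind[where B=borel])
      (simp_all add: pred_def borel_closed[OF closed_projection_extensions])
qed

subsection \<open>Haar measure on Grassmannians\<close>

abbreviation coproj :: "(real^'n) set \<Rightarrow> real^'n^'n" where
  "coproj V \<equiv> mat 1 - proj_mat V"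

lemma coproj_vector: "coproj V *v x = x - proj_mat V *v x"
  by (simp add: matrix_vector_mult_diff_rdistrib)

lemma is_proj_coproj: "subspace V \<Longrightarrow> is_proj (coproj V)"
  using is_projD[OF is_proj_proj_mat]
  by (intro is_projI) (simp_all add: coproj_vector inner_diff_left inner_diff_right matrix_vector_mult_diff_distrib)

lemma dim_le_card: "dim (V :: (real^'n) set) \<le> CARD('n)"
  using dim_subset_UNIV[of V] by simp

lemma trace_coproj:
  fixes V :: "(real^'n) set"
  assumes "subspace V" shows "trace (coproj V) = real (CARD('n) - dim V)"
  using dim_le_card[of V] by (simp add: trace_sub trace_I trace_proj_mat[OF assms])

text \<open>Says that \<open>B\<close> projects onto the sum of the orthogonal complement of
  \<open>V\<close> and a \<open>k\<close>-plane of \<open>V\<close>; then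
  \<open>B - coproj V\<close> is the projection onto that plane.\<close>

definition proj_extends :: "(real^'n) set \<Rightarrow> nat \<Rightarrow> real^'n^'n \<Rightarrow> bool" where
  "proj_extends V k B \<longleftrightarrow> is_proj B \<and> trace B = real (CARD('n) - dim V + k) \<and> B ** coproj V = coproj V"

lemma proj_extends_range:
  fixes V :: "(real^'n) set"
  assumes V: "subspace V" and B: "proj_extends V k B"
  shows "range ((*v) (B - coproj V)) \<in> grassmannian V k" "proj_mat (range ((*v) (B - coproj V))) = B - coproj V"
proof -
  let ?E = "coproj V"
  note E = is_projD[OF is_proj_coproj[OF V]]
  have B': "is_proj B" "trace B = real (CARD('n) - dim V + k)" "B ** ?E = ?E"
    using B by (auto simp: proj_extends_def)
  note b = is_projD[OF B'(1)]
  have BE: "B *v (?E *v x) = ?E *v x" for x by (metis B'(3) matrix_vector_mul_assoc)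
  \<comment> \<open>The transpose of \<open>BE\<close>, both matrices being symmetric.\<close>
  have EB: "?E *v (B *v x) = ?E *v x" for x
  proof (rule vector_eq_rdot[THEN iffD1], rule allI)
    fix y
    have "(?E *v (B *v x)) \<bullet> y = x \<bullet> (B *v (?E *v y))" by (simp only: E(2) b(2))
    also have "\<dots> = (?E *v x) \<bullet> y" by (simp only: BE E(2))
    finally show "(?E *v (B *v x)) \<bullet> y = (?E *v x) \<bullet> y" .
  qed
  have P: "is_proj (B - ?E)"
  proof (rule is_projI)
    show "((B - ?E) *v x) \<bullet> y = x \<bullet> ((B - ?E) *v y)" for x y
      by (simp only: matrix_vector_mult_diff_rdistrib[of B] inner_diff_left inner_diff_right b(2) E(2))
    show "(B - ?E) *v ((B - ?E) *v x) = (B - ?E) *v x" for x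
      by (simp only: matrix_vector_mult_diff_rdistrib[of B] matrix_vector_mult_diff_distrib b(1) E(1) BE EB) simp
  qed
  show "proj_mat (range ((*v) (B - ?E))) = B - ?E" by (rule proj_mat_range[OF P])
  have "real (dim (range ((*v) (B - ?E)))) = real k"
    unfolding is_proj_trace[OF P, symmetric] trace_sub[of B] trace_coproj[OF V] B'(2) by simp
  moreover have "range ((*v) (B - ?E)) \<subseteq> V"
  proof clarify
    fix x
    have "?E *v ((B - ?E) *v x) = 0"
      by (simp only: matrix_vector_mult_diff_rdistrib[of B] matrix_vector_mult_diff_distrib E(1) EB) simp
    hence "proj_mat V *v ((B - ?E) *v x) = (B - ?E) *v x" unfolding coproj_vector[of V "(B - ?E) *v x"] by simp
    thus "(B - ?E) *v x \<in> V" using proj_mat_fix[OF V] by blast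
  qed
  ultimately show "range ((*v) (B - ?E)) \<in> grassmannian V k"
    by (simp add: grassmannian_def linear_subspace_image)
qed

lemma closed_proj_extends: "closed {B. proj_extends V k B}"
  unfolding proj_extends_def by (rule closed_projection_extensions)

lemma AE_proj_extends:
  fixes V :: "(real^'n) set"
  assumes "subspace V" "k \<le> dim V"
  shows "AE B in random_extension k (coproj V). proj_extends V k B"
  using AE_random_extension[OF is_proj_coproj[OF assms(1)] trace_coproj[OF assms(1)], of k] assms(2) dim_le_card[of V]
  by (simp add: proj_extends_def)

lemma space_grassmannian_borel [simp]: "space (grassmannian_borel V k) = grassmannian V k"
  by (simp add: grassmannian_borel_def)

lemma proj_mat_measurable [measurable]: "proj_mat \<in> grassmannian_borel V k \<rightarrow>\<^sub>M borel"
  unfolding grassmannian_borel_def by (rule measurable_vimage_algebra1) auto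

lemma measurable_grassmannian_borelI:
  "g \<in> space N \<rightarrow> grassmannian V k \<Longrightarrow> (\<lambda>x. proj_mat (g x)) \<in> N \<rightarrow>\<^sub>M borel \<Longrightarrow> g \<in> N \<rightarrow>\<^sub>M grassmannian_borel V k"
  unfolding grassmannian_borel_def by (rule measurable_vimage_algebra2)

lemma image_grassmannian:
  fixes T :: "real^'n \<Rightarrow> real^'n"
  assumes T: "orthogonal_transformation T" "T ` V = V" and \<xi>: "\<xi> \<in> grassmannian V k"
  shows "T ` \<xi> \<in> grassmannian V k"
proof -
  have "linear T" using T(1) by (rule orthogonal_transformation_linear)
  moreover have "dim (T ` \<xi>) = dim \<xi>"
    using \<open>linear T\<close> orthogonal_transformation_inj[OF T(1)] by (intro dim_image_eq) (auto intro: inj_on_subset)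
  ultimately show ?thesis using \<xi> T(2) by (auto simp: grassmannian_def linear_subspace_image)
qed

lemma image_measurable_grassmannian:
  fixes T :: "real^'n \<Rightarrow> real^'n"
  assumes T: "orthogonal_transformation T" "T ` V = V"
  shows "(`) T \<in> grassmannian_borel V k \<rightarrow>\<^sub>M grassmannian_borel V k"
proof (rule measurable_grassmannian_borelI)
  have "(\<lambda>\<xi>. conj_mat T (proj_mat \<xi>)) \<in> grassmannian_borel V k \<rightarrow>\<^sub>M borel" by measurable
  thus "(\<lambda>\<xi>. proj_mat (T ` \<xi>)) \<in> grassmannian_borel V k \<rightarrow>\<^sub>M borel"
    by (rule measurable_cong[THEN iffD1, rotated]) (simp add: grassmannian_def proj_mat_image[OF T(1)])
qed (use image_grassmannian[OF T] in auto)

text \<open>The predicate inside the definite description of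
  \<open>grassmannian_haar\<close>.\<close>

definition grassmannian_invariant :: "(real^'n) set \<Rightarrow> nat \<Rightarrow> (real^'n) set measure \<Rightarrow> bool" where
  "grassmannian_invariant V k \<nu> \<longleftrightarrow> sets \<nu> = sets (grassmannian_borel V k) \<and> prob_space \<nu> \<and>
     (\<forall>T. orthogonal_transformation T \<and> T ` V = V \<longrightarrow> distr \<nu> \<nu> ((`) T) = \<nu>)"

text \<open>Both measures are pushed forward by \<open>proj_mat\<close>. On matrices the orthogonal
  maps preserving \<open>V\<close> act by isometries, transitively on \<open>X\<close>, so the
  images agree. Every measurable set of subspaces is a preimage under \<open>proj_mat\<close>, so
  the measures agree as well.\<close>

lemma grassmannian_invariant_unique:
  fixes V :: "(real^'n) set"
  assumes V: "subspace V" and \<nu>: "grassmannian_invariant V k \<nu>" "grassmannian_invariant V k \<nu>'"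
  shows "\<nu> = \<nu>'"
proof -
  define X where "X = {A :: real^'n^'n. (is_proj A \<and> trace A = real k) \<and> proj_mat V ** A = A}"
  define \<Gamma> where "\<Gamma> = {conj_mat T | T. orthogonal_transformation T \<and> T ` V = V}"
  have X_closed: "closed X"
    unfolding X_def by (intro closed_Collect_conj closed_is_proj_trace closed_Collect_eq continuous_intros)
  have X_in: "proj_mat \<xi> \<in> X" if "\<xi> \<in> grassmannian V k" for \<xi>
  proof -
    have \<xi>: "subspace \<xi>" "\<xi> \<subseteq> V" "dim \<xi> = k" using that by (auto simp: grassmannian_def)
    have "(proj_mat V ** proj_mat \<xi>) *v x = proj_mat \<xi> *v x" for x
      unfolding matrix_vector_mul_assoc[symmetric]
      using proj_mat_in[OF \<xi>(1)] \<xi>(2) proj_mat_fix[OF V] by blast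
    thus ?thesis using \<xi> is_proj_proj_mat[OF \<xi>(1)] trace_proj_mat[OF \<xi>(1)] by (simp add: X_def matrix_eq)
  qed
  have X_range: "range ((*v) A) \<in> grassmannian V k" "proj_mat (range ((*v) A)) = A" if "A \<in> X" for A
  proof -
    have A: "is_proj A" "trace A = real k" "proj_mat V ** A = A" using that by (auto simp: X_def)
    show "proj_mat (range ((*v) A)) = A" by (rule proj_mat_range[OF A(1)])
    have "range ((*v) A) \<subseteq> V"
    proof clarify
      fix x have "proj_mat V *v (A *v x) = A *v x" by (simp only: matrix_vector_mul_assoc A(3))
      thus "A *v x \<in> V" using proj_mat_fix[OF V] by blast
    qed
    thus "range ((*v) A) \<in> grassmannian V k"
      using is_proj_trace[OF A(1)] A(2) by (simp add: grassmannian_def linear_subspace_image)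
  qed
  have push: "prob_space (distr M borel proj_mat)" "AE A in distr M borel proj_mat. A \<in> X"
      "\<And>g. g \<in> \<Gamma> \<Longrightarrow> distr (distr M borel proj_mat) borel g = distr M borel proj_mat"
    if M: "grassmannian_invariant V k M" for M
  proof -
    have [measurable_cong]: "sets M = sets (grassmannian_borel V k)" and "prob_space M"
      using M by (auto simp: grassmannian_invariant_def)
    have sp: "space M = grassmannian V k" using sets_eq_imp_space_eq[OF \<open>sets M = _\<close>] by simp
    interpret M: prob_space M by fact
    show "prob_space (distr M borel proj_mat)" by (rule M.prob_space_distr) measurable
    show "AE A in distr M borel proj_mat. A \<in> X"
      using X_closed X_in sp by (subst AE_distr_iff) auto
    fix g assume "g \<in> \<Gamma>"
    then obtain T where T: "g = conj_mat T" "orthogonal_transformation T" "T ` V = V" by (auto simp: \<Gamma>_def)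
    have [measurable]: "(`) T \<in> M \<rightarrow>\<^sub>M M" using image_measurable_grassmannian[OF T(2,3)] by measurable
    have "distr (distr M borel proj_mat) borel g = distr M borel (\<lambda>\<xi>. conj_mat T (proj_mat \<xi>))"
      unfolding T(1) by (subst distr_distr) (auto simp: comp_def)
    also have "\<dots> = distr M borel (\<lambda>\<xi>. proj_mat (T ` \<xi>))"
      by (rule distr_cong) (auto simp: sp grassmannian_def proj_mat_image[OF T(2)])
    also have "\<dots> = distr (distr M M ((`) T)) borel proj_mat"
      by (subst distr_distr) (auto simp: comp_def)
    also have "distr M M ((`) T) = M" using M T by (auto simp: grassmannian_invariant_def)
    finally show "distr (distr M borel proj_mat) borel g = distr M borel proj_mat" .
  qed
  have eq: "distr \<nu> borel proj_mat = distr \<nu>' borel proj_mat"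
  proof (rule invariant_measure_unique[where X=X and \<Gamma>=\<Gamma>, OF _ push(1)[OF \<nu>(1)] _ push(2)[OF \<nu>(1)] push(1)[OF \<nu>(2)] _ push(2)[OF \<nu>(2)]])
    show "bounded X" by (rule bounded_subset[OF bounded_is_proj]) (auto simp: X_def)
    show "g \<in> borel_measurable borel" if "g \<in> \<Gamma>" for g using that by (auto simp: \<Gamma>_def)
    show "dist (g A) (g B) = dist A B" if "g \<in> \<Gamma>" for g A B
      using that by (auto simp: \<Gamma>_def dist_conj_mat)
    fix A B assume A: "A \<in> X" and B: "B \<in> X"
    note a = X_range[OF A] and b = X_range[OF B]
    obtain T where T: "orthogonal_transformation T" "T ` range ((*v) A) = range ((*v) B)" "T ` V = V"
      using a(1) b(1) V orthogonal_transformation_nested_subspaces[of "range ((*v) A)" V "range ((*v) B)" V]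
      by (auto simp: grassmannian_def)
    have "conj_mat T A = B"
      using proj_mat_image[OF T(1), of "range ((*v) A)"] a b T(2) by (simp add: grassmannian_def)
    thus "\<exists>g\<in>\<Gamma>. g A = B" using T by (auto simp: \<Gamma>_def)
  qed (use push(3) \<nu> in auto)
  have sets: "sets \<nu> = sets (grassmannian_borel V k)" "sets \<nu>' = sets (grassmannian_borel V k)"
    using \<nu> by (auto simp: grassmannian_invariant_def)
  show ?thesis
  proof (rule measure_eqI)
    fix S assume "S \<in> sets \<nu>"
    hence "S \<in> sets (vimage_algebra (grassmannian V k) proj_mat borel)" by (simp add: sets grassmannian_borel_def)
    then obtain C where C: "C \<in> sets borel" "S = proj_mat -` C \<inter> grassmannian V k"
      by (auto simp: sets_vimage_algebra2)
    have "emeasure M S = emeasure (distr M borel proj_mat) C" if "sets M = sets (grassmannian_borel V k)" for M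
    proof -
      note [measurable_cong] = that
      show ?thesis using C sets_eq_imp_space_eq[OF that] by (subst emeasure_distr) auto
    qed
    thus "emeasure \<nu> S = emeasure \<nu>' S" using eq sets by simp
  qed (simp add: sets)
qed

text \<open>The existence half: subtracting \<open>coproj V\<close> from the random projection
  leaves a random \<open>k\<close>-plane of \<open>V\<close> whose law is invariant. Together with
  uniqueness this evaluates the definite description.\<close>

lemma grassmannian_haar_random_extension:
  fixes V :: "(real^'n) set"
  assumes V: "subspace V" and k: "k \<le> dim V"
  shows "sets (grassmannian_haar V k) = sets (grassmannian_borel V k)"
    and "distr (grassmannian_haar V k) borel (\<lambda>\<xi>. coproj V + proj_mat \<xi>) = random_extension k (coproj V)"
proof -
  let ?R = "random_extension k (coproj V)"
  obtain B where B: "orthonormal_basis_of B V" using V orthonormal_basis_exists by blast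
  note D = orthonormal_basis_ofD[OF B]
  obtain C where C: "C \<subseteq> B" "card C = k" "finite C" using k D(3) by (metis obtain_subset_with_card_n)
  have "dim (span C) = k"
    using C D(2) independent_mono[of B C] by (simp add: dim_eq_card_independent)
  hence \<xi>0: "span C \<in> grassmannian V k" using span_minimal[of C V] C(1) D(5) V by (auto simp: grassmannian_def)
  \<comment> \<open>\<open>span C\<close> is a default plane for the null set of degenerate
    outcomes, so that \<open>r\<close> always takes values in the Grassmannian.\<close>
  define r where "r = (\<lambda>B. if proj_extends V k B then range ((*v) (B - coproj V)) else span C)"
  have r_in: "r B \<in> grassmannian V k" for B
    using proj_extends_range[OF V] \<xi>0 by (auto simp: r_def)
  have r_proj: "proj_mat (r B) = B - coproj V" if "proj_extends V k B" for B
    using proj_extends_range[OF V that] that by (auto simp: r_def)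
  have [measurable]: "Measurable.pred borel (proj_extends V k)"
    using borel_closed[OF closed_proj_extends] by (simp add: pred_def)
  have [measurable]: "r \<in> borel \<rightarrow>\<^sub>M grassmannian_borel V k"
  proof (rule measurable_grassmannian_borelI)
    have "(\<lambda>B. if proj_extends V k B then B - coproj V else proj_mat (span C)) \<in> borel \<rightarrow>\<^sub>M borel" by measurable
    thus "(\<lambda>B. proj_mat (r B)) \<in> borel \<rightarrow>\<^sub>M borel"
      by (rule measurable_cong[THEN iffD1, rotated]) (auto simp: r_proj, simp add: r_def)
  qed (use r_in in auto)
  interpret R: prob_space ?R by (rule prob_space_random_extension)
  define \<nu> where "\<nu> = distr ?R (grassmannian_borel V k) r"
  have [measurable_cong]: "sets \<nu> = sets (grassmannian_borel V k)" by (simp add: \<nu>_def)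
  have inv: "grassmannian_invariant V k \<nu>"
    unfolding grassmannian_invariant_def
  proof (intro conjI allI impI)
    show "prob_space \<nu>" unfolding \<nu>_def by (rule R.prob_space_distr) measurable
    fix T assume T: "orthogonal_transformation T \<and> T ` V = V"
    have [measurable]: "(`) T \<in> grassmannian_borel V k \<rightarrow>\<^sub>M grassmannian_borel V k"
      by (rule image_measurable_grassmannian) (use T in auto)
    \<comment> \<open>Since \<open>T\<close> maps \<open>V\<close> onto itself, it commutes with the
      projection onto \<open>V\<close>; the starting point of the random process is fixed by the
      action.\<close>
    have E: "conj_mat T (coproj V) = coproj V"
    proof (rule conj_mat_eqI)
      show "orthogonal_transformation T" using T by simp
      fix x
      have "proj_mat V *v T x = T (proj_mat V *v x)"
        using conj_mat_vector[of T "proj_mat V"] proj_mat_image[OF _ V, of T] T by simp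
      thus "coproj V *v T x = T (coproj V *v x)"
        using T by (simp add: coproj_vector linear_diff orthogonal_transformation_linear)
    qed
    have "distr \<nu> \<nu> ((`) T) = distr \<nu> (grassmannian_borel V k) ((`) T)"
      by (rule distr_cong) (auto simp: \<nu>_def)
    also have "\<dots> = distr ?R (grassmannian_borel V k) (\<lambda>B. T ` r B)"
      unfolding \<nu>_def by (subst distr_distr) (auto simp: comp_def)
    also have "\<dots> = distr ?R (grassmannian_borel V k) (\<lambda>B. r (conj_mat T B))"
    proof (rule distr_cong_AE)
      have "AE B in distr ?R borel (conj_mat T). proj_extends V k B"
        unfolding distr_random_extension_conj[OF conjunct1[OF T]] E by (rule AE_proj_extends[OF V k])
      hence "AE B in ?R. proj_extends V k (conj_mat T B)" by (subst (asm) AE_distr_iff) auto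
      with AE_proj_extends[OF V k]
      show "AE B in ?R. T ` r B = r (conj_mat T B)"
      proof eventually_elim
        case (elim B)
        have sub: "subspace (r B)" "subspace (T ` r B)" "subspace (r (conj_mat T B))"
          using r_in[of B] image_grassmannian[of T V "r B" k] T r_in[of "conj_mat T B"]
          by (auto simp: grassmannian_def)
        have "proj_mat (T ` r B) = conj_mat T (B - coproj V)"
          unfolding proj_mat_image[OF conjunct1[OF T] sub(1)] r_proj[OF elim(1)] ..
        also have "\<dots> = proj_mat (r (conj_mat T B))"
          unfolding conj_mat_diff[of T B] E r_proj[OF elim(2)] ..
        finally have "proj_mat (T ` r B) = proj_mat (r (conj_mat T B))" .
        thus ?case by (metis range_proj_mat[OF sub(2)] range_proj_mat[OF sub(3)])
      qed
    qed simp_all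
    also have "\<dots> = distr (distr ?R borel (conj_mat T)) (grassmannian_borel V k) r"
      by (subst distr_distr) (auto simp: comp_def)
    also have "\<dots> = \<nu>" unfolding \<nu>_def distr_random_extension_conj[OF conjunct1[OF T]] E ..
    finally show "distr \<nu> \<nu> ((`) T) = \<nu>" .
  qed (simp add: \<nu>_def)
  have haar: "grassmannian_haar V k = \<nu>"
    unfolding grassmannian_haar_def grassmannian_invariant_def[symmetric]
    by (rule the_equality) (use inv grassmannian_invariant_unique[OF V] in auto)
  show "sets (grassmannian_haar V k) = sets (grassmannian_borel V k)" by (simp add: haar \<nu>_def)
  have "distr \<nu> borel (\<lambda>\<xi>. coproj V + proj_mat \<xi>) = distr ?R borel (\<lambda>B. coproj V + proj_mat (r B))"
    unfolding \<nu>_def by (subst distr_distr) (auto simp: comp_def)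
  also have "\<dots> = distr ?R borel (\<lambda>B. B)"
  proof (rule distr_cong_AE)
    show "AE B in ?R. coproj V + proj_mat (r B) = B"
      using AE_proj_extends[OF V k] by eventually_elim (simp add: r_proj)
  qed simp_all
  also have "\<dots> = ?R" by (rule distr_id2) simp
  finally show "distr (grassmannian_haar V k) borel (\<lambda>\<xi>. coproj V + proj_mat \<xi>) = ?R" by (simp add: haar)
qed

text \<open>The passage from planes to matrices, used with \<open>V = UNIV\<close>, where
  \<open>coproj V\<close> is 0, for the dual quermassintegral, and with a hyperplane for the Radon
  transform. Measurability is only asked of \<open>g\<close>, a function of matrices.\<close>

lemma integral_grassmannian_haar:
  fixes V :: "(real^'n) set" and g :: "real^'n^'n \<Rightarrow> real"
  assumes V: "subspace V" "k \<le> dim V" and g: "g \<in> borel_measurable borel"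
    and F: "\<And>\<xi>. \<xi> \<in> grassmannian V k \<Longrightarrow> F \<xi> = g (coproj V + proj_mat \<xi>)"
  shows "(\<integral>\<xi>. F \<xi> \<partial>grassmannian_haar V k) = (\<integral>B. g B \<partial>random_extension k (coproj V))"
proof -
  note h = grassmannian_haar_random_extension[OF V]
  note [measurable_cong] = h(1) and [measurable] = g
  have "(\<integral>\<xi>. F \<xi> \<partial>grassmannian_haar V k) = (\<integral>\<xi>. g (coproj V + proj_mat \<xi>) \<partial>grassmannian_haar V k)"
    by (rule Bochner_Integration.integral_cong) (use F sets_eq_imp_space_eq[OF h(1)] in auto)
  also have "\<dots> = (\<integral>B. g B \<partial>distr (grassmannian_haar V k) borel (\<lambda>\<xi>. coproj V + proj_mat \<xi>))"
    by (rule integral_distr[symmetric]) measurable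
  finally show ?thesis by (simp add: h(2))
qed

subsection \<open>Volume of star-shaped sections\<close>

lemma borel_measurable_sgn_vec [measurable]: "sgn \<in> borel_measurable (borel :: 'a::euclidean_space measure)"
  unfolding sgn_div_norm[abs_def] by measurable

lemma ennreal_power_norm_less:
  fixes r :: real
  assumes "0 \<le> r" "1 \<le> (m::nat)"
  shows "ennreal (norm x ^ m) < ennreal (r ^ m) \<longleftrightarrow> norm x < r"
proof -
  have "ennreal (norm x ^ m) < ennreal (r ^ m) \<longleftrightarrow> norm x ^ m < r ^ m"
    by (simp add: ennreal_less_iff)
  also have "\<dots> \<longleftrightarrow> norm x < r"
  proof
    show "norm x < r" if "norm x ^ m < r ^ m" using that assms(1) by (rule power_less_imp_less_base)
    show "norm x ^ m < r ^ m" if "norm x < r" using power_strict_mono[OF that norm_ge_zero, of m] assms by simp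
  qed
  finally show ?thesis .
qed

text \<open>The scaling law of m-dimensional volume, stated for measures on the ambient space. It
  takes the place of polar coordinates for Lebesgue measure carried by an m-plane.\<close>

definition homogeneous_measure :: "nat \<Rightarrow> 'a::euclidean_space measure \<Rightarrow> bool" where
  "homogeneous_measure m M \<longleftrightarrow> sets M = sets borel \<and>
     (\<forall>c>0. \<forall>A\<in>sets borel. emeasure M A = ennreal (c ^ m) * emeasure M {x. c *\<^sub>R x \<in> A})"

lemma homogeneous_measureD:
  assumes "homogeneous_measure m M"
  shows "sets M = sets borel"
    "c > 0 \<Longrightarrow> A \<in> sets borel \<Longrightarrow> emeasure M A = ennreal (c ^ m) * emeasure M {x. c *\<^sub>R x \<in> A}"
  using assms unfolding homogeneous_measure_def by blast+

text \<open>The formula for the volume of a star body whose radial function has m-th power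
  \<open>f\<close>, with the radial integration left inside the unit ball. Induction on
  \<open>f\<close>: indicators give truncated cones, factors are absorbed by dilation, sums by
  disjointness and suprema by monotone convergence.\<close>

lemma homogeneous_measure_cone:
  fixes f :: "'a::euclidean_space \<Rightarrow> ennreal"
  assumes h: "homogeneous_measure m M" and m: "m \<ge> 1" and f: "f \<in> borel_measurable borel"
  shows "emeasure M {x. x \<noteq> 0 \<and> ennreal (norm x ^ m) < f (sgn x)}
       = (\<integral>\<^sup>+x. (if x \<noteq> 0 \<and> norm x < 1 then f (sgn x) else 0) \<partial>M)"
proof -
  note [measurable_cong] = homogeneous_measureD(1)[OF h]
  have space: "space M = UNIV" using sets_eq_imp_space_eq[OF homogeneous_measureD(1)[OF h]] by simp
  define S where "S = (\<lambda>f::'a \<Rightarrow> ennreal. {x::'a. x \<noteq> 0 \<and> ennreal (norm x ^ m) < f (sgn x)})"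
  have S[measurable]: "S f \<in> sets borel" if [measurable]: "f \<in> borel_measurable borel" for f
    unfolding S_def by measurable
  define J where "J = (\<lambda>f::'a \<Rightarrow> ennreal. \<integral>\<^sup>+x. (if x \<noteq> 0 \<and> norm x < 1 then f (sgn x) else 0) \<partial>M)"
  have "emeasure M (S f) = J f" using f
  proof (induction rule: borel_measurable_induct)
    case (cong f g)
    thus ?case by (simp add: S_def J_def)
  next
    case (set A)
    note [measurable] = set
    have "ennreal (norm x ^ m) < indicator A (sgn x) \<longleftrightarrow> norm x < 1 \<and> sgn x \<in> A" for x
      using ennreal_power_norm_less[of 1 m x] m by (cases "sgn x \<in> A") simp_all
    hence eq: "S (indicator A) = {x. x \<noteq> 0 \<and> norm x < 1 \<and> sgn x \<in> A}" by (auto simp: S_def)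
    have "J (indicator A) = (\<integral>\<^sup>+x. indicator (S (indicator A)) x \<partial>M)"
      unfolding J_def by (rule nn_integral_cong) (auto simp: eq indicator_def)
    thus ?case by simp
  next
    case (mult u c)
    note [measurable] = mult.hyps(2)
    obtain r where r: "c = ennreal r" "r \<ge> 0" using mult.hyps(1) by (cases c) auto
    show ?case
    proof (cases "r = 0")
      case True
      thus ?thesis by (simp add: S_def J_def r)
    next
      case False
      \<comment> \<open>Dilation by the m-th root multiplies the m-th power of the norm by
        \<open>c\<close>, and the measure by the same factor.\<close>
      define d where "d = root m r"
      have d: "d > 0" "d ^ m = r" using False r m by (auto simp: d_def)
      have "{x. d *\<^sub>R x \<in> S (\<lambda>x. c * u x)} = S u"
      proof -
        have "ennreal (norm (d *\<^sub>R x) ^ m) < c * u (sgn (d *\<^sub>R x)) \<longleftrightarrow> ennreal (norm x ^ m) < u (sgn x)" for x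
        proof -
          have "ennreal (norm (d *\<^sub>R x) ^ m) = c * ennreal (norm x ^ m)"
            using d r by (simp add: power_mult_distrib ennreal_mult[symmetric])
          moreover have "sgn (d *\<^sub>R x) = sgn x" using d by (simp add: sgn_scaleR)
          ultimately show ?thesis
            using False r by (simp add: not_le[symmetric] ennreal_mult_le_mult_iff)
        qed
        thus ?thesis using d by (auto simp: S_def)
      qed
      hence "emeasure M (S (\<lambda>x. c * u x)) = c * emeasure M (S u)"
        using homogeneous_measureD(2)[OF h d(1), of "S (\<lambda>x. c * u x)"] d(2) r(1) by simp
      also have "\<dots> = c * J u" using mult.IH by simp
      also have "\<dots> = J (\<lambda>x. c * u x)" unfolding J_def
        by (subst nn_integral_cmult[symmetric]) (auto intro!: nn_integral_cong)
      finally show ?thesis .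
    qed
  next
    case (add u v)
    note [measurable] = add.hyps(1,3)
    \<comment> \<open>The induction rule provides summands with disjoint supports, so that no
      direction contributes to both sets.\<close>
    have "S (\<lambda>x. v x + u x) = S u \<union> S v" "S u \<inter> S v = {}"
    proof -
      have "(ennreal (norm x ^ m) < v (sgn x) + u (sgn x)) = (ennreal (norm x ^ m) < v (sgn x) \<or> ennreal (norm x ^ m) < u (sgn x))
         \<and> \<not> (ennreal (norm x ^ m) < v (sgn x) \<and> ennreal (norm x ^ m) < u (sgn x))" for x
        using add.hyps(5)[of "sgn x"] by auto
      thus "S (\<lambda>x. v x + u x) = S u \<union> S v" "S u \<inter> S v = {}" unfolding S_def by blast+
    qed
    hence "emeasure M (S (\<lambda>x. v x + u x)) = emeasure M (S v) + emeasure M (S u)"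
      using plus_emeasure[of "S v" M "S u"] by (simp add: Un_commute Int_commute)
    also have "\<dots> = J v + J u" using add.IH by simp
    also have "\<dots> = J (\<lambda>x. v x + u x)" unfolding J_def
      by (subst nn_integral_add[symmetric]) (auto intro!: nn_integral_cong)
    finally show ?case .
  next
    case (seq U)
    note [measurable] = seq.hyps(1)
    have mono: "U i x \<le> U j x" if "i \<le> j" for i j x using seq.hyps(3) that by (auto simp: incseq_def le_fun_def)
    \<comment> \<open>The strict inequality in \<open>S\<close> is what makes this an increasing
      union.\<close>
    have "S (SUP i. U i) = (\<Union>i. S (U i))" by (auto simp: S_def less_SUP_iff)
    have "emeasure M (S (SUP i. U i)) = (SUP i. emeasure M (S (U i)))"
    proof -
      have "incseq (\<lambda>i. S (U i))" unfolding incseq_def S_def using mono by (blast intro: less_le_trans)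
      moreover have "range (\<lambda>i. S (U i)) \<subseteq> sets M"
        using S[OF seq.hyps(1)] by (auto simp: homogeneous_measureD(1)[OF h])
      ultimately show ?thesis using SUP_emeasure_incseq[of "\<lambda>i. S (U i)" M] \<open>S (SUP i. U i) = _\<close> by simp
    qed
    also have "\<dots> = (SUP i. J (U i))" using seq.IH by simp
    also have "\<dots> = (\<integral>\<^sup>+x. (SUP i. (if x \<noteq> 0 \<and> norm x < 1 then U i (sgn x) else 0)) \<partial>M)"
      unfolding J_def by (rule nn_integral_monotone_convergence_SUP[symmetric])
        (auto simp: incseq_def le_fun_def mono)
    also have "\<dots> = J (SUP i. U i)" unfolding J_def
      by (rule nn_integral_cong) (simp add: image_image)
    finally show ?case .
  qed
  thus ?thesis unfolding S_def J_def .
qed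

lemma homogeneous_measure_scale_integral:
  fixes g :: "'a::euclidean_space \<Rightarrow> ennreal"
  assumes h: "homogeneous_measure m M" and c: "c > 0" and [measurable]: "g \<in> borel_measurable borel"
  shows "(\<integral>\<^sup>+x. g x \<partial>M) = ennreal (c ^ m) * (\<integral>\<^sup>+x. g (c *\<^sub>R x) \<partial>M)"
proof -
  note [measurable_cong] = homogeneous_measureD(1)[OF h]
  have space: "space M = UNIV" using sets_eq_imp_space_eq[OF homogeneous_measureD(1)[OF h]] by simp
  have "M = scale_measure (ennreal (c ^ m)) (distr M borel ((*\<^sub>R) c))"
  proof (rule measure_eqI)
    fix A assume "A \<in> sets M"
    hence A: "A \<in> sets borel" by (simp add: homogeneous_measureD(1)[OF h])
    show "emeasure M A = emeasure (scale_measure (ennreal (c ^ m)) (distr M borel ((*\<^sub>R) c))) A"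
      using homogeneous_measureD(2)[OF h c A] A by (simp add: emeasure_distr space vimage_def)
  qed (simp add: homogeneous_measureD(1)[OF h])
  hence "(\<integral>\<^sup>+x. g x \<partial>M) = (\<integral>\<^sup>+x. g x \<partial>scale_measure (ennreal (c ^ m)) (distr M borel ((*\<^sub>R) c)))" by metis
  also have "\<dots> = ennreal (c ^ m) * (\<integral>\<^sup>+x. g (c *\<^sub>R x) \<partial>M)"
    by (simp add: nn_integral_scale_measure nn_integral_distr)
  finally show ?thesis .
qed

text \<open>Shrinking the closed body by a factor \<open>d < 1\<close> places it inside the open
  one, and \<open>d ^ m\<close> tends to 1. This reconciles the strict inequality of the cone
  formula with closed bodies.\<close>

lemma homogeneous_measure_radial_boundary:
  fixes \<rho> :: "'a::euclidean_space \<Rightarrow> real"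
  assumes h: "homogeneous_measure m M" and [measurable]: "\<rho> \<in> borel_measurable borel"
    and pos: "\<And>x. x \<noteq> 0 \<Longrightarrow> \<rho> (sgn x) > 0"
  shows "emeasure M {x. x \<noteq> 0 \<and> norm x \<le> \<rho> (sgn x)} = emeasure M {x. x \<noteq> 0 \<and> norm x < \<rho> (sgn x)}"
    (is "emeasure M ?A = emeasure M ?B")
proof (rule antisym)
  note [measurable_cong] = homogeneous_measureD(1)[OF h]
  have [measurable]: "?A \<in> sets borel" "?B \<in> sets borel" by measurable
  show "emeasure M ?B \<le> emeasure M ?A"
    by (rule emeasure_mono) (auto simp: homogeneous_measureD(1)[OF h])
  have le: "ennreal (d ^ m) * emeasure M ?A \<le> emeasure M ?B" if d: "0 < d" "d < 1" for d
  proof -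
    have "{x. d *\<^sub>R x \<in> ?B} \<in> sets borel" using d by measurable
    moreover have "?A \<subseteq> {x. d *\<^sub>R x \<in> ?B}"
    proof clarify
      fix x :: 'a assume x: "x \<noteq> 0" "norm x \<le> \<rho> (sgn x)"
      have "d * norm x < norm x" using d x by simp
      hence "d * norm x < \<rho> (sgn x)" using x(2) by linarith
      hence "norm (d *\<^sub>R x) < \<rho> (sgn (d *\<^sub>R x))" using d by (simp add: sgn_scaleR)
      thus "d *\<^sub>R x \<noteq> 0 \<and> norm (d *\<^sub>R x) < \<rho> (sgn (d *\<^sub>R x))" using x d by simp
    qed
    ultimately have "emeasure M ?A \<le> emeasure M {x. d *\<^sub>R x \<in> ?B}"
      by (intro emeasure_mono) (simp_all add: homogeneous_measureD(1)[OF h])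
    hence "ennreal (d ^ m) * emeasure M ?A \<le> ennreal (d ^ m) * emeasure M {x. d *\<^sub>R x \<in> ?B}"
      by (rule mult_left_mono) simp
    also have "\<dots> = emeasure M ?B" by (rule homogeneous_measureD(2)[OF h d(1), symmetric]) measurable
    finally show ?thesis .
  qed
  have "(\<lambda>k. ennreal ((real k / real (Suc k)) ^ m) * emeasure M ?A) \<longlonglongrightarrow> ennreal (1 ^ m) * emeasure M ?A"
    by (rule tendsto_mult_ennreal[OF tendsto_ennrealI[OF tendsto_power[OF LIMSEQ_n_over_Suc_n]] tendsto_const]) simp
  hence "ennreal (1 ^ m) * emeasure M ?A \<le> emeasure M ?B"
  proof (rule LIMSEQ_le_const2)
    \<comment> \<open>The index 0 is excluded because the shrinking factor vanishes there.\<close>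
    show "\<exists>N. \<forall>n\<ge>N. ennreal ((real n / real (Suc n)) ^ m) * emeasure M ?A \<le> emeasure M ?B"
      by (rule exI[of _ 1]) (auto intro!: le)
  qed
  thus "emeasure M ?A \<le> emeasure M ?B" by simp
qed

section \<open>Lebesgue measure in orthonormal coordinates\<close>

definition frame_lborel :: "(real^'n) set \<Rightarrow> (real^'n) measure" where
  "frame_lborel B = distr (Pi\<^sub>M B (\<lambda>_. lborel)) borel (\<lambda>x. \<Sum>b\<in>B. x b *\<^sub>R b)"

interpretation lborel_product: product_sigma_finite "\<lambda>_. lborel :: real measure" ..

lemma sets_frame_lborel [simp, measurable_cong]: "sets (frame_lborel B) = sets borel"
  by (simp add: frame_lborel_def)

lemma emeasure_lborel_real_scale:
  assumes "c > 0" and [measurable]: "A \<in> sets borel"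
  shows "emeasure lborel A = ennreal c * emeasure lborel {t. c * t \<in> (A :: real set)}"
proof -
  have "emeasure lborel A = emeasure (density (distr lborel borel (\<lambda>x. 0 + c * x)) (\<lambda>_. ennreal \<bar>c\<bar>)) A"
    using lborel_real_affine[of c 0] assms(1) by simp
  also have "\<dots> = ennreal c * emeasure (distr lborel borel (\<lambda>x. 0 + c * x)) A"
    using assms(1) by (simp add: emeasure_density nn_integral_cmult)
  also have "emeasure (distr lborel borel (\<lambda>x. 0 + c * x)) A = emeasure lborel {t. c * t \<in> A}"
    by (simp add: emeasure_distr vimage_def)
  finally show ?thesis .
qed

text \<open>Scaling every coordinate by \<open>c\<close> rescales boxes in the product by
  \<open>c ^ card B\<close> and commutes with forming the linear combination.\<close>

lemma homogeneous_frame_lborel: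
  fixes B :: "(real^'n) set"
  assumes B: "finite B"
  shows "homogeneous_measure (card B) (frame_lborel B)"
  unfolding homogeneous_measure_def
proof (intro conjI allI impI ballI)
  fix c :: real and A :: "(real^'n) set" assume c: "c > 0" and A[measurable]: "A \<in> sets borel"
  let ?P = "Pi\<^sub>M B (\<lambda>_. lborel :: real measure)"
  have [measurable]: "(\<lambda>x. \<lambda>b\<in>B. c * x b) \<in> ?P \<rightarrow>\<^sub>M ?P" by measurable
  have P: "scale_measure (ennreal (c ^ card B)) (distr ?P ?P (\<lambda>x. \<lambda>b\<in>B. c * x b)) = ?P"
  proof (rule lborel_product.PiM_eqI)
    fix F :: "real^'n \<Rightarrow> real set" assume F: "\<And>i. i \<in> B \<Longrightarrow> F i \<in> sets lborel"
    have F': "{t. c * t \<in> F b} \<in> sets borel" if "b \<in> B" for b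
    proof -
      have [measurable]: "F b \<in> sets borel" using F[OF that] by simp
      show ?thesis by measurable
    qed
    have "emeasure (distr ?P ?P (\<lambda>x. \<lambda>b\<in>B. c * x b)) (Pi\<^sub>E B F) = emeasure ?P (Pi\<^sub>E B (\<lambda>b. {t. c * t \<in> F b}))"
    proof -
      have "Pi\<^sub>E B F \<in> sets ?P" using F B by (intro sets_PiM_I_finite) auto
      moreover have "(\<lambda>x. \<lambda>b\<in>B. c * x b) -` Pi\<^sub>E B F \<inter> space ?P = Pi\<^sub>E B (\<lambda>b. {t. c * t \<in> F b})"
        by (auto simp: space_PiM PiE_def Pi_def)
      ultimately show ?thesis by (simp add: emeasure_distr)
    qed
    also have "\<dots> = (\<Prod>b\<in>B. emeasure lborel {t. c * t \<in> F b})"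
      by (rule lborel_product.emeasure_PiM[OF B]) (use F' in auto)
    finally have *: "emeasure (distr ?P ?P (\<lambda>x. \<lambda>b\<in>B. c * x b)) (Pi\<^sub>E B F) = (\<Prod>b\<in>B. emeasure lborel {t. c * t \<in> F b})" .
    show "emeasure (scale_measure (ennreal (c ^ card B)) (distr ?P ?P (\<lambda>x. \<lambda>b\<in>B. c * x b))) (Pi\<^sub>E B F)
        = (\<Prod>b\<in>B. emeasure lborel (F b))"
    proof -
      have "(\<Prod>b\<in>B. emeasure lborel (F b)) = (\<Prod>b\<in>B. ennreal c * emeasure lborel {t. c * t \<in> F b})"
        using F by (intro prod.cong emeasure_lborel_real_scale[OF c]) auto
      also have "\<dots> = ennreal (c ^ card B) * (\<Prod>b\<in>B. emeasure lborel {t. c * t \<in> F b})"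
        using c by (simp add: prod.distrib ennreal_power)
      finally show ?thesis using * by simp
    qed
  qed (simp_all add: B)
  let ?s = "\<lambda>x. \<Sum>b\<in>B. x b *\<^sub>R b"
  have [measurable]: "?s \<in> ?P \<rightarrow>\<^sub>M borel" by measurable
  have "emeasure (frame_lborel B) A = emeasure ?P (?s -` A \<inter> space ?P)"
    unfolding frame_lborel_def by (rule emeasure_distr) measurable
  also have "\<dots> = ennreal (c ^ card B) * emeasure (distr ?P ?P (\<lambda>x. \<lambda>b\<in>B. c * x b)) (?s -` A \<inter> space ?P)"
    using arg_cong[OF P, of "\<lambda>N. emeasure N (?s -` A \<inter> space ?P)"] by (metis emeasure_scale_measure)
  also have "emeasure (distr ?P ?P (\<lambda>x. \<lambda>b\<in>B. c * x b)) (?s -` A \<inter> space ?P)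
      = emeasure ?P ((\<lambda>x. \<lambda>b\<in>B. c * x b) -` (?s -` A \<inter> space ?P) \<inter> space ?P)"
    by (rule emeasure_distr) measurable
  also have "(\<lambda>x. \<lambda>b\<in>B. c * x b) -` (?s -` A \<inter> space ?P) \<inter> space ?P = ?s -` {x. c *\<^sub>R x \<in> A} \<inter> space ?P"
    by (auto simp: space_PiM scaleR_sum_right)
  also have "emeasure ?P \<dots> = emeasure (frame_lborel B) {x. c *\<^sub>R x \<in> A}"
    unfolding frame_lborel_def by (rule emeasure_distr[symmetric]) measurable
  finally show "emeasure (frame_lborel B) A = ennreal (c ^ card B) * emeasure (frame_lborel B) {x. c *\<^sub>R x \<in> A}" .
qed simp

lemma norm_orthonormal_sum:
  assumes "orthonormal_basis_of B \<xi>"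
  shows "(norm (\<Sum>b\<in>B. x b *\<^sub>R b))\<^sup>2 = (\<Sum>b\<in>B. (x b)\<^sup>2)"
proof -
  have "(norm (\<Sum>b\<in>B. x b *\<^sub>R b))\<^sup>2 = (\<Sum>b\<in>B. \<Sum>c\<in>B. x b * (x c * (b \<bullet> c)))"
  proof -
    have "b \<bullet> (\<Sum>c\<in>B. x c *\<^sub>R c) = (\<Sum>c\<in>B. x c * (b \<bullet> c))" for b by (simp add: inner_sum_right)
    thus ?thesis
      by (subst power2_norm_eq_inner, subst inner_sum_left) (simp add: sum_distrib_left mult.left_commute)
  qed
  also have "\<dots> = (\<Sum>b\<in>B. \<Sum>c\<in>B. if c = b then x b * x c else 0)"
    by (intro sum.cong) (auto simp: orthonormal_basis_inner[OF assms])
  also have "\<dots> = (\<Sum>b\<in>B. (x b)\<^sup>2)"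
    using orthonormal_basis_ofD(1)[OF assms] by (simp add: power2_eq_square)
  finally show ?thesis .
qed

lemma emeasure_frame_lborel_cball:
  assumes B: "orthonormal_basis_of B \<xi>"
  shows "emeasure (frame_lborel B) (cball 0 1) = ennreal (unit_ball_vol (real (card B)))"
proof -
  note D = orthonormal_basis_ofD[OF B]
  let ?P = "Pi\<^sub>M B (\<lambda>_. lborel :: real measure)"
  have "emeasure (frame_lborel B) (cball 0 1) = emeasure ?P ((\<lambda>x. \<Sum>b\<in>B. x b *\<^sub>R b) -` cball 0 1 \<inter> space ?P)"
    unfolding frame_lborel_def by (rule emeasure_distr) auto
  also have "(\<lambda>x. \<Sum>b\<in>B. x b *\<^sub>R b) -` cball 0 1 \<inter> space ?P = {f. sqrt (\<Sum>i\<in>B. (f i)\<^sup>2) \<le> 1} \<inter> space ?P"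
  proof -
    have "norm (\<Sum>b\<in>B. x b *\<^sub>R b) = sqrt (\<Sum>b\<in>B. (x b)\<^sup>2)" for x
      unfolding norm_orthonormal_sum[OF B, symmetric] by simp
    thus ?thesis by (simp add: vimage_def Int_def)
  qed
  also have "emeasure ?P \<dots> = ennreal (unit_ball_vol (real (card B)))"
    using emeasure_cball_aux[OF D(1), of 1] by simp
  finally show ?thesis .
qed

lemma orthonormal_Basis: "orthonormal_basis_of Basis (UNIV :: (real^'n) set)"
  unfolding orthonormal_basis_of_def
  by (auto simp: pairwise_def orthogonal_def inner_Basis)

text \<open>A bijection from the standard basis to \<open>C\<close> extends to an orthogonal map,
  and Lebesgue measure is invariant under it; what remains is a reindexing of the product measure.
  This permits Fubini along a subspace and its orthogonal complement.\<close>

lemma frame_lborel_UNIV: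
  fixes C :: "(real^'n) set"
  assumes C: "orthonormal_basis_of C UNIV"
  shows "frame_lborel C = lborel"
proof -
  note D = orthonormal_basis_ofD[OF C]
  have "card (Basis :: (real^'n) set) = card C" using D(3) by simp
  then obtain \<phi> where \<phi>: "bij_betw \<phi> (Basis :: (real^'n) set) C"
    using finite_same_card_bij[OF finite_Basis D(1)] by blast
  obtain T where T: "orthogonal_transformation T" "\<And>b. b \<in> Basis \<Longrightarrow> T b = \<phi> b"
    using orthogonal_transformation_of_bases[OF orthonormal_Basis C \<phi>] by blast
  have lin: "linear T" using T(1) by (rule orthogonal_transformation_linear)
  have [measurable]: "T \<in> borel_measurable borel" by (rule measurable_orthogonal_transformation[OF T(1)])
  let ?PB = "Pi\<^sub>M (Basis :: (real^'n) set) (\<lambda>_. lborel :: real measure)"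
  let ?PC = "Pi\<^sub>M C (\<lambda>_. lborel :: real measure)"
  let ?R = "\<lambda>\<omega>. \<lambda>b\<in>Basis. \<omega> (\<phi> b)"
  have \<phi>C: "b \<in> Basis \<Longrightarrow> \<phi> b \<in> C" for b using \<phi> by (auto simp: bij_betw_def)
  have [measurable]: "?R \<in> ?PC \<rightarrow>\<^sub>M ?PB"
    by (rule measurable_restrict, rule measurable_component_singleton, rule \<phi>C)
  have reindex: "distr ?PC ?PB ?R = ?PB"
  proof (rule lborel_product.PiM_eqI)
    fix F :: "real^'n \<Rightarrow> real set" assume F: "\<And>i. i \<in> Basis \<Longrightarrow> F i \<in> sets lborel"
    define \<psi> where "\<psi> = the_inv_into Basis \<phi>"
    have \<psi>: "\<psi> (\<phi> b) = b" if "b \<in> Basis" for b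
      using \<phi> that unfolding \<psi>_def by (simp add: bij_betw_def the_inv_into_f_f)
    have \<psi>C: "\<psi> c \<in> Basis" "\<phi> (\<psi> c) = c" if "c \<in> C" for c
      using \<phi> that \<psi> by (auto simp: bij_betw_def)
    have S: "Pi\<^sub>E Basis F \<in> sets ?PB" using F by (intro sets_PiM_I_finite) auto
    have "?R -` Pi\<^sub>E Basis F \<inter> space ?PC = Pi\<^sub>E C (\<lambda>c. F (\<psi> c))"
    proof (intro set_eqI iffI)
      fix \<omega> assume "\<omega> \<in> ?R -` Pi\<^sub>E Basis F \<inter> space ?PC"
      hence 1: "\<And>b. b \<in> Basis \<Longrightarrow> \<omega> (\<phi> b) \<in> F b" and 2: "\<omega> \<in> extensional C"
        by (auto simp: space_PiM PiE_def Pi_def)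
      have "\<omega> c \<in> F (\<psi> c)" if "c \<in> C" for c using 1[of "\<psi> c"] \<psi>C[OF that] by simp
      thus "\<omega> \<in> Pi\<^sub>E C (\<lambda>c. F (\<psi> c))" using 2 by (simp add: PiE_def Pi_def)
    next
      fix \<omega> assume \<omega>: "\<omega> \<in> Pi\<^sub>E C (\<lambda>c. F (\<psi> c))"
      have "\<omega> (\<phi> b) \<in> F b" if "b \<in> Basis" for b
        using PiE_mem[OF \<omega> \<phi>C[OF that]] \<psi>[OF that] by simp
      thus "\<omega> \<in> ?R -` Pi\<^sub>E Basis F \<inter> space ?PC"
        using \<omega> by (auto simp: space_PiM PiE_def Pi_def)
    qed
    hence "emeasure (distr ?PC ?PB ?R) (Pi\<^sub>E Basis F) = emeasure ?PC (Pi\<^sub>E C (\<lambda>c. F (\<psi> c)))"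
      using S by (simp add: emeasure_distr)
    also have "\<dots> = (\<Prod>c\<in>C. emeasure lborel (F (\<psi> c)))"
      by (rule lborel_product.emeasure_PiM[OF D(1)]) (use F \<psi>C in auto)
    also have "\<dots> = (\<Prod>b\<in>Basis. emeasure lborel (F (\<psi> (\<phi> b))))"
      by (rule prod.reindex_bij_betw[OF \<phi>, symmetric])
    also have "\<dots> = (\<Prod>b\<in>Basis. emeasure lborel (F b))" by (intro prod.cong) (auto simp: \<psi>)
    finally show "emeasure (distr ?PC ?PB ?R) (Pi\<^sub>E Basis F) = (\<Prod>b\<in>Basis. emeasure lborel (F b))" .
  qed simp_all
  have "lborel = distr (lborel :: (real^'n) measure) borel T" by (rule lborel_distr_orthogonal[OF T(1), symmetric])
  also have "\<dots> = distr (distr ?PB borel (\<lambda>f. \<Sum>b\<in>Basis. f b *\<^sub>R b)) borel T"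
    by (subst lborel_eq) rule
  also have "\<dots> = distr ?PB borel (\<lambda>f. T (\<Sum>b\<in>Basis. f b *\<^sub>R b))"
    by (subst distr_distr) (auto simp: comp_def)
  also have "\<dots> = distr (distr ?PC ?PB ?R) borel (\<lambda>f. T (\<Sum>b\<in>Basis. f b *\<^sub>R b))"
    unfolding reindex ..
  also have "\<dots> = distr ?PC borel (\<lambda>\<omega>. T (\<Sum>b\<in>Basis. ?R \<omega> b *\<^sub>R b))"
    by (subst distr_distr) (auto simp: comp_def)
  also have "\<dots> = distr ?PC borel (\<lambda>\<omega>. \<Sum>c\<in>C. \<omega> c *\<^sub>R c)"
  proof (rule distr_cong)
    fix \<omega> :: "real^'n \<Rightarrow> real"
    have "T (\<Sum>b\<in>Basis. ?R \<omega> b *\<^sub>R b) = (\<Sum>b\<in>Basis. \<omega> (\<phi> b) *\<^sub>R \<phi> b)"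
      by (simp add: linear_sum[OF lin] linear_scale[OF lin] T(2))
    also have "\<dots> = (\<Sum>c\<in>C. \<omega> c *\<^sub>R c)" by (rule sum.reindex_bij_betw[OF \<phi>])
    finally show "T (\<Sum>b\<in>Basis. ?R \<omega> b *\<^sub>R b) = (\<Sum>c\<in>C. \<omega> c *\<^sub>R c)" .
  qed simp_all
  finally show ?thesis by (simp add: frame_lborel_def)
qed

lemma nn_integral_lborel_split:
  fixes B B' :: "(real^'n) set"
  assumes BB: "orthonormal_basis_of (B \<union> B') UNIV" "B \<inter> B' = {}" and [measurable]: "h \<in> borel_measurable borel"
  shows "(\<integral>\<^sup>+x. h x \<partial>lborel) = (\<integral>\<^sup>+w. (\<integral>\<^sup>+v. h ((\<Sum>b\<in>B'. w b *\<^sub>R b) + (\<Sum>b\<in>B. v b *\<^sub>R b)) \<partial>Pi\<^sub>M B (\<lambda>_. lborel)) \<partial>Pi\<^sub>M B' (\<lambda>_. lborel))"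
proof -
  have fin: "finite B" "finite B'" using orthonormal_basis_ofD(1)[OF BB(1)] by auto
  have "(\<integral>\<^sup>+x. h x \<partial>lborel) = (\<integral>\<^sup>+x. h x \<partial>frame_lborel (B' \<union> B))"
    using frame_lborel_UNIV[OF BB(1)] by (simp add: Un_commute)
  also have "\<dots> = (\<integral>\<^sup>+x. h (\<Sum>b\<in>B' \<union> B. x b *\<^sub>R b) \<partial>Pi\<^sub>M (B' \<union> B) (\<lambda>_. lborel))"
    unfolding frame_lborel_def by (rule nn_integral_distr) measurable
  also have "\<dots> = (\<integral>\<^sup>+w. (\<integral>\<^sup>+v. h (\<Sum>b\<in>B' \<union> B. merge B' B (w, v) b *\<^sub>R b) \<partial>Pi\<^sub>M B (\<lambda>_. lborel)) \<partial>Pi\<^sub>M B' (\<lambda>_. lborel))"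
    by (rule lborel_product.product_nn_integral_fold) (use BB(2) fin in auto)
  also have "(\<lambda>w v. \<Sum>b\<in>B' \<union> B. merge B' B (w, v) b *\<^sub>R b) = (\<lambda>w v. (\<Sum>b\<in>B'. w b *\<^sub>R b) + (\<Sum>b\<in>B. v b *\<^sub>R b))"
  proof (intro ext)
    fix w v :: "real^'n \<Rightarrow> real"
    have d: "B' \<inter> B = {}" using BB(2) by auto
    show "(\<Sum>b\<in>B' \<union> B. merge B' B (w, v) b *\<^sub>R b) = (\<Sum>b\<in>B'. w b *\<^sub>R b) + (\<Sum>b\<in>B. v b *\<^sub>R b)"
      unfolding sum.union_disjoint[OF fin(2,1) d]
      using d by (intro arg_cong2[where f="(+)"] sum.cong) (auto simp: merge_def)
  qed
  finally show ?thesis .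
qed

text \<open>The factor \<open>c\<close> is the integral of \<open>(1 - |z|\<^sup>2)\<^bsup>m/2\<^esup>\<close> over the unit ball of the orthogonal complement;
  only its independence of \<open>f\<close> matters.\<close>

lemma proj_ball_integral:
  fixes B :: "(real^'n) set"
  assumes B: "orthonormal_basis_of B \<xi>" and m: "card B = m"
  obtains c where "\<And>f. f \<in> borel_measurable borel \<Longrightarrow>
    (\<integral>\<^sup>+x. (if proj_mat \<xi> *v x \<noteq> 0 \<and> norm x < 1 then f (sgn (proj_mat \<xi> *v x)) else 0) \<partial>lborel)
      = c * (\<integral>\<^sup>+x. (if x \<noteq> 0 \<and> norm x < 1 then f (sgn x) else 0) \<partial>frame_lborel B)"
proof -
  note D = orthonormal_basis_ofD[OF B]
  obtain C where C: "orthonormal_basis_of C UNIV" "B \<subseteq> C"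
    using orthonormal_basis_extend[OF B subset_UNIV subspace_UNIV] by blast
  define B' where "B' = C - B"
  have BB: "orthonormal_basis_of (B \<union> B') UNIV" "B \<inter> B' = {}"
    using C by (auto simp: B'_def Un_absorb1)
  have fin': "finite B'" using orthonormal_basis_ofD(1)[OF BB(1)] by simp
  have orth: "b \<bullet> b' = 0" if "b \<in> B" "b' \<in> B'" for b b'
    using orthonormal_basis_inner[OF BB(1), of b b'] that BB(2) by auto
  define s where "s = (\<lambda>v. \<Sum>b\<in>B. v b *\<^sub>R b)"
  define s' where "s' = (\<lambda>w. \<Sum>b\<in>B'. w b *\<^sub>R b)"
  have ss: "s' w \<bullet> s v = 0" for w v
    unfolding s_def s'_def inner_sum_left inner_sum_right
    by (intro sum.neutral ballI) (simp add: orth inner_commute)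
  have P: "proj_mat \<xi> *v (s' w + s v) = s v" for w v
  proof -
    have "(s' w + s v) \<bullet> b = v b" if b: "b \<in> B" for b
    proof -
      have "s' w \<bullet> b = 0" unfolding s'_def inner_sum_left
        by (intro sum.neutral ballI) (use orth[OF b] in \<open>simp add: inner_commute\<close>)
      moreover have "s v \<bullet> b = (\<Sum>c\<in>B. if c = b then v c else 0)" unfolding s_def inner_sum_left
        by (intro sum.cong) (auto simp: orthonormal_basis_inner[OF B _ b])
      ultimately show ?thesis using D(1) b by (simp add: inner_add_left)
    qed
    thus ?thesis unfolding proj_mat_basis[OF B] by (simp add: s_def)
  qed
  have n: "norm (s' w + s v) < 1 \<longleftrightarrow> (norm (s v))\<^sup>2 < 1 - (norm (s' w))\<^sup>2" for w v
  proof -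
    have "(norm (s' w + s v))\<^sup>2 = (norm (s' w))\<^sup>2 + (norm (s v))\<^sup>2"
      by (rule norm_add_Pythagorean) (simp add: orthogonal_def ss)
    moreover have "norm (s' w + s v) < 1 \<longleftrightarrow> (norm (s' w + s v))\<^sup>2 < 1"
      by (simp add: abs_square_less_1)
    ultimately show ?thesis by linarith
  qed
  have [measurable]: "s' \<in> borel_measurable (Pi\<^sub>M B' (\<lambda>_. lborel))" unfolding s'_def by measurable
  have [measurable]: "s \<in> borel_measurable (Pi\<^sub>M B (\<lambda>_. lborel))" unfolding s_def by measurable
  \<comment> \<open>For a fixed component \<open>s' w\<close> in the complement, the slice of the
    unit ball is a ball of radius \<open>sqrt (1 - |s' w|^2)\<close> in \<open>\<xi>\<close>.
    Homogeneity turns it into the unit ball at the cost of the m-th power of this radius.\<close>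
  define k where "k = (\<lambda>w. if norm (s' w) < 1 then ennreal (sqrt (1 - (norm (s' w))\<^sup>2) ^ m) else 0)"
  have [measurable]: "k \<in> borel_measurable (Pi\<^sub>M B' (\<lambda>_. lborel))" unfolding k_def by measurable
  have hom: "homogeneous_measure m (frame_lborel B)" using homogeneous_frame_lborel[OF D(1)] m by simp
  show thesis
  proof (rule that)
    fix f :: "real^'n \<Rightarrow> ennreal" assume [measurable]: "f \<in> borel_measurable borel"
    define J where "J = (\<integral>\<^sup>+x. (if x \<noteq> 0 \<and> norm x < 1 then f (sgn x) else 0) \<partial>frame_lborel B)"
    have inner: "(\<integral>\<^sup>+v. (if s v \<noteq> 0 \<and> (norm (s v))\<^sup>2 < 1 - (norm (s' w))\<^sup>2 then f (sgn (s v)) else 0) \<partial>Pi\<^sub>M B (\<lambda>_. lborel)) = k w * J" for w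
    proof -
      define a where "a = 1 - (norm (s' w))\<^sup>2"
      have "(\<integral>\<^sup>+v. (if s v \<noteq> 0 \<and> (norm (s v))\<^sup>2 < a then f (sgn (s v)) else 0) \<partial>Pi\<^sub>M B (\<lambda>_. lborel))
          = (\<integral>\<^sup>+y. (if y \<noteq> 0 \<and> (norm y)\<^sup>2 < a then f (sgn y) else 0) \<partial>frame_lborel B)"
        unfolding frame_lborel_def s_def by (rule nn_integral_distr[symmetric]) measurable
      also have "\<dots> = k w * J"
      proof (cases "norm (s' w) < 1")
        case True
        hence a: "a > 0" by (simp add: a_def abs_square_less_1)
        define r where "r = sqrt a"
        have r: "r > 0" "r\<^sup>2 = a" using a by (auto simp: r_def)
        have sc: "(norm (r *\<^sub>R x))\<^sup>2 < a \<longleftrightarrow> norm x < 1" for x :: "real^'n"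
        proof -
          have "(norm (r *\<^sub>R x))\<^sup>2 = a * (norm x)\<^sup>2" using r by (simp add: power_mult_distrib)
          also have "\<dots> < a \<longleftrightarrow> (norm x)\<^sup>2 < 1" using a by simp
          also have "\<dots> \<longleftrightarrow> norm x < 1" by (simp add: abs_square_less_1)
          finally show ?thesis .
        qed
        have "(\<integral>\<^sup>+y. (if y \<noteq> 0 \<and> (norm y)\<^sup>2 < a then f (sgn y) else 0) \<partial>frame_lborel B)
            = ennreal (r ^ m) * (\<integral>\<^sup>+x. (if x \<noteq> 0 \<and> norm x < 1 then f (sgn x) else 0) \<partial>frame_lborel B)"
        proof -
          have "sgn (r *\<^sub>R x) = sgn x" for x :: "real^'n" using r(1) by (simp add: sgn_div_norm)
          thus ?thesis using sc r(1)
            by (subst homogeneous_measure_scale_integral[OF hom r(1)]) (simp_all cong: if_cong)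
        qed
        thus ?thesis using True by (simp add: k_def J_def r_def a_def)
      next
        case False
        hence "a \<le> 0" by (simp add: a_def)
        hence "\<not> (norm y)\<^sup>2 < a" for y :: "real^'n" by (meson le_less_trans not_le order_trans zero_le_power2)
        thus ?thesis using False by (simp add: k_def)
      qed
      finally show ?thesis by (simp add: a_def)
    qed
    have "(\<integral>\<^sup>+x. (if proj_mat \<xi> *v x \<noteq> 0 \<and> norm x < 1 then f (sgn (proj_mat \<xi> *v x)) else 0) \<partial>lborel)
        = (\<integral>\<^sup>+w. (\<integral>\<^sup>+v. (if s v \<noteq> 0 \<and> (norm (s v))\<^sup>2 < 1 - (norm (s' w))\<^sup>2 then f (sgn (s v)) else 0) \<partial>Pi\<^sub>M B (\<lambda>_. lborel)) \<partial>Pi\<^sub>M B' (\<lambda>_. lborel))"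
    proof -
      have split: "(\<integral>\<^sup>+x. h x \<partial>lborel) = (\<integral>\<^sup>+w. (\<integral>\<^sup>+v. h (s' w + s v) \<partial>Pi\<^sub>M B (\<lambda>_. lborel)) \<partial>Pi\<^sub>M B' (\<lambda>_. lborel))"
        if "h \<in> borel_measurable borel" for h
        using nn_integral_lborel_split[OF BB that] by (simp add: s_def s'_def)
      show ?thesis by (subst split) (measurable, simp only: P n)
    qed
    also have "\<dots> = (\<integral>\<^sup>+w. k w \<partial>Pi\<^sub>M B' (\<lambda>_. lborel)) * J"
      unfolding inner by (rule nn_integral_multc) measurable
    finally show "(\<integral>\<^sup>+x. (if proj_mat \<xi> *v x \<noteq> 0 \<and> norm x < 1 then f (sgn (proj_mat \<xi> *v x)) else 0) \<partial>lborel)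
        = (\<integral>\<^sup>+w. k w \<partial>Pi\<^sub>M B' (\<lambda>_. lborel)) * (\<integral>\<^sup>+x. (if x \<noteq> 0 \<and> norm x < 1 then f (sgn x) else 0) \<partial>frame_lborel B)"
      unfolding J_def .
  qed
qed

text \<open>Dilation by 2 fixes the origin but multiplies mass by \<open>2 ^ card B\<close>, so the
  mass of the origin, finite because the unit ball has finite mass, must vanish.\<close>

lemma emeasure_frame_lborel_zero:
  assumes B: "orthonormal_basis_of B \<xi>" and m: "card B \<ge> 1"
  shows "emeasure (frame_lborel B) {0} = 0"
proof -
  let ?a = "emeasure (frame_lborel B) {0}"
  have "?a \<le> emeasure (frame_lborel B) (cball 0 1)" by (rule emeasure_mono) auto
  hence "?a < \<infinity>" unfolding emeasure_frame_lborel_cball[OF B] by (simp add: le_less_trans)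
  then obtain r where r: "?a = ennreal r" "r \<ge> 0" by (cases ?a) auto
  have "{x. 2 *\<^sub>R x \<in> {0::real^'a}} = {0}" by auto
  hence "?a = ennreal (2 ^ card B) * ?a"
    using homogeneous_measureD(2)[OF homogeneous_frame_lborel[OF orthonormal_basis_ofD(1)[OF B]], of 2 "{0}"]
    by simp
  hence "ennreal r = ennreal (2 ^ card B * r)" using r by (metis ennreal_mult' r(2) ennreal_mult zero_le_numeral zero_le_power)
  hence "r = 2 ^ card B * r" using r(2) by (simp add: ennreal_inj)
  moreover have "1 < (2::real) ^ card B" by (rule one_less_power) (use m in auto)
  ultimately have "r = 0" by simp
  thus ?thesis using r by simp
qed

section \<open>Section volumes as expectations\<close>

lemma AE_unif_ball_norm: "AE x in (unif_ball :: 'a::euclidean_space measure). norm x < 1"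
proof -
  have "AE x in lborel. x \<in> cball 0 1 \<longrightarrow> norm (x::'a) < 1"
    using AE_lborel_norm_neq by eventually_elim auto
  thus ?thesis unfolding unif_ball_def by (intro AE_uniform_measureI) auto
qed

text \<open>Passes from the closed to the open ball, matching the strict inequalities of the cone
  formula.\<close>

lemma nn_integral_unif_ball:
  fixes f :: "'a::euclidean_space \<Rightarrow> ennreal"
  assumes [measurable]: "f \<in> borel_measurable borel"
  shows "(\<integral>\<^sup>+x. f x \<partial>unif_ball) = (\<integral>\<^sup>+x. (if norm x < 1 then f x else 0) \<partial>lborel) / emeasure lborel (ball (0::'a) 1)"
proof -
  have "(\<integral>\<^sup>+x. f x \<partial>unif_ball) = (\<integral>\<^sup>+x. f x * indicator (cball 0 1) x \<partial>lborel) / emeasure lborel (cball (0::'a) 1)"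
    unfolding unif_ball_def by (rule nn_integral_uniform_measure) auto
  also have "(\<integral>\<^sup>+x. f x * indicator (cball 0 1) x \<partial>lborel) = (\<integral>\<^sup>+x. (if norm x < 1 then f x else 0) \<partial>lborel)"
    by (rule nn_integral_cong_AE) (use AE_lborel_norm_neq in \<open>eventually_elim, auto simp: indicator_def\<close>)
  also have "emeasure lborel (cball (0::'a) 1) = emeasure lborel (ball (0::'a) 1)"
    by (simp add: emeasure_cball emeasure_ball)
  finally show ?thesis .
qed

text \<open>The cone formula inside the plane is compared with the projection of a uniform vector of
  the whole space. The unknown factor \<open>c\<close> is never computed: the constant function 1
  calibrates it through \<open>c\<omega>\<close>.\<close>

lemma frame_lborel_radial:
  fixes \<xi> :: "(real^'n) set" and \<rho> :: "real^'n \<Rightarrow> real"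
  assumes B: "orthonormal_basis_of B \<xi>" and m: "dim \<xi> \<ge> 1"
    and [measurable]: "\<rho> \<in> borel_measurable borel" and pos: "\<And>x. x \<noteq> 0 \<Longrightarrow> \<rho> (sgn x) > 0"
  shows "emeasure (frame_lborel B) {x. x \<noteq> 0 \<and> norm x \<le> \<rho> (sgn x)}
    = ennreal (unit_ball_vol (real (dim \<xi>))) * (\<integral>\<^sup>+x. ennreal (\<rho> (sgn (proj_mat \<xi> *v x)) ^ dim \<xi>) \<partial>unif_ball)"
proof -
  note D = orthonormal_basis_ofD[OF B]
  let ?m = "dim \<xi>" and ?F = "frame_lborel B" and ?A = "proj_mat \<xi>"
  have sub: "subspace \<xi>" using D(6) subspace_span by blast
  have hom: "homogeneous_measure ?m ?F" using homogeneous_frame_lborel[OF D(1)] D(3) by simp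
  obtain c where c: "\<And>f. f \<in> borel_measurable borel \<Longrightarrow>
    (\<integral>\<^sup>+x. (if ?A *v x \<noteq> 0 \<and> norm x < 1 then f (sgn (?A *v x)) else 0) \<partial>lborel)
      = c * (\<integral>\<^sup>+x. (if x \<noteq> 0 \<and> norm x < 1 then f (sgn x) else 0) \<partial>?F)"
    using proj_ball_integral[OF B D(3)] by blast
  define J where "J = (\<lambda>f::real^'n \<Rightarrow> ennreal. \<integral>\<^sup>+x. (if x \<noteq> 0 \<and> norm x < 1 then f (sgn x) else 0) \<partial>?F)"
  define \<beta> where "\<beta> = emeasure lborel (ball (0::real^'n) 1)"
  have \<beta>: "\<beta> \<noteq> 0" "\<beta> \<noteq> \<infinity>" 
    using emeasure_cball_bounds[where 'a="real^'n"] by (auto simp: \<beta>_def emeasure_ball emeasure_cball)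
  have E: "(\<integral>\<^sup>+x. f (sgn (?A *v x)) \<partial>unif_ball) = c * J f / \<beta>"
    if [measurable]: "f \<in> borel_measurable borel" for f
  proof -
    have "(\<integral>\<^sup>+x. (if norm x < 1 then f (sgn (?A *v x)) else 0) \<partial>lborel)
       = (\<integral>\<^sup>+x. (if ?A *v x \<noteq> 0 \<and> norm x < 1 then f (sgn (?A *v x)) else 0) \<partial>lborel)"
      by (rule nn_integral_cong_AE) (use AE_lborel_proj_nonzero[OF sub m] in \<open>eventually_elim, auto\<close>)
    thus ?thesis by (simp add: nn_integral_unif_ball c J_def \<beta>_def)
  qed
  have ones: "J (\<lambda>_. 1) = ennreal (unit_ball_vol ?m)"
  proof -
    have "J (\<lambda>_. 1) = emeasure ?F {x. x \<noteq> 0 \<and> ennreal (norm x ^ ?m) < 1}"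
      unfolding J_def by (rule homogeneous_measure_cone[OF hom m, of "\<lambda>_. 1", symmetric]) simp
    also have "{x::real^'n. x \<noteq> 0 \<and> ennreal (norm x ^ ?m) < 1} = {x. x \<noteq> 0 \<and> norm x < 1}"
    proof -
      have "ennreal (norm x ^ ?m) < 1 \<longleftrightarrow> norm x < 1" for x :: "real^'n"
        using ennreal_power_norm_less[of 1 ?m x] m by simp
      thus ?thesis by auto
    qed
    also have "emeasure ?F \<dots> = emeasure ?F {x. x \<noteq> 0 \<and> norm x \<le> 1}"
      by (rule homogeneous_measure_radial_boundary[OF hom, of "\<lambda>_. 1", symmetric]) auto
    also have "\<dots> = emeasure ?F (cball 0 1)"
    proof (rule emeasure_eq_AE)
      have "{0} \<in> null_sets ?F" using emeasure_frame_lborel_zero[OF B] m D(3) by (intro null_setsI) auto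
      hence "AE x in ?F. x \<notin> {0}" by (rule AE_not_in)
      thus "AE x in ?F. (x \<in> {x. x \<noteq> 0 \<and> norm x \<le> 1}) = (x \<in> cball 0 1)" by eventually_elim auto
    qed auto
    finally show ?thesis using emeasure_frame_lborel_cball[OF B] D(3) by simp
  qed
  have \<omega>: "unit_ball_vol (real ?m) > 0" by (rule unit_ball_vol_pos) simp
  have c\<omega>: "c * ennreal (unit_ball_vol ?m) = \<beta>"
  proof -
    have "1 = c * ennreal (unit_ball_vol ?m) / \<beta>"
      using E[of "\<lambda>_. 1"] prob_space.emeasure_space_1[OF prob_space_unif_ball[where 'a="real^'n"]] by (simp add: ones)
    hence "\<beta> = \<beta> * (c * ennreal (unit_ball_vol ?m) / \<beta>)" by simp
    also have "\<dots> = c * ennreal (unit_ball_vol ?m) * \<beta> / \<beta>" by (simp only: ennreal_times_divide mult.commute)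
    also have "\<dots> = c * ennreal (unit_ball_vol ?m)" using \<beta> by (intro ennreal_mult_divide_eq) auto
    finally show ?thesis ..
  qed
  have "emeasure ?F {x. x \<noteq> 0 \<and> norm x \<le> \<rho> (sgn x)} = emeasure ?F {x. x \<noteq> 0 \<and> norm x < \<rho> (sgn x)}"
    by (rule homogeneous_measure_radial_boundary[OF hom]) (use pos in auto)
  also have "{x. x \<noteq> 0 \<and> norm x < \<rho> (sgn x)} = {x. x \<noteq> 0 \<and> ennreal (norm x ^ ?m) < ennreal (\<rho> (sgn x) ^ ?m)}"
    using ennreal_power_norm_less[OF less_imp_le[OF pos] m] by blast
  also have "emeasure ?F \<dots> = J (\<lambda>u. ennreal (\<rho> u ^ ?m))"
    unfolding J_def by (rule homogeneous_measure_cone[OF hom m]) measurable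
  also have "\<dots> = ennreal (unit_ball_vol ?m) * (c * J (\<lambda>u. ennreal (\<rho> u ^ ?m)) / \<beta>)"
  proof -
    have "ennreal (unit_ball_vol ?m) * (c * J (\<lambda>u. ennreal (\<rho> u ^ ?m)) / \<beta>)
        = (c * ennreal (unit_ball_vol ?m)) * J (\<lambda>u. ennreal (\<rho> u ^ ?m)) / \<beta>"
      by (simp only: ennreal_times_divide mult_ac)
    also have "\<dots> = J (\<lambda>u. ennreal (\<rho> u ^ ?m)) * \<beta> / \<beta>" by (simp only: c\<omega> mult.commute)
    also have "\<dots> = J (\<lambda>u. ennreal (\<rho> u ^ ?m))" using \<beta> by (intro ennreal_mult_divide_eq) auto
    finally show ?thesis ..
  qed
  also have "c * J (\<lambda>u. ennreal (\<rho> u ^ ?m)) / \<beta> = (\<integral>\<^sup>+x. ennreal (\<rho> (sgn (?A *v x)) ^ ?m) \<partial>unif_ball)"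
    by (rule E[symmetric]) measurable
  finally show ?thesis .
qed

text \<open>The direction of a projected uniform vector is uniform in the plane. In this form the
  volume depends on \<open>\<xi>\<close> only through its projection matrix and its dimension, with
  one fixed law to integrate against.\<close>

lemma section_vol_eq:
  fixes \<xi> :: "(real^'n) set" and \<rho> :: "real^'n \<Rightarrow> real"
  assumes \<xi>: "subspace \<xi>" and m: "dim \<xi> \<ge> 1"
    and [measurable]: "\<rho> \<in> borel_measurable borel" and pos: "\<And>x. x \<noteq> 0 \<Longrightarrow> \<rho> (sgn x) > 0"
    and le: "\<And>x. x \<noteq> 0 \<Longrightarrow> \<rho> (sgn x) \<le> R"
    and K: "\<And>x. x \<noteq> 0 \<Longrightarrow> x \<in> K \<longleftrightarrow> norm x \<le> \<rho> (sgn x)" and [measurable]: "K \<in> sets borel"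
  shows "section_vol K \<xi> = unit_ball_vol (real (dim \<xi>)) * (\<integral>x. \<rho> (sgn (proj_mat \<xi> *v x)) ^ dim \<xi> \<partial>unif_ball)"
proof -
  define B where "B = (SOME B. orthonormal_basis_of B \<xi>)"
  have B: "orthonormal_basis_of B \<xi>"
    using someI_ex[OF orthonormal_basis_exists[OF \<xi>]] by (simp add: B_def)
  note D = orthonormal_basis_ofD[OF B]
  let ?F = "frame_lborel B"
  interpret U: prob_space "unif_ball :: (real^'n) measure" by (rule prob_space_unif_ball)
  have sv: "section_vol K \<xi> = measure ?F (K \<inter> \<xi>)"
    by (simp add: section_vol_def subspace_lborel_def Let_def frame_lborel_def B_def)
  have [measurable]: "\<xi> \<in> sets borel" using closed_subspace[OF \<xi>] by auto
  have "AE x in ?F. x \<in> \<xi>"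
    unfolding frame_lborel_def using D(5) \<xi>
    by (subst AE_distr_iff) (auto intro!: subspace_sum subspace_scale)
  moreover have "AE x in ?F. x \<notin> {0}"
    using emeasure_frame_lborel_zero[OF B] m D(3) by (intro AE_not_in null_setsI) auto
  ultimately have "AE x in ?F. (x \<in> K \<inter> \<xi>) = (x \<in> {x. x \<noteq> 0 \<and> norm x \<le> \<rho> (sgn x)})"
    by eventually_elim (use K in auto)
  hence "emeasure ?F (K \<inter> \<xi>) = emeasure ?F {x. x \<noteq> 0 \<and> norm x \<le> \<rho> (sgn x)}"
    by (rule emeasure_eq_AE) auto
  also have "\<dots> = ennreal (unit_ball_vol (real (dim \<xi>))) * (\<integral>\<^sup>+x. ennreal (\<rho> (sgn (proj_mat \<xi> *v x)) ^ dim \<xi>) \<partial>unif_ball)"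
    by (rule frame_lborel_radial[OF B m]) (use pos in auto)
  also have "(\<integral>\<^sup>+x. ennreal (\<rho> (sgn (proj_mat \<xi> *v x)) ^ dim \<xi>) \<partial>unif_ball)
     = ennreal (\<integral>x. \<rho> (sgn (proj_mat \<xi> *v x)) ^ dim \<xi> \<partial>unif_ball)"
  proof (rule nn_integral_eq_integral)
    have nz: "AE x in unif_ball. proj_mat \<xi> *v x \<noteq> 0"
      using AE_lborel_proj_nonzero[OF \<xi> m] by (rule AE_unif_ballI)
    show "AE x in unif_ball. 0 \<le> \<rho> (sgn (proj_mat \<xi> *v x)) ^ dim \<xi>"
      using nz by eventually_elim (simp add: pos less_imp_le)
    show "integrable unif_ball (\<lambda>x. \<rho> (sgn (proj_mat \<xi> *v x)) ^ dim \<xi>)"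
    proof (rule U.integrable_const_bound[where B="R ^ dim \<xi>"])
      show "AE x in unif_ball. norm (\<rho> (sgn (proj_mat \<xi> *v x)) ^ dim \<xi>) \<le> R ^ dim \<xi>"
        using nz
      proof eventually_elim
        case (elim x)
        thus ?case using pos[OF elim] le[OF elim] by (simp add: power_mono)
      qed
    qed measurable
  qed
  finally have "emeasure ?F (K \<inter> \<xi>) = ennreal (unit_ball_vol (real (dim \<xi>)) * (\<integral>x. \<rho> (sgn (proj_mat \<xi> *v x)) ^ dim \<xi> \<partial>unif_ball))"
    by (simp add: ennreal_mult')
  moreover have "(\<integral>x. \<rho> (sgn (proj_mat \<xi> *v x)) ^ dim \<xi> \<partial>unif_ball) \<ge> 0"
  proof (rule integral_nonneg_AE)
    show "AE x in unif_ball. 0 \<le> \<rho> (sgn (proj_mat \<xi> *v x)) ^ dim \<xi>"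
      using AE_unif_ballI[OF AE_lborel_proj_nonzero[OF \<xi> m]] by eventually_elim (simp add: pos less_imp_le)
  qed
  ultimately show ?thesis by (simp add: sv measure_def)
qed

subsection \<open>Invariant measure on flags\<close>

text \<open>The plane is chosen before the direction in it. The law is taken on the Borel sets of
  the product, a Euclidean space, where \<open>invariant_measure_unique\<close> applies.\<close>

definition flag_law1 :: "nat \<Rightarrow> ((real^'n) \<times> (real^'n^'n)) measure" where
  "flag_law1 m = distr (random_extension m 0 \<Otimes>\<^sub>M unif_ball) borel (\<lambda>(A, x). (sgn (A *v x), A))"

text \<open>For nonzero \<open>y\<close> the process starts at the projection onto the line of
  \<open>y\<close>, so all resulting planes contain the direction \<open>sgn y\<close>. Averaging
  over \<open>y\<close> chooses the direction before the plane.\<close>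

definition flag_kernel :: "nat \<Rightarrow> real^'n \<Rightarrow> ((real^'n) \<times> (real^'n^'n)) measure" where
  "flag_kernel k y = distr (random_extension k (dyad y)) borel (\<lambda>B. (sgn y, B))"

definition flag_act :: "(real^'n \<Rightarrow> real^'n) \<Rightarrow> (real^'n) \<times> (real^'n^'n) \<Rightarrow> (real^'n) \<times> (real^'n^'n)" where
  "flag_act T = (\<lambda>(u, A). (T u, conj_mat T A))"

lemma measurable_flag_Pair:
  fixes f :: "'a \<Rightarrow> real^'n" and g :: "'a \<Rightarrow> real^'n^'n"
  assumes "f \<in> borel_measurable M" "g \<in> borel_measurable M"
  shows "(\<lambda>x. (f x, g x)) \<in> borel_measurable M"
  using measurable_Pair[OF assms] by (simp add: borel_prod)

lemma measurable_flag_Pair1: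
  fixes u :: "real^'n" and M :: "(real^'n^'n) measure"
  assumes [measurable_cong]: "sets M = sets borel"
  shows "Pair u \<in> M \<rightarrow>\<^sub>M borel"
  using measurable_flag_Pair[of "\<lambda>_. u" M "\<lambda>B. B"] by (simp add: measurable_ident_sets assms)

lemma measurable_flag_proj [measurable]:
  "fst \<in> borel_measurable (borel :: ((real^'n) \<times> (real^'n^'n)) measure)"
  "snd \<in> borel_measurable (borel :: ((real^'n) \<times> (real^'n^'n)) measure)"
  by (metis borel_prod measurable_fst, metis borel_prod measurable_snd)

lemma extend_proj_zero: "extend_proj 0 y = dyad y"
  by (simp add: extend_proj_def)

lemma flag_kernel_measurable [measurable]:
  "flag_kernel k \<in> borel \<rightarrow>\<^sub>M prob_algebra borel"
  unfolding flag_kernel_def[abs_def]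
proof (rule measurable_distr_prob_space2[where M=borel])
  show "(\<lambda>y. random_extension k (dyad y)) \<in> borel \<rightarrow>\<^sub>M prob_algebra borel"
    by (rule measurable_compose[OF _ random_extension_measurable]) measurable
  show "(\<lambda>(y, B). (sgn y, B)) \<in> borel \<Otimes>\<^sub>M borel \<rightarrow>\<^sub>M (borel :: ((real^'a) \<times> (real^'a^'a)) measure)"
    unfolding case_prod_unfold by (rule measurable_flag_Pair) measurable
qed

lemma flag_kernel_subprob:
  "flag_kernel k \<in> unif_ball \<rightarrow>\<^sub>M subprob_algebra borel"
  by (rule measurable_prob_algebraD) measurable

lemma orthogonal_transformation_sgn:
  "orthogonal_transformation T \<Longrightarrow> T (sgn x) = sgn (T x)"
  by (simp add: sgn_div_norm linear_scale orthogonal_transformation_linear orthogonal_transformation_norm)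

lemma conj_mat_zero: "conj_mat T 0 = (0 :: real^'n^'n)"
  using conj_mat_diff[of T 0 0] by simp

lemma flag_act_measurable:
  assumes "orthogonal_transformation T"
  shows "flag_act T \<in> borel_measurable borel"
proof -
  have [measurable]: "T \<in> borel_measurable borel" by (rule measurable_orthogonal_transformation[OF assms])
  show ?thesis unfolding flag_act_def case_prod_unfold by (rule measurable_flag_Pair) measurable
qed

lemma flag_law1_map_measurable:
  "(\<lambda>(A, x). (sgn (A *v x), A)) \<in> borel_measurable (random_extension m 0 \<Otimes>\<^sub>M unif_ball)"
  unfolding case_prod_unfold by (rule measurable_flag_Pair) measurable

text \<open>Since \<open>conj_mat T A *v T x = T (A *v x)\<close>, acting on the flag is the same as
  acting on the independent inputs \<open>A\<close> and \<open>x\<close>, each of which has an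
  invariant law.\<close>

lemma flag_law1_invariant:
  fixes T :: "real^'n \<Rightarrow> real^'n"
  assumes T: "orthogonal_transformation T"
  shows "distr (flag_law1 m) borel (flag_act T) = flag_law1 m"
proof -
  let ?R = "random_extension m (0 :: real^'n^'n)" and ?f = "\<lambda>(A::real^'n^'n, x). (sgn (A *v x), A)"
  have [measurable]: "T \<in> borel_measurable borel" by (rule measurable_orthogonal_transformation[OF T])
  note [measurable] = flag_law1_map_measurable[of m] flag_act_measurable[OF T]
  interpret U: prob_space "unif_ball :: (real^'n) measure" by (rule prob_space_unif_ball)
  have sf: "sigma_finite_measure (distr (unif_ball :: (real^'n) measure) borel T)"
    unfolding distr_unif_ball_orthogonal[OF T] by unfold_locales
  have f': "?f \<in> borel \<Otimes>\<^sub>M borel \<rightarrow>\<^sub>M borel"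
    unfolding case_prod_unfold by (rule measurable_flag_Pair) measurable
  have "distr (flag_law1 m) borel (flag_act T) = distr (?R \<Otimes>\<^sub>M unif_ball) borel (\<lambda>z. flag_act T (?f z))"
    unfolding flag_law1_def by (subst distr_distr) (auto simp: comp_def)
  also have "(\<lambda>z. flag_act T (?f z)) = (\<lambda>z. ?f (case z of (A, x) \<Rightarrow> (conj_mat T A, T x)))"
    by (auto simp: fun_eq_iff flag_act_def conj_mat_vector[OF T] orthogonal_transformation_sgn[OF T])
  also have "distr (?R \<Otimes>\<^sub>M unif_ball) borel \<dots>
     = distr (distr (?R \<Otimes>\<^sub>M unif_ball) (borel \<Otimes>\<^sub>M borel) (\<lambda>(A, x). (conj_mat T A, T x))) borel ?f"
    by (subst distr_distr[OF f']) (auto simp: comp_def)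
  also have "distr (?R \<Otimes>\<^sub>M unif_ball) (borel \<Otimes>\<^sub>M borel) (\<lambda>(A, x). (conj_mat T A, T x))
     = distr ?R borel (conj_mat T) \<Otimes>\<^sub>M distr unif_ball borel T"
    by (rule pair_measure_distr[symmetric]) (auto intro: sf)
  also have "\<dots> = ?R \<Otimes>\<^sub>M unif_ball"
    by (simp add: distr_random_extension_conj[OF T] distr_unif_ball_orthogonal[OF T] conj_mat_zero)
  finally show ?thesis unfolding flag_law1_def .
qed

lemma flag_kernel_act:
  fixes T :: "real^'n \<Rightarrow> real^'n"
  assumes T: "orthogonal_transformation T"
  shows "distr (flag_kernel k y) borel (flag_act T) = flag_kernel k (T y)"
proof -
  note [measurable] = flag_act_measurable[OF T]
  have m: "(\<lambda>B. (u, B)) \<in> (borel :: (real^'n^'n) measure) \<rightarrow>\<^sub>M borel" for u :: "real^'n"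
    by (rule measurable_flag_Pair1) simp
  have m': "(\<lambda>B. (u, B)) \<in> random_extension k A \<rightarrow>\<^sub>M borel" for u :: "real^'n" and A :: "real^'n^'n"
    by (rule measurable_flag_Pair1) simp
  have "distr (flag_kernel k y) borel (flag_act T)
      = distr (random_extension k (dyad y)) borel (\<lambda>B. (sgn (T y), conj_mat T B))"
    unfolding flag_kernel_def
    by (subst distr_distr[OF flag_act_measurable[OF T] m'])
      (simp add: comp_def flag_act_def orthogonal_transformation_sgn[OF T])
  also have "\<dots> = distr (distr (random_extension k (dyad y)) borel (conj_mat T)) borel (\<lambda>B. (sgn (T y), B))"
    by (subst distr_distr[OF m]) (auto simp: comp_def)
  also have "\<dots> = flag_kernel k (T y)"
    by (simp add: distr_random_extension_conj[OF T] flag_kernel_def dyad_orthogonal[OF T])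
  finally show ?thesis .
qed

lemma flag_law2_invariant:
  fixes T :: "real^'n \<Rightarrow> real^'n"
  assumes T: "orthogonal_transformation T"
  shows "distr (unif_ball \<bind> flag_kernel k) borel (flag_act T) = unif_ball \<bind> flag_kernel k"
proof -
  have [measurable]: "T \<in> borel_measurable borel" by (rule measurable_orthogonal_transformation[OF T])
  have "distr (unif_ball \<bind> flag_kernel k) borel (flag_act T)
      = unif_ball \<bind> (\<lambda>y. distr (flag_kernel k y) borel (flag_act T))"
    by (rule distr_bind[where K=borel]) (use flag_kernel_subprob flag_act_measurable[OF T] in simp_all)
  also have "\<dots> = unif_ball \<bind> (\<lambda>y. flag_kernel k (T y))" by (simp add: flag_kernel_act[OF T])
  also have "\<dots> = distr unif_ball borel T \<bind> flag_kernel k"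
    by (rule bind_distr[where K=borel, symmetric]) (auto intro: measurable_prob_algebraD)
  finally show ?thesis by (simp add: distr_unif_ball_orthogonal[OF T])
qed

section \<open>The space of flags and its invariant measure\<close>

definition flags :: "nat \<Rightarrow> ((real^'n) \<times> (real^'n^'n)) set" where
  "flags m = {(u, A). norm u = 1 \<and> (is_proj A \<and> trace A = real m) \<and> A *v u = u}"

lemma closed_flags: "closed (flags m :: ((real^'n) \<times> (real^'n^'n)) set)"
proof -
  have "closed (snd -` {A :: real^'n^'n. is_proj A \<and> trace A = real m} :: ((real^'n) \<times> (real^'n^'n)) set)"
    by (rule closed_vimage_snd[OF closed_is_proj_trace])
  moreover have "closed {z :: (real^'n) \<times> (real^'n^'n). norm (fst z) = 1 \<and> snd z *v fst z = fst z}"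
    by (intro closed_Collect_conj closed_Collect_eq continuous_intros)
  moreover have "flags m = snd -` {A :: real^'n^'n. is_proj A \<and> trace A = real m}
      \<inter> {z :: (real^'n) \<times> (real^'n^'n). norm (fst z) = 1 \<and> snd z *v fst z = fst z}"
    by (auto simp: flags_def)
  ultimately show ?thesis by auto
qed

lemma AE_random_extension_zero:
  assumes "m \<le> CARD('n)"
  shows "AE A in random_extension m (0 :: real^'n^'n). is_proj A \<and> trace A = real m"
proof -
  have "is_proj (0 :: real^'n^'n)" by (rule is_projI) auto
  moreover have "trace (0 :: real^'n^'n) = real 0" by (simp add: trace_def)
  ultimately show ?thesis using AE_random_extension[of "0 :: real^'n^'n" 0 m] assms by simp
qed

lemma AE_flag_law1:
  assumes m: "1 \<le> m" "m \<le> CARD('n)"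
  shows "AE z in (flag_law1 m :: ((real^'n) \<times> (real^'n^'n)) measure). z \<in> flags m"
proof -
  let ?R = "random_extension m (0 :: real^'n^'n)"
  interpret U: prob_space "unif_ball :: (real^'n) measure" by (rule prob_space_unif_ball)
  interpret R: prob_space ?R by (rule prob_space_random_extension)
  interpret P: pair_prob_space ?R "unif_ball :: (real^'n) measure" ..
  note [measurable] = flag_law1_map_measurable[of m] borel_closed[OF closed_flags[of m]]
  have "AE z in ?R \<Otimes>\<^sub>M unif_ball. (case z of (A, x) \<Rightarrow> (sgn (A *v x), A)) \<in> flags m"
  proof (rule P.AE_pair_measure)
    show "{z \<in> space (?R \<Otimes>\<^sub>M unif_ball). (case z of (A, x) \<Rightarrow> (sgn (A *v x), A)) \<in> flags m} \<in> sets (?R \<Otimes>\<^sub>M unif_ball)"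
      by measurable
    show "AE A in ?R. AE x in unif_ball. (case (A, x) of (A, x) \<Rightarrow> (sgn (A *v x), A)) \<in> flags m"
      using AE_random_extension_zero[OF m(2)]
    proof eventually_elim
      case (elim A)
      hence A: "is_proj A" "trace A \<noteq> 0" using m(1) by auto
      show ?case using AE_unif_ballI[OF AE_lborel_matrix_vector_nonzero[OF A(2)]]
      proof eventually_elim
        case (elim x)
        have "A *v sgn (A *v x) = sgn (A *v x)"
          by (simp add: sgn_div_norm matrix_vector_mult_scaleR is_projD(1)[OF A(1)])
        thus ?case using elim \<open>is_proj A \<and> _\<close> by (simp add: flags_def norm_sgn)
      qed
    qed
  qed
  thus ?thesis unfolding flag_law1_def by (subst AE_distr_iff) auto
qed

lemma AE_flag_kernel:
  fixes y :: "real^'n"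
  assumes k: "Suc k \<le> CARD('n)" and y: "y \<noteq> 0"
  shows "AE z in flag_kernel k y. z \<in> flags (Suc k)"
proof -
  have "is_proj (0 :: real^'n^'n)" by (rule is_projI) auto
  moreover have "y \<notin> range ((*v) (0 :: real^'n^'n))" using y by auto
  ultimately have d: "is_proj (dyad y)" "trace (dyad y) = real 1"
    using extend_proj[of "0 :: real^'n^'n" y] by (simp_all add: extend_proj_zero trace_def[of 0])
  have m: "(\<lambda>B. (sgn y, B)) \<in> random_extension k (dyad y) \<rightarrow>\<^sub>M borel"
    by (rule measurable_flag_Pair1) simp
  have "AE B in random_extension k (dyad y). (sgn y, B) \<in> flags (Suc k)"
    using AE_random_extension[OF d, of k, unfolded plus_1_eq_Suc, OF k]
  proof eventually_elim
    case (elim B)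
    have dy: "dyad y *v y = y" using y by (simp add: dyad_vector)
    have "B *v y = y" using elim by (metis dy matrix_vector_mul_assoc)
    hence "B *v sgn y = sgn y" by (simp add: sgn_div_norm matrix_vector_mult_scaleR)
    thus ?case using elim y by (simp add: flags_def norm_sgn)
  qed
  thus ?thesis unfolding flag_kernel_def using borel_closed[OF closed_flags]
    by (subst AE_distr_iff[OF m]) auto
qed

text \<open>An orthogonal map matching the lines and the planes sends \<open>u\<close> to
  \<open>v\<close> or to \<open>-v\<close>. In the second case its negative is used, which acts on
  projections in the same way.\<close>

lemma flag_transitive:
  fixes u v :: "real^'n"
  assumes "(u, A) \<in> flags m" "(v, B) \<in> flags m"
  obtains T where "orthogonal_transformation T" "flag_act T (u, A) = (v, B)"
proof -
  have A: "norm u = 1" "is_proj A" "trace A = real m" "A *v u = u"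
   and B: "norm v = 1" "is_proj B" "trace B = real m" "B *v v = v"
    using assms by (auto simp: flags_def)
  let ?A = "range ((*v) A)" and ?B = "range ((*v) B)"
  have uA: "u \<in> ?A" and vB: "v \<in> ?B" using A(4) B(4) by (metis rangeI)+
  have sub: "subspace ?A" "subspace ?B" by (auto intro: linear_subspace_image)
  have "dim ?A = dim ?B" using is_proj_trace[OF A(2)] is_proj_trace[OF B(2)] A(3) B(3) by simp
  moreover have "dim (span {u}) = dim (span {v})"
  proof -
    have "u \<noteq> 0" "v \<noteq> 0" using A(1) B(1) by auto
    thus ?thesis by (simp add: dim_insert)
  qed
  ultimately obtain T where T: "orthogonal_transformation T" "T ` span {u} = span {v}" "T ` ?A = ?B"
    using orthogonal_transformation_nested_subspaces[of "span {u}" ?A "span {v}" ?B] sub uA vB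
    by (metis empty_subsetI insert_subset span_minimal subspace_span)
  have cT: "conj_mat T A = B"
    using proj_mat_image[OF T(1) sub(1)] T(3) proj_mat_range[OF A(2)] proj_mat_range[OF B(2)] by simp
  have "T u \<in> span {v}" using T(2) by (metis imageI singletonI span_base)
  then obtain c where c: "T u = c *\<^sub>R v" by (auto simp: span_singleton)
  have "\<bar>c\<bar> = 1" using orthogonal_transformation_norm[OF T(1), of u] A(1) B(1) c by simp
  hence "c = 1 \<or> c = -1" by linarith
  thus thesis
  proof
    assume "c = 1"
    thus thesis using that[OF T(1)] c cT by (simp add: flag_act_def)
  next
    assume c1: "c = -1"
    have N: "orthogonal_transformation (\<lambda>x. - T x)" using T(1) by (simp add: orthogonal_transformation_neg)
    have "conj_mat (\<lambda>x. - T x) A = B"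
    proof (rule conj_mat_eqI[OF N])
      show "B *v - T x = - T (A *v x)" for x
        using conj_mat_vector[OF T(1), of A x] cT
        by (metis add.inverse_inverse matrix_vector_mult_scaleR scaleR_minus1_left)
    qed
    thus thesis using that[OF N] c c1 by (simp add: flag_act_def)
  qed
qed

lemma flag_laws_eq:
  assumes k: "Suc k \<le> CARD('n)"
  shows "flag_law1 (Suc k) = (unif_ball \<bind> flag_kernel k :: ((real^'n) \<times> (real^'n^'n)) measure)"
proof (rule invariant_measure_unique[where X="flags (Suc k)" and \<Gamma>="{flag_act T | T. orthogonal_transformation T}"])
  interpret U: prob_space "unif_ball :: (real^'n) measure" by (rule prob_space_unif_ball)
  interpret R: prob_space "random_extension (Suc k) (0 :: real^'n^'n)" by (rule prob_space_random_extension)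
  interpret P: pair_prob_space "random_extension (Suc k) (0 :: real^'n^'n)" "unif_ball :: (real^'n) measure" ..
  show "bounded (flags (Suc k) :: ((real^'n) \<times> (real^'n^'n)) set)"
  proof (rule bounded_subset)
    show "bounded (sphere (0::real^'n) 1 \<times> {A :: real^'n^'n. is_proj A})"
      by (intro bounded_Times bounded_is_proj) auto
  qed (auto simp: flags_def)
  show "prob_space (flag_law1 (Suc k) :: ((real^'n) \<times> (real^'n^'n)) measure)"
    unfolding flag_law1_def by (rule P.prob_space_distr[OF flag_law1_map_measurable])
  show "sets (flag_law1 (Suc k) :: ((real^'n) \<times> (real^'n^'n)) measure) = sets borel" by (simp add: flag_law1_def)
  show "AE z in (flag_law1 (Suc k) :: ((real^'n) \<times> (real^'n^'n)) measure). z \<in> flags (Suc k)"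
    by (rule AE_flag_law1) (use k in auto)
  show "prob_space (unif_ball \<bind> flag_kernel k :: ((real^'n) \<times> (real^'n^'n)) measure)"
    by (rule prob_space_bind'[OF unif_ball_in_prob_algebra]) measurable
  show "sets (unif_ball \<bind> flag_kernel k :: ((real^'n) \<times> (real^'n^'n)) measure) = sets borel"
    by (rule sets_bind'[OF unif_ball_in_prob_algebra]) measurable
  show "AE z in (unif_ball \<bind> flag_kernel k :: ((real^'n) \<times> (real^'n^'n)) measure). z \<in> flags (Suc k)"
  proof (subst AE_bind[OF flag_kernel_subprob])
    show "AE y in unif_ball. AE z in flag_kernel k (y :: real^'n). z \<in> flags (Suc k)"
      using AE_unif_ball_nonzero by eventually_elim (rule AE_flag_kernel[OF k])
  qed (use borel_closed[OF closed_flags] in \<open>simp add: pred_def\<close>)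
  show "g \<in> borel_measurable borel" if "g \<in> {flag_act T | T. orthogonal_transformation T}"
    for g :: "(real^'n) \<times> (real^'n^'n) \<Rightarrow> _"
    using that flag_act_measurable by auto
  show "distr (flag_law1 (Suc k)) borel g = flag_law1 (Suc k)" if "g \<in> {flag_act T | T. orthogonal_transformation T}"
    for g :: "(real^'n) \<times> (real^'n^'n) \<Rightarrow> _"
    using that flag_law1_invariant by auto
  show "distr (unif_ball \<bind> flag_kernel k) borel g = unif_ball \<bind> flag_kernel k" if "g \<in> {flag_act T | T. orthogonal_transformation T}"
    for g :: "(real^'n) \<times> (real^'n^'n) \<Rightarrow> _"
    using that flag_law2_invariant by auto
  show "dist (g x) (g y) = dist x y" if g: "g \<in> {flag_act T | T. orthogonal_transformation T}"
    for g :: "(real^'n) \<times> (real^'n^'n) \<Rightarrow> _" and x y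
  proof -
    obtain T where T: "g = flag_act T" "orthogonal_transformation T" using g by auto
    have "dist (T a) (T b) = dist a b" for a b
      by (simp add: dist_norm linear_diff[OF orthogonal_transformation_linear[OF T(2)], symmetric]
          orthogonal_transformation_norm[OF T(2)])
    thus ?thesis by (cases x; cases y) (simp add: T(1) flag_act_def dist_Pair_Pair dist_conj_mat[OF T(2)])
  qed
next
  fix x y :: "(real^'n) \<times> (real^'n^'n)" assume "x \<in> flags (Suc k)" "y \<in> flags (Suc k)"
  thus "\<exists>g\<in>{flag_act T | T. orthogonal_transformation T}. g x = y"
    by (cases x; cases y) (metis (mono_tags, lifting) flag_transitive mem_Collect_eq)
qed

text \<open>The form for nonnegative functions, used to carry null sets of directions into
  planes.\<close>

lemma nn_integral_flag:
  fixes g :: "real^'n \<Rightarrow> real^'n^'n \<Rightarrow> ennreal"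
  assumes k: "Suc k \<le> CARD('n)" and g: "(\<lambda>(u, A). g u A) \<in> borel_measurable (borel \<Otimes>\<^sub>M borel)"
  shows "(\<integral>\<^sup>+A. \<integral>\<^sup>+x. g (sgn (A *v x)) A \<partial>unif_ball \<partial>random_extension (Suc k) 0)
       = (\<integral>\<^sup>+y. \<integral>\<^sup>+B. g (sgn y) B \<partial>random_extension k (dyad y) \<partial>unif_ball)"
proof -
  let ?R = "random_extension (Suc k) (0 :: real^'n^'n)" and ?g = "\<lambda>(u, A). g u A"
  interpret U: prob_space "unif_ball :: (real^'n) measure" by (rule prob_space_unif_ball)
  have g': "?g \<in> borel_measurable borel" using g by (simp add: borel_prod)
  note m1 = flag_law1_map_measurable[of "Suc k"]
  have "(\<integral>\<^sup>+A. \<integral>\<^sup>+x. g (sgn (A *v x)) A \<partial>unif_ball \<partial>?R) = (\<integral>\<^sup>+z. ?g (case z of (A, x) \<Rightarrow> (sgn (A *v x), A)) \<partial>(?R \<Otimes>\<^sub>M unif_ball))"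
    by (subst U.nn_integral_fst[symmetric, OF measurable_compose[OF m1 g']]) simp
  also have "\<dots> = (\<integral>\<^sup>+z. ?g z \<partial>flag_law1 (Suc k))"
    unfolding flag_law1_def by (rule nn_integral_distr[symmetric, OF m1]) (use g' in simp)
  also have "\<dots> = (\<integral>\<^sup>+y. \<integral>\<^sup>+z. ?g z \<partial>flag_kernel k y \<partial>unif_ball)"
    unfolding flag_laws_eq[OF k] by (rule nn_integral_bind[OF g' flag_kernel_subprob])
  also have "\<dots> = (\<integral>\<^sup>+y. \<integral>\<^sup>+B. g (sgn y) B \<partial>random_extension k (dyad y) \<partial>unif_ball)"
  proof (rule nn_integral_cong)
    fix y :: "real^'n"
    have m: "(\<lambda>B. (sgn y, B)) \<in> random_extension k (dyad y) \<rightarrow>\<^sub>M borel"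
      by (rule measurable_flag_Pair1) simp
    show "(\<integral>\<^sup>+z. ?g z \<partial>flag_kernel k y) = (\<integral>\<^sup>+B. g (sgn y) B \<partial>random_extension k (dyad y))"
      unfolding flag_kernel_def by (subst nn_integral_distr[OF m]) (use g' in simp_all)
  qed
  finally show ?thesis .
qed

subsection \<open>Wulff shapes and almost everywhere unique normals\<close>

text \<open>Two-sided bounds are what every member of the variation shares: \<open>h t\<close> is
  known to be continuous only at \<open>t = 0\<close>. Continuity is therefore added separately,
  where contact points have to exist.\<close>

locale wulff =
  fixes h :: "real^'n \<Rightarrow> real" and r R :: real
  assumes r: "0 < r" and h_ge: "\<And>v. norm v = 1 \<Longrightarrow> r \<le> h v" and h_le: "\<And>v. norm v = 1 \<Longrightarrow> h v \<le> R"
begin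

abbreviation "K \<equiv> wulff_shape h"
abbreviation "\<rho> \<equiv> radial_fun K"

lemma h_pos: "norm v = 1 \<Longrightarrow> 0 < h v"
  using h_ge r by fastforce

lemma r_le_R: "r \<le> R"
  using h_ge[of "axis undefined 1"] h_le[of "axis undefined 1"] by simp

lemma mem_K: "x \<in> K \<longleftrightarrow> (\<forall>v. norm v = 1 \<longrightarrow> x \<bullet> v \<le> h v)"
  by (auto simp: wulff_shape_def)

lemma closed_K: "closed K"
proof -
  have "K = (\<Inter>v\<in>sphere 0 1. {x. x \<bullet> v \<le> h v})" by (auto simp: wulff_shape_def)
  thus ?thesis by (auto intro!: closed_INT closed_Collect_le continuous_intros)
qed

lemma K_norm_le:
  assumes "x \<in> K" shows "norm x \<le> R"
proof (cases "x = 0")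
  case True thus ?thesis using r r_le_R by simp
next
  case False
  have "x \<bullet> sgn x = norm x" by (simp add: sgn_div_norm power2_norm_eq_inner[symmetric] power2_eq_square False)
  moreover have "norm (sgn x) = 1" using False by (simp add: norm_sgn)
  ultimately show ?thesis using assms h_le[of "sgn x"] unfolding mem_K by fastforce
qed

lemma cball_subset_K: "norm x \<le> r \<Longrightarrow> x \<in> K"
  unfolding mem_K using h_ge norm_cauchy_schwarz[of x] by (metis mult.right_neutral order_trans)

lemma scale_mem_K:
  assumes "s *\<^sub>R x \<in> K" "0 \<le> t" "t \<le> s" shows "t *\<^sub>R x \<in> K"
  unfolding mem_K
proof (intro allI impI)
  fix v :: "real^'n" assume v: "norm v = 1"
  show "(t *\<^sub>R x) \<bullet> v \<le> h v"
  proof (cases "x \<bullet> v \<le> 0")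
    case True
    hence "t * (x \<bullet> v) \<le> 0" using assms(2) by (simp add: mult_nonneg_nonpos)
    thus ?thesis using h_pos[OF v] by simp
  next
    case False
    hence "t * (x \<bullet> v) \<le> s * (x \<bullet> v)" using assms(3) by (intro mult_right_mono) auto
    thus ?thesis using assms(1) v by (fastforce simp: mem_K)
  qed
qed

text \<open>\<open>GREATEST\<close> is meaningful only for an attained maximum; the admissible
  \<open>t\<close> form a compact set containing \<open>r\<close>.\<close>

lemma radial:
  assumes u: "norm u = 1"
  shows "r \<le> \<rho> u" "\<rho> u \<le> R" "0 \<le> t \<Longrightarrow> t *\<^sub>R u \<in> K \<longleftrightarrow> t \<le> \<rho> u"
proof -
  define S where "S = {t. 0 \<le> t \<and> t *\<^sub>R u \<in> K}"
  have rS: "r \<in> S" using r u by (auto simp: S_def intro!: cball_subset_K)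
  have leR: "t \<le> R" if "t \<in> S" for t using K_norm_le[of "t *\<^sub>R u"] that u by (simp add: S_def)
  have "closed ((\<lambda>t. t *\<^sub>R u) -` K)" by (rule closed_vimage[OF closed_K]) (intro continuous_intros)
  hence "closed S" unfolding S_def vimage_def by (intro closed_Collect_conj closed_Collect_le continuous_intros) simp
  moreover have "bounded S" using leR by (intro boundedI[of S R]) (auto simp: S_def)
  ultimately have "compact S" by (simp add: compact_eq_bounded_closed)
  then obtain s where s: "s \<in> S" "\<And>t. t \<in> S \<Longrightarrow> t \<le> s" using compact_attains_sup[of S] rS by blast
  have eq: "\<rho> u = s" unfolding radial_fun_def
    by (rule Greatest_equality) (use s in \<open>auto simp: S_def\<close>)
  show "r \<le> \<rho> u" "\<rho> u \<le> R" using s rS leR eq by auto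
  show "t *\<^sub>R u \<in> K \<longleftrightarrow> t \<le> \<rho> u" if "0 \<le> t"
    using s eq that scale_mem_K[of s u t] by (auto simp: S_def)
qed

lemma radial_pos: "norm u = 1 \<Longrightarrow> 0 < \<rho> u"
  using radial(1)[of u] r by simp

lemma mem_K_radial:
  assumes "x \<noteq> 0" shows "x \<in> K \<longleftrightarrow> norm x \<le> \<rho> (sgn x)"
  using radial(3)[of "sgn x" "norm x"] assms by (simp add: norm_sgn sgn_div_norm)

lemma radial_mem_K: "norm u = 1 \<Longrightarrow> \<rho> u *\<^sub>R u \<in> K"
  using radial(3)[of u "\<rho> u"] radial_pos[of u] by simp

lemma K_borel [measurable]: "K \<in> sets borel"
  using closed_K by auto

text \<open>The value off the unit sphere is arbitrary; \<open>r\<close> keeps it positive and bounded.\<close>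

definition rad :: "real^'n \<Rightarrow> real" where
  "rad u = (if norm u = 1 then \<rho> u else r)"

lemma rad_bounds: "r \<le> rad u" "rad u \<le> R" "0 < rad u"
  using radial[of u] r r_le_R radial_pos[of u] by (auto simp: rad_def)

lemma rad_sgn: "x \<noteq> 0 \<Longrightarrow> rad (sgn x) = \<rho> (sgn x)"
  by (simp add: rad_def norm_sgn)

lemma mem_K_rad: "x \<noteq> 0 \<Longrightarrow> x \<in> K \<longleftrightarrow> norm x \<le> rad (sgn x)"
  by (simp add: mem_K_radial rad_sgn)

lemma rad_measurable [measurable]: "rad \<in> borel_measurable borel"
  unfolding borel_measurable_iff_ge
proof
  fix a :: real
  show "{w \<in> space borel. a \<le> rad w} \<in> sets borel"
  proof (cases "a \<le> 0")
    case True
    hence "{w \<in> space borel. a \<le> rad w} = UNIV" using rad_bounds(3) by (auto intro: order_trans less_imp_le)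
    thus ?thesis by simp
  next
    case False
    hence "{w \<in> space borel. a \<le> rad w} = {w. norm w = 1 \<and> a *\<^sub>R w \<in> K} \<union> {w. norm w \<noteq> 1 \<and> a \<le> r}"
      using radial(3)[of _ a] by (auto simp: rad_def split: if_splits)
    moreover have "{w. norm w = 1 \<and> a *\<^sub>R w \<in> K} \<in> sets borel" by measurable
    moreover have "{w::real^'n. norm w \<noteq> 1 \<and> a \<le> r} \<in> sets borel" by measurable
    ultimately show ?thesis by auto
  qed
qed

lemma section_vol_K:
  assumes "subspace \<xi>" "dim \<xi> \<ge> 1"
  shows "section_vol K \<xi> = unit_ball_vol (real (dim \<xi>)) * (\<integral>x. rad (sgn (proj_mat \<xi> *v x)) ^ dim \<xi> \<partial>unif_ball)"
  by (rule section_vol_eq[OF assms, where R=R]) (auto simp: rad_bounds mem_K_rad)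

section \<open>The gauge function and its subgradients\<close>

definition gauge :: "real^'n \<Rightarrow> real" where
  "gauge x = (SUP v\<in>sphere 0 1. (x \<bullet> v) / h v)"

lemma inner_div_le: "norm v = 1 \<Longrightarrow> (x \<bullet> v) / h v \<le> norm x / r"
proof -
  assume v: "norm v = 1"
  have "(x \<bullet> v) / h v \<le> norm x / h v"
    using norm_cauchy_schwarz[of x v] v h_pos[OF v] by (intro divide_right_mono) auto
  also have "\<dots> \<le> norm x / r" using h_ge[OF v] r by (intro divide_left_mono) auto
  finally show ?thesis .
qed

lemma gauge_upper: "norm v = 1 \<Longrightarrow> (x \<bullet> v) / h v \<le> gauge x"
  unfolding gauge_def by (rule cSUP_upper) (auto intro!: bdd_aboveI2 inner_div_le)

lemma sphere_ne: "sphere (0::real^'n) 1 \<noteq> {}"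
  using norm_axis_1[of undefined] by (metis dist_0_norm emptyE mem_sphere)

lemma gauge_least: "(\<And>v. norm v = 1 \<Longrightarrow> (x \<bullet> v) / h v \<le> a) \<Longrightarrow> gauge x \<le> a"
  unfolding gauge_def by (rule cSUP_least[OF sphere_ne]) auto

lemma gauge_scale_le: "c \<ge> 0 \<Longrightarrow> gauge (c *\<^sub>R x) \<le> c * gauge x"
  by (rule gauge_least) (use mult_left_mono[OF gauge_upper] in fastforce)

lemma gauge_scale:
  assumes "c > 0" shows "gauge (c *\<^sub>R x) = c * gauge x"
proof (rule antisym)
  show "gauge (c *\<^sub>R x) \<le> c * gauge x" using assms by (intro gauge_scale_le) auto
  have "gauge x \<le> inverse c * gauge (c *\<^sub>R x)"
    using gauge_scale_le[of "inverse c" "c *\<^sub>R x"] assms by simp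
  thus "c * gauge x \<le> gauge (c *\<^sub>R x)" using assms by (simp add: field_simps)
qed

lemma gauge_diff_le: "gauge x - gauge y \<le> norm (x - y) / r"
proof -
  have "gauge x \<le> gauge y + norm (x - y) / r"
  proof (rule gauge_least)
    fix v :: "real^'n" assume v: "norm v = 1"
    have "(x \<bullet> v) / h v = (y \<bullet> v) / h v + ((x - y) \<bullet> v) / h v"
      by (simp add: inner_diff_left diff_divide_distrib)
    thus "(x \<bullet> v) / h v \<le> gauge y + norm (x - y) / r"
      using gauge_upper[OF v, of y] inner_div_le[OF v, of "x - y"] by linarith
  qed
  thus ?thesis by simp
qed

text \<open>The gauge is a supremum of linear functions of norm at most
  \<open>1 / r\<close>.\<close>

lemma gauge_lipschitz: "\<bar>gauge x - gauge y\<bar> \<le> norm (x - y) / r"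
  using gauge_diff_le[of x y] gauge_diff_le[of y x] by (simp add: norm_minus_commute)

lemma gauge_continuous: "continuous_on S gauge"
proof -
  have "(1 / r)-lipschitz_on UNIV gauge"
    using r gauge_lipschitz by (intro lipschitz_onI) (auto simp: dist_norm)
  thus ?thesis using lipschitz_on_continuous_on continuous_on_subset by blast
qed

lemma gauge_measurable [measurable]: "gauge \<in> borel_measurable borel"
  by (intro borel_measurable_continuous_onI gauge_continuous)

lemma gauge_le_iff:
  assumes "a > 0" shows "gauge x \<le> a \<longleftrightarrow> x /\<^sub>R a \<in> K"
proof -
  have "gauge x \<le> a \<longleftrightarrow> (\<forall>v. norm v = 1 \<longrightarrow> (x \<bullet> v) / h v \<le> a)"
    using gauge_upper gauge_least by (meson order_trans)
  also have "\<dots> \<longleftrightarrow> (\<forall>v. norm v = 1 \<longrightarrow> (x /\<^sub>R a) \<bullet> v \<le> h v)"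
    using assms h_pos by (intro all_cong1 imp_cong refl) (simp add: field_simps)
  finally show ?thesis by (simp add: mem_K)
qed

lemma gauge_radial:
  assumes u: "norm u = 1" shows "gauge u = 1 / \<rho> u"
proof -
  have "gauge u \<le> a \<longleftrightarrow> 1 / \<rho> u \<le> a" if "a > 0" for a
    using gauge_le_iff[OF that, of u] radial(3)[OF u, of "inverse a"] that radial_pos[OF u]
    by (simp add: field_simps)
  moreover have "gauge u > 0"
  proof -
    have "0 < (u \<bullet> u) / h u" using h_pos[OF u] u by (simp add: dot_square_norm)
    thus ?thesis using gauge_upper[OF u, of u] by linarith
  qed
  moreover have "1 / \<rho> u > 0" using radial_pos[OF u] by simp
  ultimately show ?thesis by (metis order_refl antisym)
qed

lemma gauge_pos: "x \<noteq> 0 \<Longrightarrow> gauge x > 0"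
proof -
  assume x: "x \<noteq> 0"
  have "gauge x = norm x * gauge (sgn x)"
    using gauge_scale[of "norm x" "sgn x"] x by (simp add: sgn_div_norm)
  thus ?thesis using gauge_radial[of "sgn x"] radial_pos[of "sgn x"] x by (simp add: norm_sgn)
qed

lemma outer_normal_inner_ge:
  assumes "v \<in> outer_unit_normals K p" shows "r \<le> p \<bullet> v"
proof -
  have v: "norm v = 1" "\<And>y. y \<in> K \<Longrightarrow> y \<bullet> v \<le> p \<bullet> v" using assms by (auto simp: outer_unit_normals_def)
  have "r *\<^sub>R v \<in> K" using r v(1) by (intro cball_subset_K) auto
  thus ?thesis using v(2)[of "r *\<^sub>R v"] v(1) by (simp add: dot_square_norm)
qed

text \<open>Rescaled so that its value at the boundary point is 1, an outer normal becomes a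
  subgradient of the gauge there. Non-unique normals thus become non-differentiability of a convex
  Lipschitz function.\<close>

lemma outer_normal_subgradient:
  assumes u: "norm u = 1" and v: "v \<in> outer_unit_normals K (\<rho> u *\<^sub>R u)"
  defines "s \<equiv> v /\<^sub>R ((\<rho> u *\<^sub>R u) \<bullet> v)"
  shows "s \<bullet> y \<le> gauge y" "s \<bullet> u = gauge u"
proof -
  let ?p = "\<rho> u *\<^sub>R u"
  have pos: "?p \<bullet> v > 0" using outer_normal_inner_ge[OF v] r by simp
  have le: "y \<bullet> v \<le> ?p \<bullet> v" if "y \<in> K" for y using v that by (auto simp: outer_unit_normals_def)
  show "s \<bullet> u = gauge u"
  proof -
    have "u \<bullet> v \<noteq> 0" using pos by auto
    thus ?thesis using radial_pos[OF u] by (simp add: s_def gauge_radial[OF u] inner_commute field_simps)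
  qed
  show "s \<bullet> y \<le> gauge y"
  proof (cases "y = 0")
    case True
    have "0 \<le> gauge 0" using gauge_upper[of "axis undefined 1" 0] by simp
    thus ?thesis using True by simp
  next
    case False
    have "y /\<^sub>R gauge y \<in> K" using gauge_le_iff[OF gauge_pos[OF False], of y] by simp
    from le[OF this] show ?thesis
      using pos gauge_pos[OF False] by (simp add: s_def inner_commute field_simps)
  qed
qed

section \<open>Second differences and almost everywhere uniqueness\<close>

definition second_diff :: "real^'n \<Rightarrow> real \<Rightarrow> real^'n \<Rightarrow> real" where
  "second_diff b e x = gauge (x + e *\<^sub>R b) + gauge (x - e *\<^sub>R b) - 2 * gauge x"

lemma second_diff_measurable [measurable]: "second_diff b e \<in> borel_measurable borel"
  unfolding second_diff_def[abs_def] by measurable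

lemma gauge_add: "gauge (x + y) \<le> gauge x + gauge y"
proof (rule gauge_least)
  fix v :: "real^'n" assume v: "norm v = 1"
  show "((x + y) \<bullet> v) / h v \<le> gauge x + gauge y"
    using gauge_upper[OF v, of x] gauge_upper[OF v, of y] by (simp add: inner_add_left add_divide_distrib)
qed

lemma second_diff_nonneg: "second_diff b e x \<ge> 0"
proof -
  have "2 * gauge x = gauge ((x + e *\<^sub>R b) + (x - e *\<^sub>R b))"
    using gauge_scale[of 2 x] by (simp add: scaleR_2)
  thus ?thesis using gauge_add[of "x + e *\<^sub>R b" "x - e *\<^sub>R b"] by (simp add: second_diff_def)
qed

text \<open>The two normals yield subgradients that differ in some coordinate \<open>i\<close>.
  Using one for the step forward and the other for the step backward shows a kink along that axis,
  whose second difference is at least linear in \<open>e\<close>.\<close>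

lemma distinct_normals_second_diff:
  assumes y: "y \<noteq> 0" and v: "v \<in> outer_unit_normals K (\<rho> (sgn y) *\<^sub>R sgn y)"
    and w: "w \<in> outer_unit_normals K (\<rho> (sgn y) *\<^sub>R sgn y)" and "v \<noteq> w"
  obtains i d where "d > 0" "\<And>e. e > 0 \<Longrightarrow> second_diff (axis i 1) e y \<ge> d * e"
proof -
  define u where "u = sgn y"
  have u: "norm u = 1" using y by (simp add: u_def norm_sgn)
  let ?p = "\<rho> u *\<^sub>R u"
  define s where "s = (\<lambda>v. v /\<^sub>R (?p \<bullet> v))"
  note vw = v[folded u_def] w[folded u_def]
  have n: "norm v = 1" "norm w = 1" using vw by (auto simp: outer_unit_normals_def)
  have pos: "?p \<bullet> v > 0" "?p \<bullet> w > 0" using outer_normal_inner_ge vw r by fastforce+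
  have yu: "y = norm y *\<^sub>R u" using y by (simp add: u_def sgn_div_norm)
  have sub: "s z \<bullet> x \<le> gauge x" "s z \<bullet> y = gauge y" if "z \<in> outer_unit_normals K ?p" for z x
  proof -
    show "s z \<bullet> x \<le> gauge x" unfolding s_def by (rule outer_normal_subgradient[OF u that])
    have "s z \<bullet> u = gauge u" unfolding s_def by (rule outer_normal_subgradient[OF u that])
    thus "s z \<bullet> y = gauge y" using gauge_scale[of "norm y" u] y
      by (subst (1 2) yu) simp
  qed
  \<comment> \<open>The normals are unit vectors, so equal rescalings would force equal factors, and
    then equal normals.\<close>
  have "s v \<noteq> s w"
  proof
    assume eq: "s v = s w"
    have "norm (s v) = 1 / (?p \<bullet> v)" "norm (s w) = 1 / (?p \<bullet> w)"
    proof -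
      have "norm (z /\<^sub>R c) = 1 / c" if "norm z = 1" "c > 0" for z :: "real^'n" and c
        using that by (simp add: divide_inverse)
      thus "norm (s v) = 1 / (?p \<bullet> v)" "norm (s w) = 1 / (?p \<bullet> w)"
        unfolding s_def using n pos by blast+
    qed
    hence "?p \<bullet> v = ?p \<bullet> w" using eq pos by auto
    hence "v /\<^sub>R (?p \<bullet> w) = w /\<^sub>R (?p \<bullet> w)" using eq unfolding s_def by (simp only:)
    hence "v = w" by (rule scaleR_left_imp_eq[rotated]) (use pos in auto)
    thus False using \<open>v \<noteq> w\<close> by simp
  qed
  then obtain i where i: "s v $ i \<noteq> s w $ i" by (auto simp: vec_eq_iff)
  have ineq: "second_diff (axis i 1) e y \<ge> (s a $ i - s b $ i) * e"
    if "a \<in> outer_unit_normals K ?p" "b \<in> outer_unit_normals K ?p" for a b e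
    using sub(1)[OF that(1), of "y + e *\<^sub>R axis i 1"] sub(1)[OF that(2), of "y - e *\<^sub>R axis i 1"] sub(2)[OF that(1)] sub(2)[OF that(2)]
    by (simp add: second_diff_def inner_add_right inner_diff_right inner_axis algebra_simps)
  show thesis
  proof (cases "s v $ i > s w $ i")
    case True thus thesis using that[of "s v $ i - s w $ i" i] ineq[OF vw] by simp
  next
    case False thus thesis using that[of "s w $ i - s v $ i" i] ineq[OF vw(2) vw(1)] i by simp
  qed
qed

text \<open>Summation by parts moves one difference from the gauge onto the Lipschitz weight, so the
  integral is quadratic in the step although the gauge is merely Lipschitz.\<close>

lemma integral_second_diff:
  fixes b :: "real^'n"
  assumes b: "norm b = 1" and e: "0 < e" "e \<le> 1"
  defines "\<phi> \<equiv> \<lambda>x::real^'n. max 0 (2 - norm x)"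
  shows "integrable lborel (\<lambda>x. second_diff b e x * \<phi> x)"
    "(\<integral>x. second_diff b e x * \<phi> x \<partial>lborel) \<le> e\<^sup>2 / r * measure lborel (cball (0::real^'n) 3)"
proof -
  \<comment> \<open>The second difference is the backward difference of \<open>G\<close>. The weight
    is 1-Lipschitz, at least 1 on the unit ball and zero from radius 2 on; with steps of length at
    most 1, all supports lie in the ball of radius 3.\<close>
  define G where "G = (\<lambda>x. gauge (x + e *\<^sub>R b) - gauge x)"
  have [measurable]: "G \<in> borel_measurable borel" "\<phi> \<in> borel_measurable borel" unfolding G_def \<phi>_def by measurable
  have G: "\<bar>G x\<bar> \<le> e / r" for x
    using gauge_lipschitz[of "x + e *\<^sub>R b" x] e b by (simp add: G_def)
  have \<phi>l: "\<bar>\<phi> x - \<phi> y\<bar> \<le> norm (x - y)" for x y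
    using norm_triangle_ineq3[of x y] unfolding \<phi>_def by (auto simp: max_def abs_if split: if_splits)
  have \<phi>0: "0 \<le> \<phi> x" "\<phi> x \<le> 2" for x by (auto simp: \<phi>_def)
  have ind: "integrable lborel (\<lambda>x. c * indicat_real (cball (0::real^'n) 3) x)" for c
    by (intro integrable_mult_right integrable_real_indicator emeasure_lborel_cball_finite) auto
  have int: "integrable lborel f"
    if [measurable]: "f \<in> borel_measurable borel" and f: "\<And>x. \<bar>f x\<bar> \<le> c * indicat_real (cball (0::real^'n) 3) x" for f :: "real^'n \<Rightarrow> real" and c
    by (rule Bochner_Integration.integrable_bound[OF ind[of c]]) (simp, rule AE_I2, use order_trans[OF f abs_ge_self] in simp)
  have supp: "\<phi> x = 0" if "norm x \<ge> 2" for x using that by (simp add: \<phi>_def)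
  have far: "norm (x + e *\<^sub>R b) \<ge> 2" "norm (x - e *\<^sub>R b) \<ge> 2" if "x \<notin> cball 0 3" for x
  proof -
    have "norm (e *\<^sub>R b) \<le> 1" using e b by simp
    thus "norm (x + e *\<^sub>R b) \<ge> 2" "norm (x - e *\<^sub>R b) \<ge> 2"
      using that norm_triangle_ineq2[of x "- (e *\<^sub>R b)"] norm_triangle_ineq2[of x "e *\<^sub>R b"] by auto
  qed
  have I1: "integrable lborel (\<lambda>x. G x * \<phi> x)"
  proof (rule int[where c="e / r * 2"])
    show "\<bar>G x * \<phi> x\<bar> \<le> e / r * 2 * indicat_real (cball 0 3) x" for x
    proof (cases "x \<in> cball 0 3")
      case True
      have "\<bar>G x\<bar> * \<bar>\<phi> x\<bar> \<le> e / r * 2" using G \<phi>0 e r by (intro mult_mono) auto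
      thus ?thesis using True by (simp add: abs_mult)
    next
      case False
      thus ?thesis using supp[of x] by auto
    qed
  qed measurable
  have I2: "integrable lborel (\<lambda>x. G x * \<phi> (x + e *\<^sub>R b))"
  proof (rule int[where c="e / r * 2"])
    show "\<bar>G x * \<phi> (x + e *\<^sub>R b)\<bar> \<le> e / r * 2 * indicat_real (cball 0 3) x" for x
    proof (cases "x \<in> cball 0 3")
      case True
      have "\<bar>G x\<bar> * \<bar>\<phi> (x + e *\<^sub>R b)\<bar> \<le> e / r * 2" using G \<phi>0 e r by (intro mult_mono) auto
      thus ?thesis using True by (simp add: abs_mult)
    next
      case False
      thus ?thesis using supp far by auto
    qed
  qed measurable
  have shift: "(\<integral>x. f x \<partial>lborel) = (\<integral>x. f (a + x) \<partial>lborel)" if "f \<in> borel_measurable borel" for f :: "real^'n \<Rightarrow> real" and a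
    using integral_distr[of "(+) a" "lborel :: (real^'n) measure" borel f] that by (simp add: lborel_distr_plus)
  have shiftI: "integrable lborel f \<Longrightarrow> integrable lborel (\<lambda>x. f (a + x))" if "f \<in> borel_measurable borel" for f :: "real^'n \<Rightarrow> real" and a
    using integrable_distr_eq[of "(+) a" "lborel :: (real^'n) measure" borel f] that by (simp add: lborel_distr_plus)
  have I3: "integrable lborel (\<lambda>x. G (x - e *\<^sub>R b) * \<phi> x)"
    using shiftI[OF _ I2, of "- (e *\<^sub>R b)"] by simp
  have I3': "(\<integral>x. G (x - e *\<^sub>R b) * \<phi> x \<partial>lborel) = (\<integral>x. G x * \<phi> (x + e *\<^sub>R b) \<partial>lborel)"
    using shift[of "\<lambda>x. G x * \<phi> (x + e *\<^sub>R b)" "- (e *\<^sub>R b)"] by simp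
  have sd: "second_diff b e x * \<phi> x = G x * \<phi> x - G (x - e *\<^sub>R b) * \<phi> x" for x
    by (simp add: second_diff_def G_def algebra_simps)
  show "integrable lborel (\<lambda>x. second_diff b e x * \<phi> x)" unfolding sd by (intro Bochner_Integration.integrable_diff I1 I3)
  have "(\<integral>x. second_diff b e x * \<phi> x \<partial>lborel) = (\<integral>x. G x * \<phi> x - G x * \<phi> (x + e *\<^sub>R b) \<partial>lborel)"
    unfolding sd by (simp add: I1 I2 I3 I3')
  also have "\<dots> \<le> (\<integral>x. e\<^sup>2 / r * indicat_real (cball (0::real^'n) 3) x \<partial>lborel)"
  proof (rule Bochner_Integration.integral_mono)
    show "integrable lborel (\<lambda>x. G x * \<phi> x - G x * \<phi> (x + e *\<^sub>R b))" by (intro Bochner_Integration.integrable_diff I1 I2)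
    show "integrable lborel (\<lambda>x::real^'n. e\<^sup>2 / r * indicat_real (cball 0 3) x)" by (rule ind)
    show "G x * \<phi> x - G x * \<phi> (x + e *\<^sub>R b) \<le> e\<^sup>2 / r * indicat_real (cball 0 3) x" for x
    proof (cases "x \<in> cball 0 3")
      case True
      have "G x * \<phi> x - G x * \<phi> (x + e *\<^sub>R b) \<le> \<bar>G x\<bar> * \<bar>\<phi> x - \<phi> (x + e *\<^sub>R b)\<bar>"
        by (metis abs_ge_self abs_mult right_diff_distrib)
      also have "\<dots> \<le> (e / r) * e"
        using G \<phi>l[of x "x + e *\<^sub>R b"] b e r by (intro mult_mono) auto
      finally show ?thesis using True by (simp add: power2_eq_square)
    next
      case False
      thus ?thesis using supp far[OF False] by auto
    qed
  qed
  also have "\<dots> = e\<^sup>2 / r * measure lborel (cball (0::real^'n) 3)"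
    by simp
  finally show "(\<integral>x. second_diff b e x * \<phi> x \<partial>lborel) \<le> e\<^sup>2 / r * measure lborel (cball (0::real^'n) 3)" .
qed

text \<open>Markov's inequality: the set carries second differences of size at least
  \<open>d * e\<close> while their weighted integral is of order \<open>e\<close> squared, so its
  measure is of order \<open>e\<close> for every \<open>e = 1 / (k + 1)\<close>. Restricting to
  these steps keeps the set Borel.\<close>

lemma second_diff_null:
  fixes b :: "real^'n"
  assumes b: "norm b = 1" and d: "d > 0"
  shows "{x. norm x \<le> 1 \<and> (\<forall>k::nat. second_diff b (1 / real (Suc k)) x \<ge> d * (1 / real (Suc k)))} \<in> null_sets lborel"
    (is "?E \<in> _")
proof -
  define C where "C = measure lborel (cball (0::real^'n) 3) / r"
  have E: "?E \<in> sets lborel" by measurable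
  have finE: "emeasure lborel ?E < \<infinity>"
    by (rule le_less_trans[OF emeasure_mono emeasure_lborel_cball_finite[of 0 1]]) auto
  have bound: "measure lborel ?E \<le> C / d * (1 / real (Suc k))" for k
  proof -
    let ?e = "1 / real (Suc k)"
    have e: "0 < ?e" "?e \<le> 1" by auto
    note I = integral_second_diff[OF b e]
    have "d * ?e * measure lborel ?E = (\<integral>x. d * ?e * indicat_real ?E x \<partial>lborel)"
      by simp
    also have "\<dots> \<le> (\<integral>x. second_diff b ?e x * max 0 (2 - norm x) \<partial>lborel)"
    proof (rule Bochner_Integration.integral_mono[OF _ I(1)])
      show "integrable lborel (\<lambda>x. d * ?e * indicat_real ?E x)"
        by (intro integrable_mult_right integrable_real_indicator finE E)
      show "d * ?e * indicat_real ?E x \<le> second_diff b ?e x * max 0 (2 - norm x)" for x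
      proof (cases "x \<in> ?E")
        case True
        hence x: "norm x \<le> 1" "d * ?e \<le> second_diff b ?e x" by blast+
        have "d * ?e * 1 \<le> second_diff b ?e x * max 0 (2 - norm x)"
          using x d e by (intro mult_mono second_diff_nonneg) auto
        thus ?thesis using True by simp
      next
        case False
        thus ?thesis using second_diff_nonneg[of b ?e x] by simp
      qed
    qed
    also have "\<dots> \<le> C * ?e\<^sup>2" using I(2) by (simp add: C_def mult.commute)
    finally have "d * ?e * measure lborel ?E \<le> C * ?e * ?e" by (simp add: power2_eq_square)
    hence "(d * measure lborel ?E) * ?e \<le> (C * ?e) * ?e" by (simp only: mult_ac)
    hence le: "d * measure lborel ?E \<le> C * ?e" using e(1) by (rule mult_right_le_imp_le)
    have "measure lborel ?E \<le> C * ?e / d"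
      using le d by (subst pos_le_divide_eq) (simp_all only: mult.commute)
    thus ?thesis by (simp only: times_divide_eq_left)
  qed
  have "(\<lambda>k. C / d * (1 / real (Suc k))) \<longlonglongrightarrow> C / d * 0"
    by (intro tendsto_mult tendsto_const LIMSEQ_Suc[OF lim_1_over_n])
  hence "measure lborel ?E \<le> C / d * 0"
    by (rule LIMSEQ_le_const) (use bound in auto)
  hence "emeasure lborel ?E = 0"
    using finE by (simp add: emeasure_eq_ennreal_measure measure_le_0_iff)
  thus ?thesis using E by (intro null_setsI)
qed

text \<open>Two normals give a kink along some axis with slope above some
  \<open>1 / (n + 1)\<close>; only countably many null sets are involved.\<close>

lemma AE_unique_outer_normal:
  "AE y in unif_ball. \<forall>v w. v \<in> outer_unit_normals K (\<rho> (sgn y) *\<^sub>R sgn y)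
     \<longrightarrow> w \<in> outer_unit_normals K (\<rho> (sgn y) *\<^sub>R sgn y) \<longrightarrow> v = w"
proof -
  have "AE y in lborel. \<forall>i::'n. \<forall>n::nat. y \<notin> {x. norm x \<le> 1 \<and> (\<forall>k::nat. second_diff (axis i 1) (1 / real (Suc k)) x
      \<ge> 1 / real (Suc n) * (1 / real (Suc k)))}"
    unfolding AE_all_countable by (intro allI AE_not_in second_diff_null) auto
  hence "AE y in unif_ball. \<forall>i::'n. \<forall>n::nat. y \<notin> {x. norm x \<le> 1 \<and> (\<forall>k::nat. second_diff (axis i 1) (1 / real (Suc k)) x
      \<ge> 1 / real (Suc n) * (1 / real (Suc k)))}"
    by (rule AE_unif_ballI)
  with AE_unif_ball_norm AE_unif_ball_nonzero show ?thesis
  proof eventually_elim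
    case (elim y)
    show ?case
    proof (intro allI impI, rule ccontr)
      fix v w assume vw: "v \<in> outer_unit_normals K (\<rho> (sgn y) *\<^sub>R sgn y)"
        "w \<in> outer_unit_normals K (\<rho> (sgn y) *\<^sub>R sgn y)" "v \<noteq> w"
      obtain i d where id: "d > 0" "\<And>e. e > 0 \<Longrightarrow> second_diff (axis i 1) e y \<ge> d * e"
        using distinct_normals_second_diff[OF elim(2) vw] by blast
      obtain n where n: "1 / real (Suc n) < d" using id(1) nat_approx_posE by blast
      have "second_diff (axis i 1) (1 / real (Suc k)) y \<ge> 1 / real (Suc n) * (1 / real (Suc k))" for k
        using id(2)[of "1 / real (Suc k)"] n mult_right_mono[of "1 / real (Suc n)" d "1 / real (Suc k)"] by force
      thus False using elim(1,3) by fastforce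
    qed
  qed
qed

end

subsection \<open>Derivative of the radial function\<close>

text \<open>An envelope theorem: away from the contact point \<open>v0\<close> there is a gap of fixed size between \<open>a0 k\<close>
  and \<open>g\<close>, so that only \<open>v0\<close> enters the derivative.\<close>

lemma tendsto_contact_multiplier:
  fixes g f k :: "'a::topological_space \<Rightarrow> real" and q :: "real \<Rightarrow> 'a \<Rightarrow> real" and A :: "real \<Rightarrow> real"
  assumes S: "compact S" and cont: "continuous_on S g" "continuous_on S f" "continuous_on S k"
    and k0: "\<And>v. v \<in> S \<Longrightarrow> 0 \<le> k v" and a0: "0 < a0"
    and le: "\<And>v. v \<in> S \<Longrightarrow> a0 * k v \<le> g v"
    and v0: "v0 \<in> S" "a0 * k v0 = g v0" "0 < k v0"
    and uniq: "\<And>v. v \<in> S \<Longrightarrow> a0 * k v = g v \<Longrightarrow> v = v0"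
    and q: "\<And>e. e > 0 \<Longrightarrow> eventually (\<lambda>t. \<forall>v\<in>S. \<bar>q t v - g v - t * f v\<bar> \<le> e * \<bar>t\<bar>) (at 0)"
    and A: "eventually (\<lambda>t. \<forall>a\<ge>0. a \<le> A t \<longleftrightarrow> (\<forall>v\<in>S. a * k v \<le> q t v)) (at 0)"
    and A0: "eventually (\<lambda>t. 0 \<le> A t) (at 0)"
  shows "((\<lambda>t. (A t - a0) / t) \<longlongrightarrow> f v0 / k v0) (at 0)"
proof -
  define D where "D = f v0 / k v0"
  have fD: "f v0 = D * k v0" using v0(3) by (simp add: D_def)
  have small: "eventually (\<lambda>t. \<bar>t\<bar> \<le> c) (at 0)" if "c > 0" for c :: real
    using that by (auto simp: eventually_at dist_real_def intro!: exI[of _ c])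
  have main: "eventually (\<lambda>t. \<bar>A t - a0 - t * D\<bar> \<le> e * \<bar>t\<bar>) (at 0)" if e: "e > 0" for e
  proof -
    \<comment> \<open>Small enough that two errors \<open>e' * |t|\<close> fit into
      \<open>e * |t| * k v\<close> wherever \<open>k v > k v0 / 2\<close>.\<close>
    define e' where "e' = e * k v0 / 8"
    have e': "e' > 0" using e v0(3) by (simp add: e'_def)
    \<comment> \<open>Points where the first-order comparison with \<open>v0\<close> fails, either
      because \<open>k\<close> is small or because \<open>f - D * k\<close>, which vanishes at
      \<open>v0\<close>, is not small. The set is compact and omits \<open>v0\<close>, hence the gap
      \<open>\<eta>\<close>.\<close>
    define N where "N = {v \<in> S. k v \<le> k v0 / 2} \<union> {v \<in> S. e' \<le> \<bar>f v - D * k v\<bar>}"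
    have "continuous_on S (\<lambda>v. \<bar>f v - D * k v\<bar>)" by (intro continuous_intros cont)
    have "closedin (top_of_set S) {v \<in> S. k v \<le> k v0 / 2}" "closedin (top_of_set S) {v \<in> S. e' \<le> \<bar>f v - D * k v\<bar>}"
    proof -
      have "{v \<in> S. k v \<le> k v0 / 2} = S \<inter> k -` {..k v0 / 2}"
        "{v \<in> S. e' \<le> \<bar>f v - D * k v\<bar>} = S \<inter> (\<lambda>v. \<bar>f v - D * k v\<bar>) -` {e'..}" by auto
      thus "closedin (top_of_set S) {v \<in> S. k v \<le> k v0 / 2}" "closedin (top_of_set S) {v \<in> S. e' \<le> \<bar>f v - D * k v\<bar>}"
        using continuous_closedin_preimage[OF \<open>continuous_on S (\<lambda>v. \<bar>f v - D * k v\<bar>)\<close> closed_atLeast[of e']]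
          continuous_closedin_preimage[OF cont(3) closed_atMost[of "k v0 / 2"]] by (simp_all only:)
    qed
    hence N: "compact N" unfolding N_def by (intro compact_Un closedin_compact[OF S])
    have NS: "N \<subseteq> S" by (auto simp: N_def)
    have v0N: "v0 \<notin> N" using v0(3) e' by (auto simp: N_def fD)
    obtain \<eta> where \<eta>: "\<eta> > 0" "\<And>v. v \<in> N \<Longrightarrow> \<eta> \<le> g v - a0 * k v"
    proof (cases "N = {}")
      case True thus thesis using that[of 1] by auto
    next
      case False
      have "continuous_on N (\<lambda>v. g v - a0 * k v)"
        using cont NS by (intro continuous_intros) (auto intro: continuous_on_subset)
      then obtain w where w: "w \<in> N" "\<And>v. v \<in> N \<Longrightarrow> g w - a0 * k w \<le> g v - a0 * k v"
        using continuous_attains_inf[OF N False] by blast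
      have "g w - a0 * k w \<noteq> 0" using uniq[of w] w(1) NS v0N by auto
      hence "g w - a0 * k w > 0" using le[of w] w(1) NS by force
      thus thesis using that w(2) by blast
    qed
    obtain F where F: "\<And>v. v \<in> S \<Longrightarrow> \<bar>f v\<bar> \<le> F"
      using compact_imp_bounded[OF compact_continuous_image[OF cont(2) S]] by (auto simp: bounded_iff)
    obtain M where M: "\<And>v. v \<in> S \<Longrightarrow> \<bar>k v\<bar> \<le> M"
      using compact_imp_bounded[OF compact_continuous_image[OF cont(3) S]] by (auto simp: bounded_iff)
    have FM: "0 \<le> F" "0 \<le> M" using F[OF v0(1)] M[OF v0(1)] by auto
    \<comment> \<open>For \<open>|t| \<le> \<eta> / G\<close> all perturbations on \<open>N\<close>
      stay within the gap; the summand 1 keeps \<open>G\<close> positive. The other bound on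
      \<open>t\<close> keeps the trial value \<open>a\<close> nonnegative, as the characterisation
      of \<open>A t\<close> demands.\<close>
    define G where "G = F + e' + \<bar>D\<bar> * M + 1"
    have G: "G > 0" using FM e' by (simp add: G_def add_nonneg_pos)
    have "\<eta> / G > 0" "a0 / (\<bar>D\<bar> + e) > 0" using \<eta>(1) G a0 e by (auto intro!: divide_pos_pos add_nonneg_pos)
    with q[OF e'] A A0 small[of "\<eta> / G"] small[of "a0 / (\<bar>D\<bar> + e)"]
    have "eventually (\<lambda>t. \<forall>v\<in>S. \<bar>q t v - g v - t * f v\<bar> \<le> e' * \<bar>t\<bar>) (at 0)"
      "eventually (\<lambda>t. \<forall>a\<ge>0. a \<le> A t \<longleftrightarrow> (\<forall>v\<in>S. a * k v \<le> q t v)) (at 0)" "eventually (\<lambda>t. 0 \<le> A t) (at 0)"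
      "eventually (\<lambda>t. \<bar>t\<bar> \<le> \<eta> / G) (at 0)" "eventually (\<lambda>t. \<bar>t\<bar> \<le> a0 / (\<bar>D\<bar> + e)) (at 0)" by blast+
    thus ?thesis
    proof (eventually_elim)
      case (elim t)
      note t = elim(4,5)
      have qd: "g v + t * f v - e' * \<bar>t\<bar> \<le> q t v" "q t v \<le> g v + t * f v + e' * \<bar>t\<bar>" if "v \<in> S" for v
        using elim(1) that by (fastforce simp: abs_le_iff)+
      have upper: "A t \<le> a0 + t * D + e * \<bar>t\<bar>"
      proof -
        have "A t * k v0 \<le> q t v0" using elim(2,3) v0(1) by blast
        also have "\<dots> \<le> a0 * k v0 + t * (D * k v0) + e' * \<bar>t\<bar>" using qd(2)[OF v0(1)] v0(2) fD by simp
        also have "\<dots> \<le> a0 * k v0 + t * (D * k v0) + e * k v0 * \<bar>t\<bar>"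
          using e v0(3) by (intro add_left_mono mult_right_mono) (auto simp: e'_def)
        also have "\<dots> = (a0 + t * D + e * \<bar>t\<bar>) * k v0" by (simp add: algebra_simps)
        finally show ?thesis using v0(3) by simp
      qed
      \<comment> \<open>The upper bound only tested the constraint at \<open>v0\<close>. For the
        lower bound this trial value is shown to satisfy every constraint: on \<open>N\<close>
        through the gap, elsewhere because the decrement \<open>e * |t| * k v\<close> outweighs the
        errors.\<close>
      define a where "a = a0 + t * D - e * \<bar>t\<bar>"
      have a_nonneg: "a \<ge> 0"
      proof -
        have "\<bar>t\<bar> * (\<bar>D\<bar> + e) \<le> a0" using t(2) e by (simp add: field_simps add_nonneg_pos pos_le_divide_eq)
        moreover have "- (t * D) \<le> \<bar>t\<bar> * \<bar>D\<bar>" by (metis abs_ge_minus_self abs_mult)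
        ultimately show ?thesis by (simp add: a_def algebra_simps)
      qed
      have "a * k v \<le> q t v" if v: "v \<in> S" for v
      proof (cases "v \<in> N")
        case True
        have "t * D * k v \<le> \<bar>t\<bar> * (\<bar>D\<bar> * M)"
        proof -
          have "t * D * k v \<le> \<bar>t\<bar> * \<bar>D\<bar> * \<bar>k v\<bar>" by (metis abs_ge_self abs_mult)
          also have "\<dots> \<le> \<bar>t\<bar> * \<bar>D\<bar> * M" using M[OF v] by (intro mult_left_mono) auto
          finally show ?thesis by (simp add: mult.assoc)
        qed
        moreover have "- (t * f v) \<le> \<bar>t\<bar> * F"
        proof -
          have "- (t * f v) \<le> \<bar>t\<bar> * \<bar>f v\<bar>" by (metis abs_ge_minus_self abs_mult)
          also have "\<dots> \<le> \<bar>t\<bar> * F" using F[OF v] by (intro mult_left_mono) auto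
          finally show ?thesis .
        qed
        moreover have "e * \<bar>t\<bar> * k v \<ge> 0" using e k0[OF v] by simp
        moreover have "\<bar>t\<bar> * F + e' * \<bar>t\<bar> + \<bar>t\<bar> * (\<bar>D\<bar> * M) \<le> \<eta>"
        proof -
          have "\<bar>t\<bar> * F + e' * \<bar>t\<bar> + \<bar>t\<bar> * (\<bar>D\<bar> * M) = \<bar>t\<bar> * (G - 1)" by (simp add: G_def algebra_simps)
          also have "\<dots> \<le> \<bar>t\<bar> * G" by (intro mult_left_mono) auto
          also have "\<dots> \<le> \<eta>" using t(1) G by (simp add: pos_le_divide_eq)
          finally show ?thesis .
        qed
        ultimately show ?thesis
          using qd(1)[OF v] \<eta>(2)[OF True] by (simp add: a_def algebra_simps)
      next
        case False
        hence kv: "k v > k v0 / 2" and fv: "\<bar>f v - D * k v\<bar> < e'" using v by (auto simp: N_def)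
        have "t * f v - t * (D * k v) \<ge> - (e' * \<bar>t\<bar>)"
        proof -
          have "- (t * (f v - D * k v)) \<le> \<bar>t\<bar> * \<bar>f v - D * k v\<bar>" by (metis abs_ge_minus_self abs_mult)
          also have "\<dots> \<le> \<bar>t\<bar> * e'" using fv by (intro mult_left_mono) auto
          finally show ?thesis by (simp add: algebra_simps)
        qed
        moreover have "2 * (e' * \<bar>t\<bar>) \<le> e * \<bar>t\<bar> * k v"
        proof -
          have "2 * e' \<le> e * k v" using mult_left_mono[of "k v0 / 4" "k v" e] kv e v0(3) by (simp add: e'_def)
          from mult_right_mono[OF this abs_ge_zero[of t]] show ?thesis by (simp add: mult_ac)
        qed
        ultimately show ?thesis
          using qd(1)[OF v] le[OF v] by (simp add: a_def algebra_simps)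
      qed
      hence "a \<le> A t" using elim(2) a_nonneg by blast
      thus ?case using upper by (auto simp: a_def abs_le_iff)
    qed
  qed
  show ?thesis
    unfolding tendsto_iff D_def[symmetric]
  proof (intro allI impI)
    fix e :: real assume "e > 0"
    hence "e / 2 > 0" by simp
    have "eventually (\<lambda>t. t \<noteq> 0) (at (0::real))" by (simp add: eventually_at_filter)
    with main[OF \<open>e / 2 > 0\<close>]
    show "eventually (\<lambda>t. dist ((A t - a0) / t) D < e) (at 0)"
    proof eventually_elim
      case (elim t)
      have "\<bar>(A t - a0) / t - D\<bar> = \<bar>A t - a0 - t * D\<bar> / \<bar>t\<bar>"
        using elim(2) by (simp add: field_simps flip: abs_divide)
      also have "\<dots> \<le> e / 2" using elim by (simp add: pos_divide_le_eq)
      also have "\<dots> < e" using \<open>e > 0\<close> by simp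
      finally show ?case by (simp add: dist_real_def)
    qed
  qed
qed

text \<open>The interval stays away from 0, where \<open>powr\<close> is not smooth, and is the
  range of ratios permitted by \<open>c * \<tau> \<le> 1 / 2\<close>.\<close>

lemma powr_lipschitz_at_1:
  fixes s :: real
  obtains C where "C \<ge> 0" "\<And>x. x \<in> {1/2..3/2} \<Longrightarrow> \<bar>x powr s - 1\<bar> \<le> C * \<bar>x - 1\<bar>"
proof -
  have "continuous_on {1/2..3/2::real} (\<lambda>x. s * x powr (s - 1))"
    by (intro continuous_intros) auto
  then obtain C where C: "\<And>x. x \<in> {1/2..3/2} \<Longrightarrow> \<bar>s * x powr (s - 1)\<bar> \<le> C"
    using compact_imp_bounded[OF compact_continuous_image[OF _ compact_Icc]]
    by (metis (no_types, lifting) bounded_iff imageI real_norm_def)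
  have "\<bar>x powr s - 1\<bar> \<le> C * \<bar>x - 1\<bar>" if x: "x \<in> {1/2..3/2}" for x
  proof -
    have "norm (x powr s - 1 powr s) \<le> C * norm (x - 1)"
    proof (rule field_differentiable_bound[where S="{1/2..3/2}" and f="\<lambda>x. x powr s" and f'="\<lambda>x. s * x powr (s - 1)"])
      fix z :: real assume z: "z \<in> {1/2..3/2}"
      show "((\<lambda>x. x powr s) has_field_derivative s * z powr (s - 1)) (at z within {1/2..3/2})"
        by (rule has_field_derivative_at_within, rule has_real_derivative_powr) (use z in auto)
      show "norm (s * z powr (s - 1)) \<le> C" using C[OF z] by simp
    qed (use x in auto)
    thus ?thesis by simp
  qed
  moreover have "C \<ge> 0" using C[of 1] by simp
  ultimately show thesis using that by blast
qed

section \<open>Contact points and outer normals\<close>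

context wulff begin

text \<open>In p-th powers the constraint is linear both in \<open>a\<close> and in the quantity
  that varies affinely with t. Directions with \<open>u \<bullet> v \<le> 0\<close> impose nothing,
  which \<open>max 0\<close> together with \<open>0 powr p = 0\<close> expresses.\<close>

lemma radial_powr_le_iff:
  assumes u: "norm u = 1" and p: "p > 0" and a: "a \<ge> 0"
  shows "a \<le> \<rho> u powr p \<longleftrightarrow> (\<forall>v\<in>sphere 0 1. a * max 0 (u \<bullet> v) powr p \<le> h v powr p)"
proof -
  define s where "s = a powr (1 / p)"
  have s: "s \<ge> 0" "s powr p = a" using a p by (auto simp: s_def powr_powr)
  have mono: "x \<le> y \<longleftrightarrow> x powr p \<le> y powr p" if "x \<ge> 0" "y \<ge> 0" for x y :: real
    using that p powr_mono2[of p x y] powr_less_mono2[of p y x] by fastforce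
  have "a \<le> \<rho> u powr p \<longleftrightarrow> s \<le> \<rho> u" using mono[of s "\<rho> u"] s radial_pos[OF u] by simp
  also have "\<dots> \<longleftrightarrow> s *\<^sub>R u \<in> K" using radial(3)[OF u s(1)] by simp
  also have "\<dots> \<longleftrightarrow> (\<forall>v. norm v = 1 \<longrightarrow> s * (u \<bullet> v) \<le> h v)" by (simp add: mem_K)
  also have "\<dots> \<longleftrightarrow> (\<forall>v. norm v = 1 \<longrightarrow> a * max 0 (u \<bullet> v) powr p \<le> h v powr p)"
  proof (intro all_cong1 imp_cong refl)
    fix v :: "real^'n" assume v: "norm v = 1"
    show "s * (u \<bullet> v) \<le> h v \<longleftrightarrow> a * max 0 (u \<bullet> v) powr p \<le> h v powr p"
    proof (cases "u \<bullet> v \<le> 0")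
      case True
      have "s * (u \<bullet> v) \<le> 0" using True s(1) by (simp add: mult_nonneg_nonpos)
      thus ?thesis using True h_pos[OF v] by (simp add: max_def)
    next
      case False
      have "s * (u \<bullet> v) \<le> h v \<longleftrightarrow> (s * (u \<bullet> v)) powr p \<le> h v powr p"
        using mono[of "s * (u \<bullet> v)" "h v"] False s(1) h_pos[OF v] by simp
      thus ?thesis using False s by (simp add: powr_mult)
    qed
  qed
  finally show ?thesis by auto
qed

text \<open>If no constraint were active, compactness would give a uniform slack
  \<open>\<eta>\<close>, and lengthening the radius by \<open>\<eta>\<close> would stay inside
  \<open>K\<close>.\<close>

lemma contact_exists:
  assumes cont: "continuous_on (sphere 0 1) h" and u: "norm u = 1"
  obtains v where "norm v = 1" "\<rho> u * (u \<bullet> v) = h v"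
proof (rule ccontr)
  assume "\<not> thesis"
  hence ne: "\<And>v. norm v = 1 \<Longrightarrow> \<rho> u * (u \<bullet> v) \<noteq> h v" using that by blast
  have le: "\<rho> u * (u \<bullet> v) \<le> h v" if "norm v = 1" for v
    using radial_mem_K[OF u] that by (auto simp: mem_K)
  have "continuous_on (sphere 0 1) (\<lambda>v. h v - \<rho> u * (u \<bullet> v))" by (intro continuous_intros cont)
  then obtain w where w: "w \<in> sphere 0 1" "\<And>v. v \<in> sphere 0 1 \<Longrightarrow> h w - \<rho> u * (u \<bullet> w) \<le> h v - \<rho> u * (u \<bullet> v)"
    using continuous_attains_inf[OF compact_sphere sphere_ne] by blast
  define \<eta> where "\<eta> = h w - \<rho> u * (u \<bullet> w)"
  have \<eta>: "\<eta> > 0" using le[of w] ne[of w] w(1) by (simp add: \<eta>_def)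
  have "(\<rho> u + \<eta>) *\<^sub>R u \<in> K" unfolding mem_K
  proof (intro allI impI)
    fix v :: "real^'n" assume v: "norm v = 1"
    have "\<eta> * (u \<bullet> v) \<le> \<eta> * 1" using \<eta> norm_cauchy_schwarz[of u v] u v by (intro mult_left_mono) auto
    moreover have "\<eta> \<le> h v - \<rho> u * (u \<bullet> v)" using w(2)[of v] v by (simp add: \<eta>_def)
    ultimately show "((\<rho> u + \<eta>) *\<^sub>R u) \<bullet> v \<le> h v" by (simp add: algebra_simps)
  qed
  thus False using radial(3)[OF u, of "\<rho> u + \<eta>"] radial_pos[OF u] \<eta> by simp
qed

lemma contact_outer_normal:
  assumes "norm v = 1" "\<rho> u * (u \<bullet> v) = h v"
  shows "v \<in> outer_unit_normals K (\<rho> u *\<^sub>R u)"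
  using assms by (auto simp: outer_unit_normals_def mem_K)

abbreviation "unique_normal u \<equiv> (\<forall>v w. v \<in> outer_unit_normals K (\<rho> u *\<^sub>R u) \<longrightarrow> w \<in> outer_unit_normals K (\<rho> u *\<^sub>R u) \<longrightarrow> v = w)"

text \<open>Contact points are outer normals, so uniqueness of the normal yields the unique contact
  point that the envelope argument asks for.\<close>

lemma unique_contact:
  assumes cont: "continuous_on (sphere 0 1) h" and u: "norm u = 1" and uniq: "unique_normal u"
  defines "\<nu> \<equiv> outer_unit_normal K (\<rho> u *\<^sub>R u)"
  shows "norm \<nu> = 1" "\<rho> u * (u \<bullet> \<nu>) = h \<nu>" "0 < u \<bullet> \<nu>"
    "\<And>v. v \<in> outer_unit_normals K (\<rho> u *\<^sub>R u) \<longleftrightarrow> v = \<nu>"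
    "\<And>v. norm v = 1 \<Longrightarrow> \<rho> u * (u \<bullet> v) = h v \<Longrightarrow> v = \<nu>"
proof -
  obtain v where v: "norm v = 1" "\<rho> u * (u \<bullet> v) = h v" using contact_exists[OF cont u] .
  have vn: "v \<in> outer_unit_normals K (\<rho> u *\<^sub>R u)" by (rule contact_outer_normal[OF v])
  have eq: "\<nu> = v" unfolding \<nu>_def outer_unit_normal_def
    by (rule the_equality) (use vn uniq in auto)
  show "norm \<nu> = 1" "\<rho> u * (u \<bullet> \<nu>) = h \<nu>" using v eq by auto
  thus "0 < u \<bullet> \<nu>" using h_pos[of \<nu>] radial_pos[OF u] by (metis zero_less_mult_pos)
  show "w \<in> outer_unit_normals K (\<rho> u *\<^sub>R u) \<longleftrightarrow> w = \<nu>" for w using vn uniq eq by auto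
  show "w = \<nu>" if "norm w = 1" "\<rho> u * (u \<bullet> w) = h w" for w
    using contact_outer_normal[OF that] vn uniq eq by auto
qed

end

context wulff begin

definition contact :: "real^'n \<Rightarrow> real^'n \<Rightarrow> bool" where
  "contact u v \<longleftrightarrow> norm v = 1 \<and> \<rho> u * (u \<bullet> v) = h v"

lemma contact_inner_pos:
  "norm u = 1 \<Longrightarrow> contact u v \<Longrightarrow> 0 < u \<bullet> v"
  using h_pos[of v] radial_pos[of u] unfolding contact_def by (metis zero_less_mult_pos)

end

text \<open>What the variation provides on one fixed interval: common bounds, a relative Lipschitz
  estimate in t for domination (\<open>rel\<close>), and the expansion that determines the limit
  (\<open>lim\<close>).\<close>

locale wulff_variation =
  fixes h :: "real \<Rightarrow> real^'n \<Rightarrow> real" and f :: "real^'n \<Rightarrow> real" and p \<tau> c r R :: real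
  assumes p: "0 < p" and \<tau>: "0 < \<tau>" and c: "0 \<le> c" "c * \<tau> \<le> 1 / 2"
    and W: "\<And>t. \<bar>t\<bar> < \<tau> \<Longrightarrow> wulff (h t) r R"
    and h0_cont: "continuous_on (sphere 0 1) (h 0)" and f_cont: "continuous_on (sphere 0 1) f"
    and rel: "\<And>t v. \<bar>t\<bar> < \<tau> \<Longrightarrow> norm v = 1 \<Longrightarrow> \<bar>h t v powr p - h 0 v powr p\<bar> \<le> c * \<bar>t\<bar> * h 0 v powr p"
    and lim: "\<And>e. e > 0 \<Longrightarrow> eventually (\<lambda>t. \<forall>v\<in>sphere 0 1. \<bar>h t v powr p - h 0 v powr p - t * f v\<bar> \<le> e * \<bar>t\<bar>) (at 0)"
begin

sublocale W0: wulff "h 0" r R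
  using W[of 0] \<tau> by simp

definition radt :: "real \<Rightarrow> real^'n \<Rightarrow> real" where
  "radt t = wulff.rad (h t) r"

lemma radt_0: "radt 0 = W0.rad"
  by (simp add: radt_def)

lemma radt_unit: "norm u = 1 \<Longrightarrow> radt t u = radial_fun (wulff_shape (h t)) u" if "\<bar>t\<bar> < \<tau>"
  by (simp add: radt_def wulff.rad_def[OF W[OF that]])

lemma radt_bounds: assumes "\<bar>t\<bar> < \<tau>" shows "r \<le> radt t u" "radt t u \<le> R" "0 < radt t u"
  using wulff.rad_bounds[OF W[OF assms]] by (simp_all add: radt_def)

lemma radt_measurable: "\<bar>t\<bar> < \<tau> \<Longrightarrow> radt t \<in> borel_measurable borel"
  unfolding radt_def by (rule wulff.rad_measurable[OF W])

lemma radt_powr_le_iff: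
  assumes t: "\<bar>t\<bar> < \<tau>" and u: "norm u = 1" and a: "a \<ge> 0"
  shows "a \<le> radt t u powr p \<longleftrightarrow> (\<forall>v\<in>sphere 0 1. a * max 0 (u \<bullet> v) powr p \<le> h t v powr p)"
  using wulff.radial_powr_le_iff[OF W[OF t] u p a] radt_unit[OF t u] by simp

text \<open>Multiplying all constraints by a factor multiplies the maximal admissible
  \<open>a\<close> by the same factor, so a uniform relative error of \<open>h t v powr p\<close>
  passes unchanged to the radial function.\<close>

lemma radt_powr_ratio:
  assumes t: "\<bar>t\<bar> < \<tau>" and u: "norm u = 1"
  shows "\<bar>radt t u powr p - radt 0 u powr p\<bar> \<le> c * \<bar>t\<bar> * radt 0 u powr p"
proof -
  let ?a = "radt t u powr p" and ?b = "radt 0 u powr p"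
  have t0: "\<bar>0\<bar> < \<tau>" using \<tau> by simp
  have ct: "0 \<le> c * \<bar>t\<bar>" "c * \<bar>t\<bar> \<le> 1 / 2"
    using c t mult_left_mono[of "\<bar>t\<bar>" \<tau> c] by auto
  have k: "?a * max 0 (u \<bullet> v) powr p \<le> h t v powr p" "?b * max 0 (u \<bullet> v) powr p \<le> h 0 v powr p" if "v \<in> sphere 0 1" for v
    using radt_powr_le_iff[OF t u, of ?a, THEN iffD1] radt_powr_le_iff[OF t0 u, of ?b, THEN iffD1] that
    by (blast intro: order_refl powr_ge_zero)+
  have q: "h t v powr p \<le> (1 + c * \<bar>t\<bar>) * h 0 v powr p" "(1 - c * \<bar>t\<bar>) * h 0 v powr p \<le> h t v powr p"
    if "v \<in> sphere 0 1" for v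
    using rel[OF t, of v] that by (auto simp: abs_le_iff algebra_simps)
  have "(1 - c * \<bar>t\<bar>) * ?b \<le> ?a"
  proof (subst radt_powr_le_iff[OF t u])
    show "\<forall>v\<in>sphere 0 1. (1 - c * \<bar>t\<bar>) * ?b * max 0 (u \<bullet> v) powr p \<le> h t v powr p"
    proof
      fix v :: "real^'n" assume v: "v \<in> sphere 0 1"
      have "(1 - c * \<bar>t\<bar>) * (?b * max 0 (u \<bullet> v) powr p) \<le> (1 - c * \<bar>t\<bar>) * h 0 v powr p"
        using k(2)[OF v] ct by (intro mult_left_mono) auto
      thus "(1 - c * \<bar>t\<bar>) * ?b * max 0 (u \<bullet> v) powr p \<le> h t v powr p"
        using q(2)[OF v] by (simp add: mult.assoc)
    qed
  qed (use ct in auto)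
  moreover have "?a / (1 + c * \<bar>t\<bar>) \<le> ?b"
  proof (subst radt_powr_le_iff[OF t0 u])
    show "\<forall>v\<in>sphere 0 1. ?a / (1 + c * \<bar>t\<bar>) * max 0 (u \<bullet> v) powr p \<le> h 0 v powr p"
    proof
      fix v :: "real^'n" assume v: "v \<in> sphere 0 1"
      have "?a * max 0 (u \<bullet> v) powr p \<le> (1 + c * \<bar>t\<bar>) * h 0 v powr p"
        using k(1)[OF v] q(1)[OF v] by simp
      thus "?a / (1 + c * \<bar>t\<bar>) * max 0 (u \<bullet> v) powr p \<le> h 0 v powr p"
        using ct by (simp add: field_simps)
    qed
  qed (use ct in auto)
  hence "?a \<le> ?b * (1 + c * \<bar>t\<bar>)" using ct by (simp add: pos_divide_le_eq)
  ultimately show ?thesis by (simp add: abs_le_iff algebra_simps)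
qed

lemma radt_power: "\<bar>t\<bar> < \<tau> \<Longrightarrow> radt t u ^ m = (radt t u powr p) powr (real m / p)"
  using radt_bounds(3)[of t u] p by (simp add: powr_powr powr_realpow)

text \<open>Provides the constant dominating function for all difference quotients. Off the sphere
  \<open>radt\<close> is constantly \<open>r\<close>, so nothing changes there.\<close>

lemma radt_power_lipschitz:
  obtains C where "C \<ge> 0" "\<And>t u. \<bar>t\<bar> < \<tau> \<Longrightarrow> \<bar>radt t u ^ m - radt 0 u ^ m\<bar> \<le> C * \<bar>t\<bar>"
proof -
  obtain C where C: "C \<ge> 0" "\<And>x. x \<in> {1/2..3/2} \<Longrightarrow> \<bar>x powr (real m / p) - 1\<bar> \<le> C * \<bar>x - 1\<bar>"
    using powr_lipschitz_at_1 by blast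
  have R: "0 \<le> R" using W0.r W0.r_le_R by simp
  have t0: "\<bar>0\<bar> < \<tau>" using \<tau> by simp
  have "\<bar>radt t u ^ m - radt 0 u ^ m\<bar> \<le> R ^ m * (C * c) * \<bar>t\<bar>" if t: "\<bar>t\<bar> < \<tau>" for t u
  proof (cases "norm u = 1")
    case True
    let ?a = "radt t u powr p" and ?b = "radt 0 u powr p"
    have pos: "?a > 0" "?b > 0" using radt_bounds(3)[OF t, of u] radt_bounds(3)[OF t0, of u] by auto
    have ct: "0 \<le> c * \<bar>t\<bar>" "c * \<bar>t\<bar> \<le> 1 / 2"
      using c t mult_left_mono[of "\<bar>t\<bar>" \<tau> c] by auto
    define x where "x = ?a / ?b"
    have x1: "\<bar>x - 1\<bar> \<le> c * \<bar>t\<bar>"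
    proof -
      have "x - 1 = (?a - ?b) / ?b" using pos by (simp add: x_def diff_divide_distrib)
      hence "\<bar>x - 1\<bar> = \<bar>?a - ?b\<bar> / ?b" using pos by simp
      thus ?thesis using radt_powr_ratio[OF t True] pos ct by (simp add: pos_divide_le_eq)
    qed
    hence x: "x \<in> {1/2..3/2}" using ct by (auto simp: abs_le_iff)
    have "radt t u ^ m = radt 0 u ^ m * x powr (real m / p)"
    proof -
      have "?a powr (real m / p) = (?b * x) powr (real m / p)" using pos by (simp add: x_def)
      also have "\<dots> = ?b powr (real m / p) * x powr (real m / p)" by (rule powr_mult)
      finally show ?thesis using radt_power[OF t] radt_power[OF t0] by metis
    qed
    hence "radt t u ^ m - radt 0 u ^ m = radt 0 u ^ m * (x powr (real m / p) - 1)"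
      by (simp add: right_diff_distrib)
    hence "\<bar>radt t u ^ m - radt 0 u ^ m\<bar> = radt 0 u ^ m * \<bar>x powr (real m / p) - 1\<bar>"
      using radt_bounds(3)[OF t0, of u] by (simp add: abs_mult)
    also have "\<dots> \<le> R ^ m * (C * (c * \<bar>t\<bar>))"
    proof (rule mult_mono)
      show "radt 0 u ^ m \<le> R ^ m" using radt_bounds[OF t0, of u] by (intro power_mono) auto
      show "\<bar>x powr (real m / p) - 1\<bar> \<le> C * (c * \<bar>t\<bar>)"
        using C(2)[OF x] mult_left_mono[OF x1 C(1)] by linarith
    qed (use R in auto)
    finally show ?thesis by (simp add: mult.assoc)
  next
    case False
    have "radt t u = r" "radt 0 u = r" using False
      by (simp_all add: radt_def wulff.rad_def[OF W[OF t]] wulff.rad_def[OF W[OF t0]])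
    thus ?thesis using R C(1) c(1) by simp
  qed
  thus thesis using that[of "R ^ m * (C * c)"] R C(1) c(1) by simp
qed

lemma radt_power_derivative:
  assumes u: "norm u = 1" and v0: "W0.contact u v0" "\<And>v. W0.contact u v \<Longrightarrow> v = v0"
  shows "((\<lambda>t. (radt t u ^ m - radt 0 u ^ m) / t) \<longlongrightarrow>
      real m / p * (radt 0 u powr (real m - p) * (f v0 * (u \<bullet> v0) powr (- p)))) (at 0)"
proof -
  let ?k = "\<lambda>v. max 0 (u \<bullet> v) powr p"
  define A where "A = (\<lambda>t. radt t u powr p)"
  have t0: "\<bar>0\<bar> < \<tau>" using \<tau> by simp
  have ev: "eventually (\<lambda>t. \<bar>t\<bar> < \<tau>) (at 0)"
    using \<tau> by (auto simp: eventually_at dist_real_def intro!: exI[of _ \<tau>])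
  have uv: "u \<bullet> v0 > 0" using W0.contact_inner_pos[OF u v0(1)] .
  have rho0: "radt 0 u > 0" by (rule radt_bounds(3)[OF t0])
  \<comment> \<open>Equality of p-th powers is contact: where \<open>u \<bullet> v \<le> 0\<close>
    the left side is 0 while \<open>h 0 v\<close> is positive.\<close>
  have touch: "A 0 * ?k v = h 0 v powr p \<longleftrightarrow> W0.contact u v" if v: "v \<in> sphere 0 1" for v
  proof (cases "u \<bullet> v \<le> 0")
    case True
    have "radt 0 u * (u \<bullet> v) \<le> 0" using True rho0 by (simp add: mult_nonneg_nonpos)
    hence "\<not> W0.contact u v" using W0.contact_inner_pos[OF u, of v] True by fastforce
    moreover have "h 0 v > 0" using W0.h_pos v by simp
    ultimately show ?thesis using True by (simp add: max_def)
  next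
    case False
    have h: "h 0 v > 0" using W0.h_pos v by simp
    have "A 0 * ?k v = (radt 0 u * (u \<bullet> v)) powr p" using False rho0 by (simp add: A_def powr_mult)
    moreover have "(radt 0 u * (u \<bullet> v)) powr p = h 0 v powr p \<longleftrightarrow> radt 0 u * (u \<bullet> v) = h 0 v"
      using False rho0 h p by (metis less_eq_real_def mult_pos_pos not_le powr_less_mono2 nless_le)
    ultimately show ?thesis using v radt_unit[OF t0 u] by (simp add: W0.contact_def)
  qed
  have v0S: "v0 \<in> sphere 0 1" using v0(1) by (simp add: W0.contact_def)
  have "((\<lambda>t. (A t - A 0) / t) \<longlongrightarrow> f v0 / ?k v0) (at 0)"
  proof (rule tendsto_contact_multiplier[where S="sphere 0 1" and k="?k" and g="\<lambda>v. h 0 v powr p" and q="\<lambda>t v. h t v powr p"])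
    show "continuous_on (sphere 0 1) (\<lambda>v. h 0 v powr p)"
      by (intro continuous_intros h0_cont ballI) (use W0.h_pos in fastforce)
    show "continuous_on (sphere 0 1) ?k"
      by (rule continuous_on_powr') (use p in \<open>auto intro!: continuous_intros\<close>)
    show "A 0 * ?k v \<le> h 0 v powr p" if "v \<in> sphere 0 1" for v
      using radt_powr_le_iff[OF t0 u, of "A 0"] that by (simp add: A_def)
    show "\<And>v. v \<in> sphere 0 1 \<Longrightarrow> A 0 * ?k v = h 0 v powr p \<Longrightarrow> v = v0" using touch v0(2) by blast
    show "A 0 * ?k v0 = h 0 v0 powr p" using touch[OF v0S] v0(1) by blast
    show "\<forall>\<^sub>F t in at 0. \<forall>a\<ge>0. a \<le> A t \<longleftrightarrow> (\<forall>v\<in>sphere 0 1. a * ?k v \<le> h t v powr p)"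
      using ev by eventually_elim (auto simp: A_def radt_powr_le_iff[OF _ u])
    show "\<forall>\<^sub>F t in at 0. 0 \<le> A t" by (simp add: A_def)
  qed (use v0S uv rho0 lim f_cont in \<open>auto simp: A_def\<close>)
  hence "(A has_real_derivative f v0 / ?k v0) (at 0)" by (simp add: DERIV_def)
  hence D: "((\<lambda>t. A t powr (real m / p)) has_real_derivative real m / p * A 0 powr (real m / p - 1) * (f v0 / ?k v0)) (at 0)"
    using rho0 by (intro DERIV_chain2[OF has_real_derivative_powr]) (auto simp: A_def)
  \<comment> \<open>The chain rule for the exponent \<open>m / p\<close> is the origin of the
    exponents \<open>m - p\<close> and \<open>- p\<close> in the curvature density.\<close>
  have eq: "real m / p * A 0 powr (real m / p - 1) * (f v0 / ?k v0)
      = real m / p * (radt 0 u powr (real m - p) * (f v0 * (u \<bullet> v0) powr (- p)))"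
  proof -
    have "A 0 powr (real m / p - 1) = radt 0 u powr (real m - p)"
      using p by (simp add: A_def powr_powr right_diff_distrib)
    moreover have "f v0 / ?k v0 = f v0 * (u \<bullet> v0) powr (- p)"
      using uv by (simp add: powr_minus divide_inverse)
    ultimately show ?thesis by simp
  qed
  have "((\<lambda>t. (A t powr (real m / p) - A 0 powr (real m / p)) / t) \<longlongrightarrow>
      real m / p * (radt 0 u powr (real m - p) * (f v0 * (u \<bullet> v0) powr (- p)))) (at 0)"
    using D unfolding eq DERIV_def by simp
  moreover have "\<forall>\<^sub>F t in at 0. (A t powr (real m / p) - A 0 powr (real m / p)) / t = (radt t u ^ m - radt 0 u ^ m) / t"
    using ev by eventually_elim (simp add: A_def radt_power[OF t0] radt_power)
  ultimately show ?thesis by (rule Lim_transform_eventually)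
qed

end

subsection \<open>The affine dual curvature measure\<close>

text \<open>The random process for planes inside the hyperplane starts at the projection onto its
  complement, the line of \<open>u\<close>. It is the same starting point as in
  \<open>flag_kernel\<close>.\<close>

lemma coproj_orthogonal_hyperplane:
  fixes u :: "real^'n"
  assumes u: "norm u = 1"
  shows "coproj {x. orthogonal u x} = dyad u" "dim {x. orthogonal u x} = CARD('n) - 1" "subspace {x. orthogonal u x}"
proof -
  show sub: "subspace {x. orthogonal u x}" by (auto simp: subspace_def orthogonal_def inner_add_right)
  have uu: "u \<bullet> u = 1" using u by (simp add: dot_square_norm)
  have "proj_mat {x. orthogonal u x} *v x = x - (u \<bullet> x) *\<^sub>R u" for x
    unfolding proj_mat_vector[OF sub]
    by (rule closest_point_eqI[OF sub]) (auto simp: orthogonal_def inner_diff_right uu)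
  thus "coproj {x. orthogonal u x} = dyad u"
    by (simp add: matrix_eq coproj_vector dyad_vector uu)
  have "u \<noteq> 0" using u by auto
  hence "real (CARD('n) - dim {x. orthogonal u x}) = 1"
    unfolding trace_coproj[OF sub, symmetric] \<open>coproj _ = _\<close> by (rule trace_dyad)
  thus "dim {x. orthogonal u x} = CARD('n) - 1" using dim_le_card[of "{x. orthogonal u x}"] by simp
qed

lemma coproj_UNIV: "coproj (UNIV :: (real^'n) set) = 0"
proof -
  have "proj_mat (UNIV :: (real^'n) set) *v x = x" for x :: "real^'n"
    using proj_mat_fix[of UNIV x] by simp
  thus ?thesis by (simp add: matrix_eq coproj_vector)
qed

text \<open>Projections onto orthogonal subspaces add up. This recognises the argument of the Radon
  transform as the outcome of the process started at \<open>dyad u\<close>.\<close>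

lemma span_insert_orthogonal:
  fixes u :: "real^'n"
  assumes u: "norm u = 1" and \<zeta>: "\<zeta> \<in> grassmannian {x. orthogonal u x} k"
  shows "proj_mat (span (insert u \<zeta>)) = dyad u + proj_mat \<zeta>" "dim (span (insert u \<zeta>)) = Suc k"
proof -
  have z: "subspace \<zeta>" "\<And>x. x \<in> \<zeta> \<Longrightarrow> u \<bullet> x = 0" "dim \<zeta> = k"
    using \<zeta> by (auto simp: grassmannian_def orthogonal_def)
  have uu: "u \<bullet> u = 1" using u by (simp add: dot_square_norm)
  have zfix: "(x - proj_mat \<zeta> *v x) \<bullet> y = 0" if "y \<in> \<zeta>" for x y
  proof -
    have "proj_mat \<zeta> *v y = y" using that proj_mat_fix[OF z(1)] by blast
    hence "x \<bullet> y = (proj_mat \<zeta> *v x) \<bullet> y" using is_projD(2)[OF is_proj_proj_mat[OF z(1)], of x y] by simp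
    thus ?thesis by (simp add: inner_diff_left)
  qed
  have "proj_mat (span (insert u \<zeta>)) *v x = (dyad u + proj_mat \<zeta>) *v x" for x
    unfolding proj_mat_vector[OF subspace_span]
  proof (rule closest_point_eqI[OF subspace_span])
    have e: "(dyad u + proj_mat \<zeta>) *v x = (u \<bullet> x) *\<^sub>R u + proj_mat \<zeta> *v x"
      by (simp add: matrix_vector_mult_add_rdistrib dyad_vector uu)
    have "(u \<bullet> x) *\<^sub>R u \<in> span (insert u \<zeta>)" by (intro span_scale span_base) simp
    moreover have "proj_mat \<zeta> *v x \<in> span (insert u \<zeta>)" using proj_mat_in[OF z(1)] by (intro span_base) simp
    ultimately show "(dyad u + proj_mat \<zeta>) *v x \<in> span (insert u \<zeta>)" unfolding e by (rule span_add)
    fix y assume "y \<in> span (insert u \<zeta>)"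
    then obtain c where "y - c *\<^sub>R u \<in> span \<zeta>" by (auto simp: span_breakdown_eq)
    hence w: "y - c *\<^sub>R u \<in> \<zeta>" using z(1) by (metis span_eq_iff)
    define w where "w = y - c *\<^sub>R u"
    have wz: "w \<in> \<zeta>" and y: "y = w + c *\<^sub>R u" using w by (simp_all add: w_def)
    have pu: "u \<bullet> (proj_mat \<zeta> *v x) = 0" using z(2) proj_mat_in[OF z(1)] by blast
    show "(x - (dyad u + proj_mat \<zeta>) *v x) \<bullet> y = 0"
      unfolding e y using zfix[OF wz, of x] z(2)[OF wz] pu
      by (simp add: inner_diff_left inner_add_left inner_add_right uu inner_commute algebra_simps)
  qed
  thus *: "proj_mat (span (insert u \<zeta>)) = dyad u + proj_mat \<zeta>" by (simp add: matrix_eq)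
  have "u \<noteq> 0" using u by auto
  hence "real (dim (span (insert u \<zeta>))) = real (Suc k)"
    using trace_proj_mat[of "span (insert u \<zeta>)"] trace_proj_mat[OF z(1)] z(3) trace_dyad[of u]
    by (simp add: * trace_add)
  thus "dim (span (insert u \<zeta>)) = Suc k" by simp
qed

lemma dyad_sgn: "dyad (sgn y) = dyad (y :: real^'n)"
proof (cases "y = 0")
  case False
  have "dyad (sgn y) *v x = dyad y *v x" for x
    using False by (simp add: dyad_vector sgn_div_norm power2_norm_eq_inner[symmetric] dot_square_norm power2_eq_square field_simps)
  thus ?thesis by (simp add: matrix_eq)
qed (simp add: sgn_zero)

text \<open>The cone definition says that directions of uniform vectors in the ball carry spherical
  measure up to total mass; completion leaves nonnegative integrals unchanged.\<close>

lemma nn_integral_sphere_lebesgue: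
  fixes F :: "real^'n \<Rightarrow> ennreal"
  assumes [measurable]: "F \<in> borel_measurable borel"
  shows "(\<integral>\<^sup>+u. F u \<partial>sphere_lebesgue)
       = ennreal (real CARD('n) * unit_ball_vol (real CARD('n))) * (\<integral>\<^sup>+y. F (sgn y) \<partial>unif_ball)"
proof -
  let ?X = "cball (0::real^'n) 1 - {0}" and ?S = "restrict_space borel (sphere (0::real^'n) 1)"
  have m: "sgn \<in> restrict_space lborel ?X \<rightarrow>\<^sub>M ?S"
    by (intro measurable_restrict_space2 measurable_restrict_space1) (auto simp: space_restrict_space norm_sgn)
  have F: "F \<in> borel_measurable ?S" by (intro measurable_restrict_space1) measurable
  have "(\<integral>\<^sup>+u. F u \<partial>sphere_lebesgue) = of_nat CARD('n) * (\<integral>\<^sup>+x. F (sgn x) \<partial>restrict_space lborel ?X)"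
    unfolding sphere_lebesgue_def nn_integral_completion
    by (subst nn_integral_scale_measure) (simp_all add: F nn_integral_distr[OF m] cong: measurable_cong_sets)
  also have "(\<integral>\<^sup>+x. F (sgn x) \<partial>restrict_space lborel ?X) = (\<integral>\<^sup>+x. F (sgn x) * indicator ?X x \<partial>lborel)"
    by (rule nn_integral_restrict_space) auto
  also have "\<dots> = (\<integral>\<^sup>+x. (if norm x < 1 then F (sgn x) else 0) \<partial>lborel)"
  proof (rule nn_integral_cong_AE)
    from AE_lborel_norm_neq AE_lborel_singleton[of "0::real^'n"]
    show "AE x in lborel. F (sgn x) * indicator ?X x = (if norm x < 1 then F (sgn x) else 0)"
      by eventually_elim (auto simp: indicator_def)
  qed
  also have "\<dots> = emeasure lborel (ball (0::real^'n) 1) * (\<integral>\<^sup>+y. F (sgn y) \<partial>unif_ball)"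
  proof -
    have b: "emeasure lborel (ball (0::real^'n) 1) \<noteq> 0" "emeasure lborel (ball (0::real^'n) 1) \<noteq> \<infinity>"
      using emeasure_cball_bounds[where 'a="real^'n"] by (auto simp: emeasure_ball emeasure_cball)
    have "emeasure lborel (ball (0::real^'n) 1) * (\<integral>\<^sup>+y. F (sgn y) \<partial>unif_ball)
      = (\<integral>\<^sup>+x. (if norm x < 1 then F (sgn x) else 0) \<partial>lborel) * emeasure lborel (ball (0::real^'n) 1) / emeasure lborel (ball (0::real^'n) 1)"
      by (simp only: nn_integral_unif_ball[OF measurable_compose[OF borel_measurable_sgn_vec assms]] ennreal_times_divide mult.commute)
    also have "\<dots> = (\<integral>\<^sup>+x. (if norm x < 1 then F (sgn x) else 0) \<partial>lborel)"
      using b by (intro ennreal_mult_divide_eq) auto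
    finally show ?thesis ..
  qed
  also have "emeasure lborel (ball (0::real^'n) 1) = ennreal (unit_ball_vol (real CARD('n)))"
    by (simp add: emeasure_ball)
  finally show ?thesis by (simp add: ennreal_mult' mult.assoc ennreal_of_nat_eq_real_of_nat)
qed

section \<open>Section volumes and Radon transforms through projection matrices\<close>

context wulff begin

text \<open>The section volume of the plane with projection \<open>A\<close>, but defined for every
  matrix, so that measurability and bounds hold without side conditions.\<close>

definition svol :: "nat \<Rightarrow> real^'n^'n \<Rightarrow> real" where
  "svol m A = unit_ball_vol (real m) * (\<integral>x. rad (sgn (A *v x)) ^ m \<partial>unif_ball)"

lemma rad_power_integrable:
  fixes A :: "real^'n^'n"
  shows "integrable unif_ball (\<lambda>x. rad (sgn (A *v x)) ^ m)"
proof -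
  interpret U: prob_space "unif_ball :: (real^'n) measure" by (rule prob_space_unif_ball)
  show ?thesis
  proof (rule U.integrable_const_bound[where B="R ^ m"])
    show "AE x in unif_ball. norm (rad (sgn (A *v x)) ^ m) \<le> R ^ m"
      using rad_bounds by (auto intro!: AE_I2 power_mono simp: abs_of_pos less_imp_le)
  qed measurable
qed

lemma svol_measurable [measurable]: "svol m \<in> borel_measurable borel"
proof -
  interpret U: prob_space "unif_ball :: (real^'n) measure" by (rule prob_space_unif_ball)
  show ?thesis unfolding svol_def[abs_def] by measurable
qed

lemma svol_bounds: "0 \<le> svol m A" "svol m A \<le> unit_ball_vol (real m) * R ^ m"
proof -
  interpret U: prob_space "unif_ball :: (real^'n) measure" by (rule prob_space_unif_ball)
  show "0 \<le> svol m A" unfolding svol_def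
    using rad_bounds(3) by (intro mult_nonneg_nonneg unit_ball_vol_nonneg integral_nonneg_AE AE_I2) (auto simp: less_imp_le)
  have "(\<integral>x. rad (sgn (A *v x)) ^ m \<partial>unif_ball) \<le> (\<integral>x. R ^ m \<partial>(unif_ball :: (real^'n) measure))"
    using rad_bounds(2,3) by (intro Bochner_Integration.integral_mono rad_power_integrable power_mono) (auto simp: less_imp_le)
  thus "svol m A \<le> unit_ball_vol (real m) * R ^ m" unfolding svol_def
    using U.prob_space by (intro mult_left_mono) simp_all
qed

lemma section_vol_svol: "subspace \<xi> \<Longrightarrow> dim \<xi> = m \<Longrightarrow> 1 \<le> m \<Longrightarrow> section_vol K \<xi> = svol m (proj_mat \<xi>)"
  using section_vol_K by (simp add: svol_def)

lemma dual_quermass_svol: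
  assumes m: "1 \<le> m" "m \<le> CARD('n)"
  shows "dual_quermass m K = (\<integral>A. svol m A ^ CARD('n) \<partial>random_extension m 0)"
proof -
  have "(\<integral>\<xi>. section_vol K \<xi> ^ CARD('n) \<partial>grassmannian_haar UNIV m)
      = (\<integral>A. svol m A ^ CARD('n) \<partial>random_extension m (coproj UNIV))"
    by (rule integral_grassmannian_haar)
      (use m in \<open>auto simp: coproj_UNIV grassmannian_def section_vol_svol\<close>)
  thus ?thesis by (simp add: dual_quermass_def coproj_UNIV)
qed

lemma dual_radon_svol:
  assumes u: "norm u = 1" and m: "1 \<le> m" "m \<le> CARD('n)"
  shows "dual_radon m (\<lambda>\<xi>. section_vol K \<xi> ^ j) u
     = (real m * unit_ball_vol (real m)) / (real CARD('n) * unit_ball_vol (real CARD('n)))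
       * (\<integral>B. svol m B ^ j \<partial>random_extension (m - 1) (dyad u))"
proof -
  note H = coproj_orthogonal_hyperplane[OF u]
  have "(\<integral>\<zeta>. section_vol K (span (insert u \<zeta>)) ^ j \<partial>grassmannian_haar {x. orthogonal u x} (m - 1))
     = (\<integral>B. svol m B ^ j \<partial>random_extension (m - 1) (coproj {x. orthogonal u x}))"
  proof (rule integral_grassmannian_haar[OF H(3)])
    show "m - 1 \<le> dim {x. orthogonal u x}" using m H(2) by simp
    fix \<zeta> assume z: "\<zeta> \<in> grassmannian {x. orthogonal u x} (m - 1)"
    show "section_vol K (span (insert u \<zeta>)) ^ j = svol m (coproj {x. orthogonal u x} + proj_mat \<zeta>) ^ j"
      using span_insert_orthogonal[OF u z] m by (simp add: section_vol_svol H(1))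
  qed measurable
  thus ?thesis by (simp add: dual_radon_def H(1))
qed

section \<open>Measurability of the Gauss map\<close>

lemma outer_unit_normals_iff:
  assumes u: "norm u = 1"
  shows "v \<in> outer_unit_normals K (\<rho> u *\<^sub>R u) \<longleftrightarrow> norm v = 1 \<and> (\<forall>y\<in>K. gauge u * (y \<bullet> v) \<le> u \<bullet> v)"
  using radial_pos[OF u] by (auto simp: outer_unit_normals_def gauge_radial[OF u] field_simps)

text \<open>The graph of the normal relation over directions. Writing it with the continuous gauge
  instead of the radial function makes it visibly closed.\<close>

definition normal_pairs :: "((real^'n) \<times> (real^'n)) set" where
  "normal_pairs = {z. norm (fst z) = 1 \<and> norm (snd z) = 1 \<and> (\<forall>y\<in>K. gauge (fst z) * (y \<bullet> snd z) \<le> fst z \<bullet> snd z)}"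

lemma compact_normal_pairs: "compact normal_pairs"
proof -
  have c: "continuous_on UNIV (\<lambda>z::(real^'n) \<times> (real^'n). gauge (fst z))"
    by (rule continuous_on_compose2[OF gauge_continuous[of UNIV] continuous_on_fst[OF continuous_on_id]]) simp
  have "normal_pairs = (sphere 0 1 \<times> sphere 0 1) \<inter> (\<Inter>y\<in>K. {z. gauge (fst z) * (y \<bullet> snd z) \<le> fst z \<bullet> snd z})"
    by (auto simp: normal_pairs_def)
  moreover have "closed (\<Inter>y\<in>K. {z::(real^'n) \<times> (real^'n). gauge (fst z) * (y \<bullet> snd z) \<le> fst z \<bullet> snd z})"
    by (intro closed_INT ballI closed_Collect_le continuous_intros c)
  ultimately show ?thesis by (simp add: compact_Times compact_Int_closed)
qed

definition regular :: "(real^'n) set" where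
  "regular = {u. norm u = 1 \<and> unique_normal u}"

text \<open>The irregular directions are those with two normals at distance at least
  \<open>1 / (n + 1)\<close> for some \<open>n\<close>. For fixed \<open>n\<close> they form the
  projection of a compact set, hence a compact set.\<close>

lemma regular_borel [measurable]: "regular \<in> sets borel"
proof -
  define D where "D = (\<lambda>n::nat. (\<lambda>z. fst (fst z)) ` ((normal_pairs \<times> normal_pairs)
      \<inter> {z. fst (fst z) = fst (snd z) \<and> 1 / real (Suc n) \<le> dist (snd (fst z)) (snd (snd z))}))"
  have "compact (D n)" for n unfolding D_def
    by (intro compact_continuous_image continuous_intros compact_Int_closed compact_Times compact_normal_pairs
        closed_Collect_conj closed_Collect_eq closed_Collect_le)
  hence [measurable]: "D n \<in> sets borel" for n by (simp add: borel_compact)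
  have "regular = sphere 0 1 - (\<Union>n. D n)"
  proof (intro set_eqI iffI)
    fix u assume u: "u \<in> regular"
    have "u \<notin> D n" for n
    proof
      assume "u \<in> D n"
      then obtain v w where vw: "(u, v) \<in> normal_pairs" "(u, w) \<in> normal_pairs" "1 / real (Suc n) \<le> dist v w"
        unfolding D_def by auto
      hence "v = w" using u by (auto simp: regular_def outer_unit_normals_iff normal_pairs_def)
      thus False using vw(3) by simp
    qed
    thus "u \<in> sphere 0 1 - (\<Union>n. D n)" using u by (auto simp: regular_def)
  next
    fix u assume u: "u \<in> sphere 0 1 - (\<Union>n. D n)"
    have "v = w" if "v \<in> outer_unit_normals K (\<rho> u *\<^sub>R u)" "w \<in> outer_unit_normals K (\<rho> u *\<^sub>R u)" for v w
    proof (rule ccontr)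
      assume "v \<noteq> w"
      then obtain n where n: "1 / real (Suc n) < dist v w" using nat_approx_posE[of "dist v w"] by auto
      have "(u, v) \<in> normal_pairs" "(u, w) \<in> normal_pairs"
        using that u by (auto simp: outer_unit_normals_iff normal_pairs_def)
      hence "u \<in> D n" unfolding D_def using n by (intro image_eqI[of _ _ "((u, v), (u, w))"]) auto
      thus False using u by blast
    qed
    thus "u \<in> regular" using u by (auto simp: regular_def)
  qed
  thus ?thesis by simp
qed

lemma AE_regular: "AE y in unif_ball. sgn y \<in> regular"
proof -
  from AE_unique_outer_normal AE_unif_ball_nonzero show ?thesis
    by eventually_elim (simp add: regular_def norm_sgn)
qed

text \<open>The default is a unit vector, so that for continuous \<open>h\<close> the map takes
  values in the sphere everywhere.\<close>

definition gauss :: "real^'n \<Rightarrow> real^'n" where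
  "gauss u = (if u \<in> regular then outer_unit_normal K (\<rho> u *\<^sub>R u) else axis undefined 1)"

lemma gauss_regular:
  assumes cont: "continuous_on (sphere 0 1) h" and u: "u \<in> regular"
  shows "norm (gauss u) = 1" "contact u (gauss u)" "0 < u \<bullet> gauss u"
    "\<And>v. v \<in> outer_unit_normals K (\<rho> u *\<^sub>R u) \<longleftrightarrow> v = gauss u" "\<And>v. contact u v \<Longrightarrow> v = gauss u"
proof -
  have n: "norm u = 1" "unique_normal u" using u unfolding regular_def by blast+
  have g: "gauss u = outer_unit_normal K (\<rho> u *\<^sub>R u)" using u by (simp add: gauss_def)
  note U = unique_contact[OF cont n, folded g]
  show "norm (gauss u) = 1" "0 < u \<bullet> gauss u" by (rule U)+
  show "contact u (gauss u)" unfolding contact_def using U(1,2) by blast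
  show "v \<in> outer_unit_normals K (\<rho> u *\<^sub>R u) \<longleftrightarrow> v = gauss u" for v by (rule U(4))
  show "v = gauss u" if "contact u v" for v using that U(5) unfolding contact_def by blast
qed

lemma gauss_norm: "continuous_on (sphere 0 1) h \<Longrightarrow> norm (gauss u) = 1"
  by (cases "u \<in> regular") (simp add: gauss_regular(1), simp add: gauss_def)

text \<open>On regular directions the preimage of a closed set \<open>C\<close> is the projection of
  the compact set of normal pairs with second entry in \<open>C\<close>.\<close>

lemma gauss_measurable:
  assumes cont: "continuous_on (sphere 0 1) h"
  shows "gauss \<in> borel_measurable borel"
proof (rule borel_measurableI)
  fix S :: "(real^'n) set" assume "open S"
  define C where "C = - S"
  have C: "closed C" using \<open>open S\<close> unfolding C_def by (rule closed_Compl)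
  define E where "E = fst ` (normal_pairs \<inter> (UNIV \<times> C))"
  have "compact E" unfolding E_def
    by (intro compact_continuous_image continuous_intros compact_Int_closed compact_normal_pairs closed_Times closed_UNIV C)
  hence [measurable]: "E \<in> sets borel" by (simp add: borel_compact)
  have "u \<in> E \<longleftrightarrow> gauss u \<in> C" if u: "u \<in> regular" for u
  proof -
    have n: "norm u = 1" using u unfolding regular_def by blast
    have "u \<in> E \<longleftrightarrow> (\<exists>v\<in>C. (u, v) \<in> normal_pairs)"
    proof
      show "\<exists>v\<in>C. (u, v) \<in> normal_pairs" if "u \<in> E" using that by (auto simp: E_def)
      show "u \<in> E" if "\<exists>v\<in>C. (u, v) \<in> normal_pairs"
        using that unfolding E_def by (metis IntI SigmaI UNIV_I fst_conv image_eqI)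
    qed
    also have "\<dots> \<longleftrightarrow> (\<exists>v\<in>C. v \<in> outer_unit_normals K (\<rho> u *\<^sub>R u))"
      by (simp add: outer_unit_normals_iff[OF n] normal_pairs_def n)
    finally have "u \<in> E \<longleftrightarrow> (\<exists>v\<in>C. v \<in> outer_unit_normals K (\<rho> u *\<^sub>R u))" .
    thus ?thesis unfolding gauss_regular(4)[OF cont u] by blast
  qed
  hence "gauss -` C \<inter> space borel = (E \<inter> regular) \<union> (if axis undefined 1 \<in> C then - regular else {})"
    by (auto simp: gauss_def split: if_splits)
  also have "\<dots> \<in> sets borel" by auto
  finally have "UNIV - (gauss -` C \<inter> space borel) \<in> sets borel" by auto
  moreover have "UNIV - (gauss -` C \<inter> space borel) = gauss -` S \<inter> space borel" by (auto simp: C_def)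
  ultimately show "gauss -` S \<inter> space borel \<in> sets borel" by simp
qed

end

section \<open>Spherical measure on Borel sets, before completion\<close>

definition sphere_borel :: "(real^'n) measure" where
  "sphere_borel = restrict_space borel (sphere 0 1)"

definition sphere_measure :: "(real^'n) measure" where
  "sphere_measure = scale_measure (of_nat CARD('n))
     (distr (restrict_space lborel (cball 0 1 - {0})) sphere_borel sgn)"

lemma sphere_lebesgue_eq: "sphere_lebesgue = completion sphere_measure"
  by (simp add: sphere_lebesgue_def sphere_measure_def sphere_borel_def)

lemma sets_sphere_measure [measurable_cong, simp]: "sets sphere_measure = sets sphere_borel"
  by (simp add: sphere_measure_def)

lemma space_sphere_borel [simp]: "space sphere_borel = sphere 0 1"
  by (simp add: sphere_borel_def space_restrict_space)

lemma space_sphere_measure [simp]: "space sphere_measure = sphere 0 1"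
  using sets_eq_imp_space_eq[OF sets_sphere_measure] by simp

lemma measurable_sphere_borel: "f \<in> borel \<rightarrow>\<^sub>M N \<Longrightarrow> f \<in> sphere_borel \<rightarrow>\<^sub>M N"
  unfolding sphere_borel_def by (rule measurable_restrict_space1)

lemma measurable_sphere_measure: "f \<in> borel \<rightarrow>\<^sub>M N \<Longrightarrow> f \<in> sphere_measure \<rightarrow>\<^sub>M N"
  by (subst measurable_cong_sets[OF sets_sphere_measure refl]) (rule measurable_sphere_borel)

lemma measurable_density_sphere_measure: "f \<in> sphere_borel \<rightarrow>\<^sub>M N \<Longrightarrow> f \<in> density sphere_measure g \<rightarrow>\<^sub>M N"
proof -
  have "sets (density sphere_measure g) = sets sphere_borel" by simp
  thus "f \<in> sphere_borel \<rightarrow>\<^sub>M N \<Longrightarrow> f \<in> density sphere_measure g \<rightarrow>\<^sub>M N"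
    by (subst measurable_cong_sets[OF _ refl])
qed

lemma nn_integral_sphere_measure:
  fixes F :: "real^'n \<Rightarrow> ennreal"
  assumes "F \<in> borel_measurable borel"
  shows "(\<integral>\<^sup>+u. F u \<partial>sphere_measure)
       = ennreal (real CARD('n) * unit_ball_vol (real CARD('n))) * (\<integral>\<^sup>+y. F (sgn y) \<partial>unif_ball)"
  using nn_integral_sphere_lebesgue[OF assms] by (simp add: sphere_lebesgue_eq nn_integral_completion)

lemma integral_sphere_measure:
  fixes g :: "real^'n \<Rightarrow> real"
  assumes [measurable]: "g \<in> borel_measurable borel" and B: "\<And>u. \<bar>g u\<bar> \<le> B"
  shows "(\<integral>u. g u \<partial>sphere_measure)
       = real CARD('n) * unit_ball_vol (real CARD('n)) * (\<integral>y. g (sgn y) \<partial>unif_ball)"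
proof -
  let ?c = "real CARD('n) * unit_ball_vol (real CARD('n))"
  interpret U: prob_space "unif_ball :: (real^'n) measure" by (rule prob_space_unif_ball)
  have c: "?c \<ge> 0" by (simp add: unit_ball_vol_nonneg)
  have intU: "integrable unif_ball (\<lambda>y. g (sgn y))"
    by (rule U.integrable_const_bound[where B=B]) (use B in auto)
  have intS: "integrable sphere_measure g"
  proof (rule integrableI_bounded)
    show "g \<in> borel_measurable sphere_measure" by (rule measurable_sphere_measure[OF assms(1)])
    have "(\<integral>\<^sup>+y. ennreal (norm (g (sgn y))) \<partial>unif_ball) < \<infinity>"
      using intU by (simp add: integrable_iff_bounded)
    thus "(\<integral>\<^sup>+u. ennreal (norm (g u)) \<partial>sphere_measure) < \<infinity>"
      by (subst nn_integral_sphere_measure) (auto simp: ennreal_mult_less_top)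
  qed
  have "(\<integral>u. g u \<partial>sphere_measure) = enn2real (ennreal ?c * (\<integral>\<^sup>+y. ennreal (g (sgn y)) \<partial>unif_ball))
      - enn2real (ennreal ?c * (\<integral>\<^sup>+y. ennreal (- g (sgn y)) \<partial>unif_ball))"
    by (simp add: real_lebesgue_integral_def[OF intS] nn_integral_sphere_measure)
  also have "\<dots> = ?c * (\<integral>y. g (sgn y) \<partial>unif_ball)"
    using c by (simp add: real_lebesgue_integral_def[OF intU] enn2real_mult right_diff_distrib)
  finally show ?thesis .
qed

section \<open>The curvature measure as an image under the Gauss map\<close>

context wulff begin

text \<open>On regular directions this is the integrand defining the curvature measure; the value 0
  elsewhere makes it Borel for continuous \<open>h\<close>.\<close>

definition curvature_density :: "real \<Rightarrow> nat \<Rightarrow> real^'n \<Rightarrow> real" where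
  "curvature_density p m u = (if u \<in> regular then (u \<bullet> gauss u) powr (- p) * rad u powr (real m - p)
     * ((real m * unit_ball_vol (real m)) / (real CARD('n) * unit_ball_vol (real CARD('n)))
        * (\<integral>B. svol m B ^ (CARD('n) - 1) \<partial>random_extension (m - 1) (dyad u))) else 0)"

lemma svol_power_kernel_measurable [measurable]:
  "(\<lambda>u. \<integral>B. svol m B ^ j \<partial>random_extension k (dyad u)) \<in> borel_measurable borel"
proof -
  have 1: "(\<lambda>M. \<integral>B. svol m B ^ j \<partial>M) \<in> borel_measurable (subprob_algebra borel)"
    by (rule integral_measurable_subprob_algebra) measurable
  have 2: "(\<lambda>u. random_extension k (dyad u)) \<in> borel \<rightarrow>\<^sub>M subprob_algebra (borel :: (real^'n^'n) measure)"
    by (rule measurable_compose[OF _ random_extension_subprob]) measurable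
  show ?thesis by (rule measurable_compose[OF 2 1])
qed

lemma svol_power_integral_bounds:
  "0 \<le> (\<integral>B. svol m B ^ j \<partial>random_extension k A)"
  "(\<integral>B. svol m B ^ j \<partial>random_extension k A) \<le> (unit_ball_vol (real m) * R ^ m) ^ j"
proof -
  interpret P: prob_space "random_extension k A" by (rule prob_space_random_extension)
  show "0 \<le> (\<integral>B. svol m B ^ j \<partial>random_extension k A)"
    by (intro integral_nonneg_AE AE_I2) (simp add: svol_bounds)
  have "integrable (random_extension k A) (\<lambda>B. svol m B ^ j)"
    by (rule P.integrable_const_bound[where B="(unit_ball_vol (real m) * R ^ m) ^ j"])
      (auto intro!: AE_I2 power_mono svol_bounds simp: svol_bounds(1) abs_of_nonneg)
  hence "(\<integral>B. svol m B ^ j \<partial>random_extension k A) \<le> (\<integral>B. (unit_ball_vol (real m) * R ^ m) ^ j \<partial>random_extension k A)"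
    by (intro Bochner_Integration.integral_mono) (auto intro!: power_mono svol_bounds)
  thus "(\<integral>B. svol m B ^ j \<partial>random_extension k A) \<le> (unit_ball_vol (real m) * R ^ m) ^ j"
    using P.prob_space by simp
qed

lemma curvature_density_measurable:
  assumes "continuous_on (sphere 0 1) h"
  shows "curvature_density p m \<in> borel_measurable borel"
proof -
  note [measurable] = gauss_measurable[OF assms]
  show ?thesis unfolding curvature_density_def[abs_def] by measurable
qed

text \<open>The ball of radius \<open>r\<close> inside \<open>K\<close> keeps supporting hyperplanes
  at distance at least \<open>r\<close> from the origin, while the boundary point has norm at most
  \<open>R\<close>. So the negative power of the cosine stays bounded.\<close>

lemma regular_inner_ge:
  assumes cont: "continuous_on (sphere 0 1) h" and u: "u \<in> regular"
  shows "r / R \<le> u \<bullet> gauss u" "u \<bullet> gauss u \<le> 1"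
proof -
  have n: "norm u = 1" using u unfolding regular_def by blast
  have "r \<le> \<rho> u * (u \<bullet> gauss u)"
    using outer_normal_inner_ge[of "gauss u" "\<rho> u *\<^sub>R u"] gauss_regular(4)[OF cont u] by simp
  also have "\<dots> \<le> R * (u \<bullet> gauss u)"
    using radial(2)[OF n] gauss_regular(3)[OF cont u] by (intro mult_right_mono) auto
  finally show "r / R \<le> u \<bullet> gauss u" using r r_le_R by (simp add: pos_divide_le_eq mult.commute)
  show "u \<bullet> gauss u \<le> 1" using norm_cauchy_schwarz[of u "gauss u"] n gauss_norm[OF cont] by simp
qed

text \<open>The exponent \<open>m - p\<close> may have either sign; the sum covers both
  cases.\<close>

lemma rad_powr_le: "rad u powr s \<le> r powr s + R powr s"
proof (cases "s \<ge> 0")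
  case True
  have "rad u powr s \<le> R powr s" using rad_bounds[of u] True by (intro powr_mono2) auto
  thus ?thesis by (simp add: add_increasing)
next
  case False
  have "rad u powr s \<le> r powr s" using rad_bounds[of u] False r by (intro powr_mono2') auto
  thus ?thesis by (simp add: add_increasing2)
qed

lemma inner_powr_le:
  assumes "continuous_on (sphere 0 1) h" "u \<in> regular" "p > 0"
  shows "(u \<bullet> gauss u) powr (- p) \<le> (r / R) powr (- p)"
  using regular_inner_ge[OF assms(1,2)] assms(3) r r_le_R by (intro powr_mono2') auto

lemma curvature_density_bounds:
  assumes cont: "continuous_on (sphere 0 1) h" and p: "p > 0"
  obtains B where "\<And>u. 0 \<le> curvature_density p m u" "\<And>u. curvature_density p m u \<le> B"
proof
  let ?c = "(real m * unit_ball_vol (real m)) / (real CARD('n) * unit_ball_vol (real CARD('n)))"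
  let ?V = "(unit_ball_vol (real m) * R ^ m) ^ (CARD('n) - 1)"
  have c: "?c \<ge> 0" by (simp add: unit_ball_vol_nonneg)
  have R: "R \<ge> 0" using r r_le_R by simp
  show "0 \<le> curvature_density p m u" for u
    unfolding curvature_density_def using c svol_power_integral_bounds(1) by simp
  show "curvature_density p m u \<le> (r / R) powr (- p) * (r powr (real m - p) + R powr (real m - p)) * (?c * ?V)" for u
  proof (cases "u \<in> regular")
    case True
    show ?thesis unfolding curvature_density_def if_P[OF True]
      by (intro mult_mono inner_powr_le[OF cont True p] rad_powr_le svol_power_integral_bounds mult_nonneg_nonneg add_nonneg_nonneg c) auto
  next
    case False
    thus ?thesis using c R by (auto simp: curvature_density_def unit_ball_vol_nonneg intro!: mult_nonneg_nonneg)
  qed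
qed

lemma AE_sphere_regular: "AE u in sphere_measure. u \<in> regular"
proof -
  let ?F = "\<lambda>u. indicator (- regular) u :: ennreal"
  have "(\<integral>\<^sup>+y. ?F (sgn y) \<partial>unif_ball) = (\<integral>\<^sup>+y. 0 \<partial>(unif_ball :: (real^'n) measure))"
    by (rule nn_integral_cong_AE) (use AE_regular in \<open>eventually_elim, simp\<close>)
  hence "(\<integral>\<^sup>+u. ?F u \<partial>sphere_measure) = 0" by (simp add: nn_integral_sphere_measure)
  moreover have "?F \<in> borel_measurable sphere_measure"
    by (rule measurable_sphere_measure) measurable
  ultimately have "AE u in sphere_measure. ?F u = 0" by (simp add: nn_integral_0_iff_AE)
  thus ?thesis by eventually_elim (simp add: indicator_def split: if_splits)
qed

text \<open>\<open>measure_of\<close> returns the given set function only if that is a measure;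
  recognising it as an image of a density settles this. For regular \<open>u\<close>, membership in
  the reverse radial Gauss image of \<open>\<eta>\<close> just means that \<open>gauss u\<close>
  lies in \<open>\<eta>\<close>.\<close>

lemma affine_dual_curvature_eq:
  assumes cont: "continuous_on (sphere 0 1) h" and m: "1 \<le> m" "m \<le> CARD('n)"
  shows "affine_dual_curvature p m K
    = distr (density sphere_measure (\<lambda>u. ennreal (curvature_density p m u))) sphere_borel gauss" (is "_ = ?M")
proof -
  let ?\<mu> = "\<lambda>\<eta>. set_nn_integral sphere_lebesgue (reverse_radial_gauss_image K \<eta>)
          (\<lambda>u. ennreal (
              (u \<bullet> outer_unit_normal K (radial_fun K u *\<^sub>R u)) powr (- p)
            * radial_fun K u powr (real m - p)
            * dual_radon m (\<lambda>\<xi>. section_vol K \<xi> ^ (CARD('n) - 1)) u))"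
  have g: "gauss \<in> sphere_borel \<rightarrow>\<^sub>M sphere_borel"
    unfolding sphere_borel_def using gauss_measurable[OF cont] gauss_norm[OF cont]
    by (intro measurable_restrict_space2 measurable_restrict_space1) (auto simp: space_restrict_space)
  hence g': "gauss \<in> density sphere_measure (\<lambda>u. ennreal (curvature_density p m u)) \<rightarrow>\<^sub>M sphere_borel"
    by (rule measurable_density_sphere_measure)
  have d: "(\<lambda>u. ennreal (curvature_density p m u)) \<in> borel_measurable sphere_measure"
    by (rule measurable_compose[OF measurable_sphere_measure[OF curvature_density_measurable[OF cont]]]) measurable
  have eq: "?\<mu> \<eta> = emeasure ?M \<eta>" if \<eta>: "\<eta> \<in> sets sphere_borel" for \<eta>
  proof -
    have "emeasure ?M \<eta> = (\<integral>\<^sup>+u. ennreal (curvature_density p m u) * indicator (gauss -` \<eta> \<inter> sphere 0 1) u \<partial>sphere_measure)"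
      using measurable_sets[OF g \<eta>] by (simp add: emeasure_distr[OF g' \<eta>] emeasure_density[OF d])
    also have "\<dots> = (\<integral>\<^sup>+u. ennreal (
              (u \<bullet> outer_unit_normal K (radial_fun K u *\<^sub>R u)) powr (- p)
            * radial_fun K u powr (real m - p)
            * dual_radon m (\<lambda>\<xi>. section_vol K \<xi> ^ (CARD('n) - 1)) u) * indicator (reverse_radial_gauss_image K \<eta>) u \<partial>sphere_measure)"
    proof (rule nn_integral_cong_AE)
      show "AE u in sphere_measure. ennreal (curvature_density p m u) * indicator (gauss -` \<eta> \<inter> sphere 0 1) u
        = ennreal ((u \<bullet> outer_unit_normal K (radial_fun K u *\<^sub>R u)) powr (- p)
            * radial_fun K u powr (real m - p)
            * dual_radon m (\<lambda>\<xi>. section_vol K \<xi> ^ (CARD('n) - 1)) u) * indicator (reverse_radial_gauss_image K \<eta>) u"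
        using AE_sphere_regular
      proof eventually_elim
        case (elim u)
        have n: "norm u = 1" using elim unfolding regular_def by blast
        have "u \<in> reverse_radial_gauss_image K \<eta> \<longleftrightarrow> u \<in> gauss -` \<eta> \<inter> sphere 0 1"
        proof -
          have "u \<in> reverse_radial_gauss_image K \<eta> \<longleftrightarrow> (\<exists>v\<in>\<eta>. v \<in> outer_unit_normals K (\<rho> u *\<^sub>R u))"
            by (simp add: reverse_radial_gauss_image_def n)
          thus ?thesis unfolding gauss_regular(4)[OF cont elim] using n by simp
        qed
        hence i: "indicator (reverse_radial_gauss_image K \<eta>) u = (indicator (gauss -` \<eta> \<inter> sphere 0 1) u :: ennreal)"
          by (simp only: indicator_def)
        have "curvature_density p m u = (u \<bullet> outer_unit_normal K (radial_fun K u *\<^sub>R u)) powr (- p)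
            * radial_fun K u powr (real m - p)
            * dual_radon m (\<lambda>\<xi>. section_vol K \<xi> ^ (CARD('n) - 1)) u"
          unfolding dual_radon_svol[OF n m] curvature_density_def if_P[OF elim]
          using elim n by (simp add: gauss_def rad_def)
        thus ?case by (simp only: i)
      qed
    qed
    also have "\<dots> = ?\<mu> \<eta>" by (simp add: sphere_lebesgue_eq nn_integral_completion)
    finally show ?thesis ..
  qed
  have "affine_dual_curvature p m K = measure_of (sphere 0 1) (sets sphere_borel) ?\<mu>"
    by (simp only: affine_dual_curvature_def sphere_borel_def)
  also have "\<dots> = measure_of (sphere 0 1) (sets sphere_borel) (emeasure ?M)"
  proof (rule measure_of_eq)
    show "sets sphere_borel \<subseteq> Pow (sphere (0::real^'n) 1)" using sets.space_closed[of sphere_borel] by simp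
    show "?\<mu> \<eta> = emeasure ?M \<eta>" if "\<eta> \<in> sigma_sets (sphere 0 1) (sets sphere_borel)" for \<eta>
      by (rule eq) (use that sets.sigma_sets_eq[of "sphere_borel :: (real^'n) measure"] in simp)
  qed
  also have "\<dots> = ?M"
    using measure_of_of_measure[of ?M] by simp
  finally show ?thesis .
qed

lemma integral_affine_dual_curvature:
  assumes cont: "continuous_on (sphere 0 1) h" and m: "1 \<le> m" "m \<le> CARD('n)" and p: "p > 0"
    and f: "continuous_on (sphere 0 1) f"
  shows "(\<integral>u. f u \<partial>affine_dual_curvature p m K) = real CARD('n) * unit_ball_vol (real CARD('n))
      * (\<integral>y. curvature_density p m (sgn y) * f (gauss (sgn y)) \<partial>unif_ball)"
proof -
  have gm: "gauss \<in> borel \<rightarrow>\<^sub>M sphere_borel"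
    unfolding sphere_borel_def using gauss_measurable[OF cont] gauss_norm[OF cont]
    by (intro measurable_restrict_space2) auto
  have g': "gauss \<in> density sphere_measure (\<lambda>u. ennreal (curvature_density p m u)) \<rightarrow>\<^sub>M sphere_borel"
    by (rule measurable_density_sphere_measure[OF measurable_sphere_borel[OF gm]])
  have fm: "f \<in> borel_measurable sphere_borel"
    unfolding sphere_borel_def by (rule borel_measurable_continuous_on_restrict[OF f])
  have fg: "(\<lambda>u. f (gauss u)) \<in> borel_measurable borel" by (rule measurable_compose[OF gm fm])
  note dm = curvature_density_measurable[OF cont, of p m]
  obtain B where B: "\<And>u. 0 \<le> curvature_density p m u" "\<And>u. curvature_density p m u \<le> B"
    using curvature_density_bounds[OF cont p] by blast
  obtain F where "\<forall>x\<in>f ` sphere 0 1. norm x \<le> F"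
    using compact_imp_bounded[OF compact_continuous_image[OF f compact_sphere]] unfolding bounded_iff by blast
  hence F: "\<And>v. v \<in> sphere 0 1 \<Longrightarrow> \<bar>f v\<bar> \<le> F" by simp
  have "(\<integral>u. f u \<partial>affine_dual_curvature p m K)
      = (\<integral>u. f (gauss u) \<partial>density sphere_measure (\<lambda>u. ennreal (curvature_density p m u)))"
    unfolding affine_dual_curvature_eq[OF cont m] by (rule integral_distr[OF g' fm])
  also have "\<dots> = (\<integral>u. curvature_density p m u *\<^sub>R f (gauss u) \<partial>sphere_measure)"
    by (rule integral_density) (use measurable_sphere_measure[OF fg] measurable_sphere_measure[OF dm] B(1) in simp_all)
  also have "\<dots> = (\<integral>u. curvature_density p m u * f (gauss u) \<partial>sphere_measure)" by simp
  also have "\<dots> = real CARD('n) * unit_ball_vol (real CARD('n))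
      * (\<integral>y. curvature_density p m (sgn y) * f (gauss (sgn y)) \<partial>unif_ball)"
  proof (rule integral_sphere_measure)
    show "(\<lambda>u. curvature_density p m u * f (gauss u)) \<in> borel_measurable borel"
      by (intro borel_measurable_times dm fg)
    show "\<bar>curvature_density p m u * f (gauss u)\<bar> \<le> B * F" for u
    proof -
      have "gauss u \<in> sphere 0 1" using gauss_norm[OF cont] by simp
      hence "\<bar>curvature_density p m u\<bar> * \<bar>f (gauss u)\<bar> \<le> B * F"
        using B[of u] F by (intro mult_mono) auto
      thus ?thesis by (simp add: abs_mult)
    qed
  qed
  finally show ?thesis .
qed

end

subsection \<open>The variational formula\<close>

lemma integral_flag:
  fixes g :: "real^'n \<Rightarrow> real^'n^'n \<Rightarrow> real"
  assumes k: "Suc k \<le> CARD('n)" and g: "(\<lambda>(u, A). g u A) \<in> borel_measurable (borel \<Otimes>\<^sub>M borel)"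
    and B: "\<And>u A. \<bar>g u A\<bar> \<le> B"
  shows "(\<integral>A. \<integral>x. g (sgn (A *v x)) A \<partial>unif_ball \<partial>random_extension (Suc k) 0)
       = (\<integral>y. \<integral>B. g (sgn y) B \<partial>random_extension k (dyad y) \<partial>unif_ball)"
proof -
  let ?R = "random_extension (Suc k) (0 :: real^'n^'n)" and ?g = "\<lambda>(u, A). g u A"
  interpret U: prob_space "unif_ball :: (real^'n) measure" by (rule prob_space_unif_ball)
  interpret R: prob_space ?R by (rule prob_space_random_extension)
  interpret P: pair_prob_space ?R "unif_ball :: (real^'n) measure" ..
  have g': "?g \<in> borel_measurable borel" using g by (simp add: borel_prod)
  note m1 = flag_law1_map_measurable[of "Suc k"]
  have int: "integrable (?R \<Otimes>\<^sub>M unif_ball) (\<lambda>z. ?g (case z of (A, x) \<Rightarrow> (sgn (A *v x), A)))"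
    by (rule P.integrable_const_bound[where B=B]) (use B measurable_compose[OF m1 g'] in \<open>auto simp: case_prod_unfold\<close>)
  have "(\<integral>A. \<integral>x. g (sgn (A *v x)) A \<partial>unif_ball \<partial>?R) = (\<integral>z. ?g (case z of (A, x) \<Rightarrow> (sgn (A *v x), A)) \<partial>(?R \<Otimes>\<^sub>M unif_ball))"
    using P.integral_fst'[OF int] by simp
  also have "\<dots> = (\<integral>z. ?g z \<partial>flag_law1 (Suc k))"
    unfolding flag_law1_def by (rule integral_distr[symmetric, OF m1 g'])
  also have "\<dots> = (\<integral>y. \<integral>z. ?g z \<partial>flag_kernel k y \<partial>unif_ball)"
    unfolding flag_laws_eq[OF k]
  proof (rule integral_bind[OF g' _ flag_kernel_subprob, where B=B and B'=1])
    show "finite_measure (unif_ball :: (real^'n) measure)" by unfold_locales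
    have "prob_space (flag_kernel k y)" for y :: "real^'n"
      using measurable_space[OF flag_kernel_measurable, of y k] by (simp add: space_prob_algebra)
    thus "AE y in unif_ball. emeasure (flag_kernel k y) (space (flag_kernel k (y :: real^'n))) \<le> ennreal 1"
      by (simp add: prob_space.emeasure_space_1)
  qed (use B in auto)
  also have "\<dots> = (\<integral>y. \<integral>B. g (sgn y) B \<partial>random_extension k (dyad y) \<partial>unif_ball)"
  proof (rule Bochner_Integration.integral_cong[OF refl])
    fix y :: "real^'n"
    have m: "(\<lambda>B. (sgn y, B)) \<in> random_extension k (dyad y) \<rightarrow>\<^sub>M borel"
      by (rule measurable_flag_Pair1) simp
    show "(\<integral>z. ?g z \<partial>flag_kernel k y) = (\<integral>B. g (sgn y) B \<partial>random_extension k (dyad y))"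
      unfolding flag_kernel_def by (subst integral_distr[OF m g']) simp
  qed
  finally show ?thesis .
qed

text \<open>The exchange of order, applied to the indicator of the complement: a null set of
  directions is null within almost every plane.\<close>

lemma AE_flag:
  fixes N :: "(real^'n) set"
  assumes k: "Suc k \<le> CARD('n)" and N[measurable]: "N \<in> sets borel" and ae: "AE y in unif_ball. sgn y \<in> N"
  shows "AE A in random_extension (Suc k) (0 :: real^'n^'n). AE x in unif_ball. sgn (A *v x) \<in> N"
proof -
  let ?R = "random_extension (Suc k) (0 :: real^'n^'n)"
  interpret U: prob_space "unif_ball :: (real^'n) measure" by (rule prob_space_unif_ball)
  have "(\<integral>\<^sup>+A. \<integral>\<^sup>+x. indicator (- N) (sgn (A *v x)) \<partial>unif_ball \<partial>?R)
      = (\<integral>\<^sup>+y. \<integral>\<^sup>+B. indicator (- N) (sgn y) \<partial>random_extension k (dyad y) \<partial>unif_ball)"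
    by (rule nn_integral_flag[OF k, of "\<lambda>u A. indicator (- N) u"]) measurable
  also have "\<dots> = (\<integral>\<^sup>+y. 0 \<partial>(unif_ball :: (real^'n) measure))"
    by (rule nn_integral_cong_AE) (use ae in \<open>eventually_elim, simp\<close>)
  finally have 0: "(\<integral>\<^sup>+A. \<integral>\<^sup>+x. indicator (- N) (sgn (A *v x)) \<partial>(unif_ball :: (real^'n) measure) \<partial>?R) = 0" by simp
  have "(\<lambda>A. \<integral>\<^sup>+x. indicator (- N) (sgn (A *v x)) \<partial>(unif_ball :: (real^'n) measure)) \<in> borel_measurable ?R"
    by measurable
  from nn_integral_0_iff_AE[OF this] 0
  have "AE A in ?R. (\<integral>\<^sup>+x. indicator (- N) (sgn (A *v x)) \<partial>(unif_ball :: (real^'n) measure)) = 0" by blast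
  thus ?thesis
  proof eventually_elim
    case (elim A)
    hence "AE x in unif_ball. indicator (- N) (sgn (A *v x)) = (0::ennreal)"
      by (subst (asm) nn_integral_0_iff_AE) simp_all
    thus ?case by eventually_elim (simp add: indicator_def split: if_splits)
  qed
qed

lemma abs_power_diff_le:
  fixes x y :: real
  assumes "0 \<le> x" "x \<le> M" "0 \<le> y" "y \<le> M"
  shows "\<bar>x ^ n - y ^ n\<bar> \<le> \<bar>x - y\<bar> * (real n * M ^ (n - 1))"
proof -
  have "\<bar>\<Sum>i<n. y ^ (n - Suc i) * x ^ i\<bar> \<le> (\<Sum>i<n. M ^ (n - 1))"
  proof (rule order_trans[OF sum_abs sum_mono])
    fix i assume i: "i \<in> {..<n}"
    have "\<bar>y ^ (n - Suc i) * x ^ i\<bar> = y ^ (n - Suc i) * x ^ i" using assms by simp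
    also have "\<dots> \<le> M ^ (n - Suc i) * M ^ i" using assms by (intro mult_mono power_mono) auto
    also have "\<dots> = M ^ (n - 1)" using i by (simp flip: power_add)
    finally show "\<bar>y ^ (n - Suc i) * x ^ i\<bar> \<le> M ^ (n - 1)" .
  qed
  hence "\<bar>x - y\<bar> * \<bar>\<Sum>i<n. y ^ (n - Suc i) * x ^ i\<bar> \<le> \<bar>x - y\<bar> * (real n * M ^ (n - 1))"
    by (intro mult_left_mono) auto
  thus ?thesis unfolding power_diff_sumr2 by (simp add: abs_mult)
qed

lemma tendsto_power_quotient:
  fixes x X :: "nat \<Rightarrow> real"
  assumes q: "(\<lambda>i. (x i - y) / X i) \<longlonglongrightarrow> d" and X: "X \<longlonglongrightarrow> 0" "\<And>i. X i \<noteq> 0"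
  shows "(\<lambda>i. (x i ^ n - y ^ n) / X i) \<longlonglongrightarrow> real n * y ^ (n - 1) * d"
proof -
  have "(\<lambda>i. (x i - y) / X i * X i + y) \<longlonglongrightarrow> d * 0 + y" by (intro tendsto_intros q X)
  hence x: "x \<longlonglongrightarrow> y" using X(2) by simp
  have "(\<lambda>i. (x i - y) / X i * (\<Sum>j<n. y ^ (n - Suc j) * x i ^ j)) \<longlonglongrightarrow> d * (\<Sum>j<n. y ^ (n - Suc j) * y ^ j)"
    by (intro tendsto_intros q x)
  moreover have "(\<Sum>j<n. y ^ (n - Suc j) * y ^ j) = (\<Sum>j<n. y ^ (n - 1))"
    by (rule sum.cong) (simp_all flip: power_add)
  ultimately show ?thesis by (simp add: power_diff_sumr2 mult_ac)
qed

section \<open>Differentiation under the integrals\<close>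

context wulff_variation begin

definition svolt :: "real \<Rightarrow> nat \<Rightarrow> real^'n^'n \<Rightarrow> real" where
  "svolt t = wulff.svol (h t) r"

lemma svolt_eq:
  assumes "\<bar>t\<bar> < \<tau>"
  shows "svolt t m A = unit_ball_vol (real m) * (\<integral>x. radt t (sgn (A *v x)) ^ m \<partial>unif_ball)"
  by (simp add: svolt_def radt_def wulff.svol_def[OF W[OF assms]])

lemma svolt_0: "svolt 0 = W0.svol"
  by (simp add: svolt_def)

lemma svolt_measurable: "\<bar>t\<bar> < \<tau> \<Longrightarrow> svolt t m \<in> borel_measurable borel"
  unfolding svolt_def by (rule wulff.svol_measurable[OF W])

lemma svolt_bounds: "\<bar>t\<bar> < \<tau> \<Longrightarrow> 0 \<le> svolt t m A" "\<bar>t\<bar> < \<tau> \<Longrightarrow> svolt t m A \<le> unit_ball_vol (real m) * R ^ m"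
  unfolding svolt_def using wulff.svol_bounds[OF W] by blast+

lemma dual_quermass_svolt:
  assumes "\<bar>t\<bar> < \<tau>" "1 \<le> m" "m \<le> CARD('n)"
  shows "dual_quermass m (wulff_shape (h t)) = (\<integral>A. svolt t m A ^ CARD('n) \<partial>random_extension m 0)"
  using wulff.dual_quermass_svol[OF W[OF assms(1)] assms(2,3)] by (simp add: svolt_def)

text \<open>The derivative at \<open>t = 0\<close> of the m-th power of the radial function on
  regular directions, extended by 0.\<close>

definition radial_variation :: "nat \<Rightarrow> real^'n \<Rightarrow> real" where
  "radial_variation m u = (if u \<in> W0.regular then
     real m / p * (W0.rad u powr (real m - p) * (f (W0.gauss u) * (u \<bullet> W0.gauss u) powr (- p))) else 0)"

lemma f_gauss_measurable: "(\<lambda>u. f (W0.gauss u)) \<in> borel_measurable borel"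
proof -
  have "W0.gauss \<in> borel \<rightarrow>\<^sub>M sphere_borel"
    unfolding sphere_borel_def using W0.gauss_measurable[OF h0_cont] W0.gauss_norm[OF h0_cont]
    by (intro measurable_restrict_space2) auto
  moreover have "f \<in> borel_measurable sphere_borel"
    unfolding sphere_borel_def by (rule borel_measurable_continuous_on_restrict[OF f_cont])
  ultimately show ?thesis by (rule measurable_compose)
qed

lemma radial_variation_measurable [measurable]: "radial_variation m \<in> borel_measurable borel"
proof -
  note [measurable] = f_gauss_measurable W0.gauss_measurable[OF h0_cont]
  show ?thesis unfolding radial_variation_def[abs_def] by measurable
qed

lemma radial_variation_bounded:
  obtains B where "\<And>u. \<bar>radial_variation m u\<bar> \<le> B"
proof -
  obtain F where "\<forall>x\<in>f ` sphere 0 1. norm x \<le> F"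
    using compact_imp_bounded[OF compact_continuous_image[OF f_cont compact_sphere]] unfolding bounded_iff by blast
  hence F: "\<bar>f v\<bar> \<le> F" if "norm v = 1" for v using that by simp
  have F0: "0 \<le> F" using F[OF W0.gauss_norm[OF h0_cont, of 0]] by linarith
  let ?P = "r powr (real m - p) + R powr (real m - p)" and ?Q = "(r / R) powr (- p)"
  have "\<bar>radial_variation m u\<bar> \<le> real m / p * (?P * (F * ?Q))" for u
  proof (cases "u \<in> W0.regular")
    case True
    have "\<bar>radial_variation m u\<bar> = real m / p * (W0.rad u powr (real m - p) * (\<bar>f (W0.gauss u)\<bar> * (u \<bullet> W0.gauss u) powr (- p)))"
      using True p by (simp add: radial_variation_def abs_mult)
    also have "\<dots> \<le> real m / p * (?P * (F * ?Q))"
      using F[OF W0.gauss_norm[OF h0_cont, of u]] W0.inner_powr_le[OF h0_cont True p] W0.rad_powr_le[of u "real m - p"] p F0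
      by (intro mult_left_mono mult_mono) auto
    finally show ?thesis .
  next
    case False
    thus ?thesis using F0 p by (auto simp: radial_variation_def intro!: mult_nonneg_nonneg)
  qed
  thus thesis using that by blast
qed

lemma radt_power_sequence:
  assumes u: "u \<in> W0.regular" and X: "X \<longlonglongrightarrow> 0" "\<And>i. X i \<noteq> 0"
  shows "(\<lambda>i. (radt (X i) u ^ m - radt 0 u ^ m) / X i) \<longlonglongrightarrow> radial_variation m u"
proof -
  have n: "norm u = 1" using u unfolding W0.regular_def by blast
  note G = W0.gauss_regular[OF h0_cont u]
  have "((\<lambda>t. (radt t u ^ m - radt 0 u ^ m) / t) \<longlongrightarrow> radial_variation m u) (at 0)"
    using radt_power_derivative[OF n G(2) G(5), of m] u by (simp add: radial_variation_def radt_0)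
  moreover have "filterlim X (at 0) sequentially" using X by (simp add: filterlim_at)
  ultimately show ?thesis by (rule filterlim_compose)
qed

text \<open>The bound holds for every matrix and so dominates the next integral as well; the limit
  is claimed only if almost all directions in the plane are regular.\<close>

lemma svolt_sequence:
  assumes X: "X \<longlonglongrightarrow> 0" "\<And>i. X i \<noteq> 0" "\<And>i. \<bar>X i\<bar> < \<tau>"
    and C: "\<And>t u. \<bar>t\<bar> < \<tau> \<Longrightarrow> \<bar>radt t u ^ m - radt 0 u ^ m\<bar> \<le> C * \<bar>t\<bar>"
  shows "\<bar>(svolt (X i) m A - svolt 0 m A) / X i\<bar> \<le> unit_ball_vol (real m) * C"
    and "AE x in unif_ball. sgn (A *v x) \<in> W0.regular \<Longrightarrow>
      (\<lambda>i. (svolt (X i) m A - svolt 0 m A) / X i) \<longlonglongrightarrow> unit_ball_vol (real m) * (\<integral>x. radial_variation m (sgn (A *v x)) \<partial>unif_ball)"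
proof -
  interpret U: prob_space "unif_ball :: (real^'n) measure" by (rule prob_space_unif_ball)
  have t0: "\<bar>0\<bar> < \<tau>" using \<tau> by simp
  define s where "s = (\<lambda>i x. (radt (X i) (sgn (A *v x)) ^ m - radt 0 (sgn (A *v x)) ^ m) / X i)"
  note [measurable] = radt_measurable[OF X(3)] radt_measurable[OF t0]
  have sm: "s i \<in> borel_measurable unif_ball" for i unfolding s_def by measurable
  have sb: "\<bar>s i x\<bar> \<le> C" for i x
    using C[OF X(3), of i "sgn (A *v x)"] X(2)[of i] by (simp add: s_def abs_divide pos_divide_le_eq)
  have int: "integrable unif_ball (\<lambda>x. radt t (sgn (A *v x)) ^ m)" if "\<bar>t\<bar> < \<tau>" for t
    unfolding radt_def by (rule wulff.rad_power_integrable[OF W[OF that]])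
  have eq: "(svolt (X i) m A - svolt 0 m A) / X i = unit_ball_vol (real m) * (\<integral>x. s i x \<partial>unif_ball)" for i
    unfolding svolt_eq[OF X(3)] svolt_eq[OF t0] s_def
    using int[OF X(3)] int[OF t0] by (simp add: Bochner_Integration.integral_diff right_diff_distrib[symmetric])
  have "\<bar>\<integral>x. s i x \<partial>unif_ball\<bar> \<le> C" for i
  proof -
    have si: "integrable unif_ball (s i)"
      by (rule U.integrable_const_bound[where B=C]) (use sb sm in auto)
    have "\<bar>\<integral>x. s i x \<partial>unif_ball\<bar> \<le> (\<integral>x. \<bar>s i x\<bar> \<partial>unif_ball)" by (rule integral_abs_bound)
    also have "\<dots> \<le> (\<integral>x. C \<partial>(unif_ball :: (real^'n) measure))"
      by (intro Bochner_Integration.integral_mono integrable_abs si) (use sb in auto)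
    also have "\<dots> = C" using U.prob_space by simp
    finally show ?thesis .
  qed
  thus "\<bar>(svolt (X i) m A - svolt 0 m A) / X i\<bar> \<le> unit_ball_vol (real m) * C"
    unfolding eq by (simp add: abs_mult unit_ball_vol_nonneg mult_left_mono)
  assume ae: "AE x in unif_ball. sgn (A *v x) \<in> W0.regular"
  have "(\<lambda>i. \<integral>x. s i x \<partial>unif_ball) \<longlonglongrightarrow> (\<integral>x. radial_variation m (sgn (A *v x)) \<partial>unif_ball)"
  proof (rule integral_dominated_convergence[where w="\<lambda>_. C"])
    show "AE x in unif_ball. (\<lambda>i. s i x) \<longlonglongrightarrow> radial_variation m (sgn (A *v x))"
      using ae unfolding s_def by eventually_elim (rule radt_power_sequence[OF _ X(1,2)])
  qed (use sb sm in auto)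
  thus "(\<lambda>i. (svolt (X i) m A - svolt 0 m A) / X i) \<longlonglongrightarrow> unit_ball_vol (real m) * (\<integral>x. radial_variation m (sgn (A *v x)) \<partial>unif_ball)"
    unfolding eq by (intro tendsto_mult tendsto_const)
qed

text \<open>Stated along sequences, for which dominated convergence is available; it is applied once
  more, now over planes.\<close>

lemma dual_quermass_sequence:
  assumes m: "1 \<le> m" "m \<le> CARD('n)"
    and X: "X \<longlonglongrightarrow> 0" "\<And>i. X i \<noteq> 0" "\<And>i. \<bar>X i\<bar> < \<tau>"
  shows "(\<lambda>i. (dual_quermass m (wulff_shape (h (X i))) - dual_quermass m (wulff_shape (h 0))) / X i)
    \<longlonglongrightarrow> (\<integral>A. real CARD('n) * W0.svol m A ^ (CARD('n) - 1)
          * (unit_ball_vol (real m) * (\<integral>x. radial_variation m (sgn (A *v x)) \<partial>unif_ball)) \<partial>random_extension m 0)"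
proof -
  let ?n = "CARD('n)" and ?R = "random_extension m (0 :: real^'n^'n)"
  let ?M = "unit_ball_vol (real m) * R ^ m"
  interpret U: prob_space "unif_ball :: (real^'n) measure" by (rule prob_space_unif_ball)
  interpret P: prob_space ?R by (rule prob_space_random_extension)
  have t0: "\<bar>0\<bar> < \<tau>" using \<tau> by simp
  obtain C where C: "C \<ge> 0" "\<And>t u. \<bar>t\<bar> < \<tau> \<Longrightarrow> \<bar>radt t u ^ m - radt 0 u ^ m\<bar> \<le> C * \<bar>t\<bar>"
    using radt_power_lipschitz by blast
  have R: "R \<ge> 0" using W0.r W0.r_le_R by simp
  note [measurable] = svolt_measurable[OF X(3)] svolt_measurable[OF t0]
  define Q where "Q = (\<lambda>i A. (svolt (X i) m A ^ ?n - svolt 0 m A ^ ?n) / X i)"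
  have int: "integrable ?R (\<lambda>A. svolt t m A ^ ?n)" if t: "\<bar>t\<bar> < \<tau>" for t
  proof (rule P.integrable_const_bound[where B="?M ^ ?n"])
    show "AE A in ?R. norm (svolt t m A ^ ?n) \<le> ?M ^ ?n"
      using svolt_bounds[OF t] by (auto intro!: AE_I2 power_mono)
    show "(\<lambda>A. svolt t m A ^ ?n) \<in> borel_measurable ?R" using svolt_measurable[OF t] by measurable
  qed
  have eq: "(dual_quermass m (wulff_shape (h (X i))) - dual_quermass m (wulff_shape (h 0))) / X i = (\<integral>A. Q i A \<partial>?R)" for i
    unfolding dual_quermass_svolt[OF X(3) m] dual_quermass_svolt[OF t0 m] Q_def
    using int[OF X(3)] int[OF t0] by (simp add: Bochner_Integration.integral_diff)
  have Qb: "\<bar>Q i A\<bar> \<le> unit_ball_vol (real m) * C * (real ?n * ?M ^ (?n - 1))" for i A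
  proof -
    have "\<bar>Q i A\<bar> = \<bar>svolt (X i) m A ^ ?n - svolt 0 m A ^ ?n\<bar> / \<bar>X i\<bar>" by (simp add: Q_def abs_divide)
    also have "\<dots> \<le> \<bar>svolt (X i) m A - svolt 0 m A\<bar> * (real ?n * ?M ^ (?n - 1)) / \<bar>X i\<bar>"
      by (intro divide_right_mono abs_power_diff_le svolt_bounds X(3) t0) auto
    also have "\<dots> = \<bar>(svolt (X i) m A - svolt 0 m A) / X i\<bar> * (real ?n * ?M ^ (?n - 1))"
      by (simp add: abs_divide)
    also have "\<dots> \<le> unit_ball_vol (real m) * C * (real ?n * ?M ^ (?n - 1))"
      using R by (intro mult_right_mono svolt_sequence(1)[OF X C(2)]) (auto simp: unit_ball_vol_nonneg)
    finally show ?thesis .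
  qed
  show ?thesis unfolding eq
  proof (rule integral_dominated_convergence[where w="\<lambda>_. unit_ball_vol (real m) * C * (real ?n * ?M ^ (?n - 1))"])
    obtain k where k: "m = Suc k" using m(1) by (cases m) auto
    have "AE A in ?R. AE x in unif_ball. sgn (A *v x) \<in> W0.regular"
      using AE_flag[OF _ W0.regular_borel W0.AE_regular, of k] m(2) unfolding k by simp
    thus "AE A in ?R. (\<lambda>i. Q i A) \<longlonglongrightarrow> real ?n * W0.svol m A ^ (?n - 1)
          * (unit_ball_vol (real m) * (\<integral>x. radial_variation m (sgn (A *v x)) \<partial>unif_ball))"
    proof eventually_elim
      case (elim A)
      show ?case unfolding Q_def svolt_0[symmetric]
        by (rule tendsto_power_quotient[OF svolt_sequence(2)[OF X C(2) elim] X(1,2)])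
    qed
    show "(\<lambda>A. real ?n * W0.svol m A ^ (?n - 1)
          * (unit_ball_vol (real m) * (\<integral>x. radial_variation m (sgn (A *v x)) \<partial>unif_ball))) \<in> borel_measurable ?R"
      by measurable
    show "Q i \<in> borel_measurable ?R" for i unfolding Q_def by measurable
  qed (use Qb in auto)
qed

text \<open>The factor \<open>svol\<close> does not depend on the direction, so it can be moved
  under the inner integral. After the exchange of order it is averaged over all planes through a
  fixed direction, which is the Radon transform up to normalisation.\<close>

lemma variation_integral:
  assumes m: "1 \<le> m" "m \<le> CARD('n)"
  shows "(\<integral>A. real CARD('n) * W0.svol m A ^ (CARD('n) - 1)
          * (unit_ball_vol (real m) * (\<integral>x. radial_variation m (sgn (A *v x)) \<partial>unif_ball)) \<partial>random_extension m 0)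
     = real CARD('n) / p * (\<integral>u. f u \<partial>affine_dual_curvature p m (wulff_shape (h 0)))"
proof -
  let ?n = "CARD('n)" and ?\<omega>m = "unit_ball_vol (real m)" and ?\<omega>n = "unit_ball_vol (real CARD('n))"
  let ?M = "?\<omega>m * R ^ m"
  obtain k where k: "m = Suc k" using m(1) by (cases m) auto
  obtain B where B: "\<And>u. \<bar>radial_variation m u\<bar> \<le> B" using radial_variation_bounded by blast
  have \<omega>: "?\<omega>m > 0" "?\<omega>n > 0" by (auto intro: unit_ball_vol_pos)
  have nz: "?\<omega>m \<noteq> 0" "?\<omega>n \<noteq> 0" using \<omega> by (metis less_irrefl)+
  have R: "R \<ge> 0" using W0.r W0.r_le_R by simp
  have "(\<integral>A. real ?n * W0.svol m A ^ (?n - 1)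
          * (?\<omega>m * (\<integral>x. radial_variation m (sgn (A *v x)) \<partial>unif_ball)) \<partial>random_extension m 0)
     = (\<integral>A. real ?n * ?\<omega>m * (\<integral>x. W0.svol m A ^ (?n - 1) * radial_variation m (sgn (A *v x)) \<partial>unif_ball) \<partial>random_extension m 0)"
    by (rule Bochner_Integration.integral_cong) (simp_all add: mult_ac)
  also have "\<dots> = real ?n * ?\<omega>m * (\<integral>A. \<integral>x. W0.svol m A ^ (?n - 1) * radial_variation m (sgn (A *v x)) \<partial>unif_ball \<partial>random_extension m 0)"
    by simp
  also have "(\<integral>A. \<integral>x. W0.svol m A ^ (?n - 1) * radial_variation m (sgn (A *v x)) \<partial>unif_ball \<partial>random_extension m 0)
     = (\<integral>y. \<integral>A. W0.svol m A ^ (?n - 1) * radial_variation m (sgn y) \<partial>random_extension k (dyad y) \<partial>unif_ball)"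
    unfolding k
  proof (rule integral_flag[where g="\<lambda>u A. W0.svol (Suc k) A ^ (?n - 1) * radial_variation (Suc k) u" and B="?M ^ (?n - 1) * B"])
    show "Suc k \<le> ?n" using m(2) k by simp
    show "(\<lambda>(u, A). W0.svol (Suc k) A ^ (?n - 1) * radial_variation (Suc k) u) \<in> borel_measurable (borel \<Otimes>\<^sub>M borel)"
      by measurable
    show "\<bar>W0.svol (Suc k) A ^ (?n - 1) * radial_variation (Suc k) u\<bar> \<le> ?M ^ (?n - 1) * B" for u A
      unfolding abs_mult using W0.svol_bounds[of "Suc k" A] B[of u] R \<omega>(1) unfolding k
      by (intro mult_mono) (auto simp: power_mono)
  qed
  \<comment> \<open>The second quotient undoes the normalisation of the Radon transform contained in
    \<open>curvature_density\<close>.\<close>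
  also have "\<dots> = (\<integral>y. real m / p * (real ?n * ?\<omega>n / (real m * ?\<omega>m)) * (W0.curvature_density p m (sgn y) * f (W0.gauss (sgn y))) \<partial>unif_ball)"
  proof (rule Bochner_Integration.integral_cong[OF refl])
    fix y :: "real^'n"
    show "(\<integral>A. W0.svol m A ^ (?n - 1) * radial_variation m (sgn y) \<partial>random_extension k (dyad y))
      = real m / p * (real ?n * ?\<omega>n / (real m * ?\<omega>m)) * (W0.curvature_density p m (sgn y) * f (W0.gauss (sgn y)))"
    proof -
      have "m - 1 = k" using k by simp
      thus ?thesis using nz m p by (simp add: radial_variation_def W0.curvature_density_def dyad_sgn)
    qed
  qed
  also have "\<dots> = real m / p * (real ?n * ?\<omega>n / (real m * ?\<omega>m)) * (\<integral>y. W0.curvature_density p m (sgn y) * f (W0.gauss (sgn y)) \<partial>unif_ball)"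
    by simp
  \<comment> \<open>\<open>m\<close> and \<open>\<omega>m\<close> cancel; the remaining
    \<open>n \<omega>n\<close> is the total mass of the sphere.\<close>
  also have "real ?n * ?\<omega>m * \<dots> = real ?n / p * (real ?n * ?\<omega>n * (\<integral>y. W0.curvature_density p m (sgn y) * f (W0.gauss (sgn y)) \<partial>unif_ball))"
    using nz m by (simp add: field_simps)
  also have "\<dots> = real ?n / p * (\<integral>u. f u \<partial>affine_dual_curvature p m (wulff_shape (h 0)))"
    by (simp only: W0.integral_affine_dual_curvature[OF h0_cont m p f_cont])
  finally show ?thesis .
qed

lemma dual_quermass_variation:
  assumes m: "1 \<le> m" "m \<le> CARD('n)"
  shows "((\<lambda>t. (dual_quermass m (wulff_shape (h t)) - dual_quermass m (wulff_shape (h 0))) / t)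
           \<longlongrightarrow> real CARD('n) / p * (\<integral>u. f u \<partial>affine_dual_curvature p m (wulff_shape (h 0)))) (at 0)"
proof -
  let ?q = "\<lambda>t. (dual_quermass m (wulff_shape (h t)) - dual_quermass m (wulff_shape (h 0))) / t"
  \<comment> \<open>Passing to the open interval confines every test sequence to the range where the
    uniform bounds hold.\<close>
  have at: "at 0 within {-\<tau><..<\<tau>} = at (0::real)"
    using \<tau> by (intro at_within_open) auto
  show ?thesis
    unfolding at[symmetric] tendsto_at_iff_sequentially
  proof (intro allI impI)
    fix X :: "nat \<Rightarrow> real" assume X: "\<forall>i. X i \<in> {-\<tau><..<\<tau>} - {0}" "X \<longlonglongrightarrow> 0"
    have "\<bar>X i\<bar> < \<tau>" "X i \<noteq> 0" for i using X(1)[rule_format, of i] by auto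
    from dual_quermass_sequence[OF m X(2) this(2,1), unfolded variation_integral[OF m]]
    show "(?q \<circ> X) \<longlonglongrightarrow> real CARD('n) / p * (\<integral>u. f u \<partial>affine_dual_curvature p m (wulff_shape (h 0)))"
      by (simp only: comp_def)
  qed
qed

end

section \<open>From the given expansion to uniform bounds\<close>

text \<open>The powers \<open>h t v powr p\<close>, not the \<open>h t v\<close> themselves, are affine in \<open>t\<close> up to a uniform \<open>o(t)\<close>.\<close>

lemma wulff_variation_exists:
  fixes p \<delta> :: real and f :: "real^'n \<Rightarrow> real" and h g :: "real \<Rightarrow> real^'n \<Rightarrow> real"
  assumes p: "0 < p"
    and h0_cont: "continuous_on (sphere 0 1) (h 0)"
    and h0_pos: "\<And>v. v \<in> sphere 0 1 \<Longrightarrow> 0 < h 0 v"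
    and f_cont: "continuous_on (sphere 0 1) f"
    and \<delta>: "0 < \<delta>"
    and ht: "\<And>t v. \<lbrakk>t \<in> {-\<delta><..<\<delta>}; v \<in> sphere 0 1\<rbrakk> \<Longrightarrow>
               h t v = (h 0 v powr p + t * f v + g t v) powr (1 / p)"
    and g0: "\<And>v. v \<in> sphere 0 1 \<Longrightarrow> g 0 v = 0"
    and g_lim: "uniform_limit (sphere 0 1) (\<lambda>t v. g t v / t) (\<lambda>_. 0) (at 0)"
  obtains \<tau> c r R where "wulff_variation h f p \<tau> c r R"
proof -
  let ?S = "sphere 0 1 :: (real^'n) set"
  have ne: "?S \<noteq> {}" using norm_axis_1[of undefined] by (metis dist_0_norm emptyE mem_sphere)
  have q_cont: "continuous_on ?S (\<lambda>v. h 0 v powr p)"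
    by (intro continuous_intros h0_cont ballI) (use h0_pos in fastforce)
  obtain v1 where v1: "v1 \<in> ?S" "\<And>v. v \<in> ?S \<Longrightarrow> h 0 v1 powr p \<le> h 0 v powr p"
    using continuous_attains_inf[OF compact_sphere ne q_cont] by blast
  obtain v2 where v2: "v2 \<in> ?S" "\<And>v. v \<in> ?S \<Longrightarrow> h 0 v powr p \<le> h 0 v2 powr p"
    using continuous_attains_sup[OF compact_sphere ne q_cont] by blast
  define a where "a = h 0 v1 powr p"
  define b where "b = h 0 v2 powr p"
  have a: "a > 0" using h0_pos[OF v1(1)] by (simp add: a_def)
  have ab: "a \<le> h 0 v powr p" "h 0 v powr p \<le> b" if "v \<in> ?S" for v
    using v1 v2 that by (auto simp: a_def b_def)
  obtain F where "\<forall>x\<in>f ` ?S. norm x \<le> F"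
    using compact_imp_bounded[OF compact_continuous_image[OF f_cont compact_sphere]] unfolding bounded_iff by blast
  hence F: "\<bar>f v\<bar> \<le> F" if "v \<in> ?S" for v using that by simp
  have F0: "0 \<le> F" using F[OF v1(1)] by linarith
  have g_small: "eventually (\<lambda>t. \<forall>v\<in>?S. \<bar>g t v\<bar> \<le> e * \<bar>t\<bar>) (at 0)" if e: "e > 0" for e
  proof -
    have "eventually (\<lambda>t. \<forall>v\<in>?S. dist (g t v / t) 0 < e) (at 0)"
      using g_lim e by (simp add: uniform_limit_iff)
    moreover have "eventually (\<lambda>t. t \<noteq> 0) (at (0::real))" by (simp add: eventually_at_filter)
    ultimately show ?thesis
    proof eventually_elim
      case (elim t)
      show ?case
      proof
        fix v assume "v \<in> ?S"
        hence "\<bar>g t v\<bar> / \<bar>t\<bar> < e" using elim(1) by (simp add: dist_real_def)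
        thus "\<bar>g t v\<bar> \<le> e * \<bar>t\<bar>" using elim(2) by (simp add: pos_divide_less_eq)
      qed
    qed
  qed
  \<comment> \<open>The limit says nothing at \<open>t = 0\<close>; there \<open>g0\<close> is
    used.\<close>
  obtain \<tau>1 where \<tau>1: "\<tau>1 > 0" "\<And>t v. \<bar>t\<bar> < \<tau>1 \<Longrightarrow> v \<in> ?S \<Longrightarrow> \<bar>g t v\<bar> \<le> \<bar>t\<bar>"
  proof -
    obtain d where d: "d > 0" "\<And>t. t \<noteq> 0 \<Longrightarrow> \<bar>t\<bar> < d \<Longrightarrow> \<forall>v\<in>?S. \<bar>g t v\<bar> \<le> 1 * \<bar>t\<bar>"
      using g_small[of 1] by (auto simp: eventually_at dist_real_def)
    have "\<bar>g t v\<bar> \<le> \<bar>t\<bar>" if "\<bar>t\<bar> < d" "v \<in> ?S" for t v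
      using d(2)[of t] that g0[of v] by (cases "t = 0") auto
    thus thesis using that d(1) by blast
  qed
  \<comment> \<open>The perturbation \<open>t * f v + g t v\<close> is at most
    \<open>(F + 1) * |t|\<close>, and \<open>h 0 v powr p\<close> is at least
    \<open>a\<close>.\<close>
  define c where "c = (F + 1) / a"
  have c: "c > 0" using F0 a by (simp add: c_def)
  \<comment> \<open>The third bound limits the relative change to one half, so \<open>q\<close>
    stays between \<open>a / 2\<close> and \<open>3 / 2 * b\<close>.\<close>
  define \<tau> where "\<tau> = min \<delta> (min \<tau>1 (1 / (2 * c)))"
  have \<tau>: "\<tau> > 0" "\<tau> \<le> \<delta>" "\<tau> \<le> \<tau>1" "c * \<tau> \<le> 1 / 2"
  proof -
    show "\<tau> > 0" using \<delta> \<tau>1(1) c by (simp add: \<tau>_def)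
    show "\<tau> \<le> \<delta>" "\<tau> \<le> \<tau>1" by (auto simp: \<tau>_def)
    have "\<tau> \<le> 1 / (2 * c)" by (simp add: \<tau>_def)
    hence "c * \<tau> \<le> c * (1 / (2 * c))" using c by (intro mult_left_mono) auto
    thus "c * \<tau> \<le> 1 / 2" using c by simp
  qed
  define q where "q = (\<lambda>t v. h 0 v powr p + t * f v + g t v)"
  have rel: "\<bar>q t v - h 0 v powr p\<bar> \<le> c * \<bar>t\<bar> * h 0 v powr p" if t: "\<bar>t\<bar> < \<tau>" and v: "v \<in> ?S" for t v
  proof -
    have "\<bar>t * f v\<bar> \<le> \<bar>t\<bar> * F" unfolding abs_mult using F[OF v] by (intro mult_left_mono) auto
    hence "\<bar>q t v - h 0 v powr p\<bar> \<le> \<bar>t\<bar> * F + \<bar>t\<bar>"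
      using \<tau>1(2)[of t v] t v \<tau>(3) by (simp add: q_def)
    also have "\<dots> = c * \<bar>t\<bar> * a" using a by (simp add: c_def field_simps)
    also have "\<dots> \<le> c * \<bar>t\<bar> * h 0 v powr p" using ab(1)[OF v] c by (intro mult_left_mono) auto
    finally show ?thesis .
  qed
  have half: "c * \<bar>t\<bar> \<le> 1 / 2" if "\<bar>t\<bar> < \<tau>" for t
  proof -
    have "c * \<bar>t\<bar> \<le> c * \<tau>" using that c by (intro mult_left_mono) auto
    thus ?thesis using \<tau>(4) by linarith
  qed
  have q_bounds: "a / 2 \<le> q t v" "q t v \<le> 3 / 2 * b" if t: "\<bar>t\<bar> < \<tau>" and v: "v \<in> ?S" for t v
  proof -
    have "c * \<bar>t\<bar> * h 0 v powr p \<le> 1 / 2 * h 0 v powr p"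
      using half[OF t] by (rule mult_right_mono) simp
    thus "a / 2 \<le> q t v" "q t v \<le> 3 / 2 * b" using rel[OF t v] ab[OF v] by linarith+
  qed
  have hq: "h t v = q t v powr (1 / p)" if "\<bar>t\<bar> < \<tau>" "v \<in> ?S" for t v
    using ht[of t v] that \<tau>(2) by (simp add: q_def abs_less_iff)
  \<comment> \<open>The p-th power undoes the root because \<open>q\<close> is positive on this
    interval.\<close>
  have hp: "h t v powr p = q t v" if "\<bar>t\<bar> < \<tau>" "v \<in> ?S" for t v
    using hq[OF that] q_bounds(1)[OF that] a p by (simp add: powr_powr)
  have "wulff_variation h f p \<tau> c ((a / 2) powr (1 / p)) ((3 / 2 * b) powr (1 / p))"
  proof
    show "0 < p" "0 < \<tau>" "0 \<le> c" "c * \<tau> \<le> 1 / 2" using p \<tau> c by auto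
    show "continuous_on (sphere 0 1) (h 0)" "continuous_on (sphere 0 1) f" by fact+
    show "0 < (a / 2) powr (1 / p)" using a by simp
    show "(a / 2) powr (1 / p) \<le> h t v" "h t v \<le> (3 / 2 * b) powr (1 / p)" if "\<bar>t\<bar> < \<tau>" "norm v = 1" for t v
    proof -
      have v: "v \<in> ?S" using that by simp
      show "(a / 2) powr (1 / p) \<le> h t v" "h t v \<le> (3 / 2 * b) powr (1 / p)"
        unfolding hq[OF that(1) v] using q_bounds[OF that(1) v] a p by (auto intro!: powr_mono2)
    qed
    show "\<bar>h t v powr p - h 0 v powr p\<bar> \<le> c * \<bar>t\<bar> * h 0 v powr p" if "\<bar>t\<bar> < \<tau>" "norm v = 1" for t v
      using rel[of t v] hp[of t v] that by simp
    fix e :: real assume e: "e > 0"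
    have "eventually (\<lambda>t. \<bar>t\<bar> < \<tau>) (at 0)"
      using \<tau>(1) by (auto simp: eventually_at dist_real_def intro!: exI[of _ \<tau>])
    with g_small[OF e]
    show "eventually (\<lambda>t. \<forall>v\<in>sphere 0 1. \<bar>h t v powr p - h 0 v powr p - t * f v\<bar> \<le> e * \<bar>t\<bar>) (at 0)"
    proof eventually_elim
      case (elim t)
      thus ?case using hp[of t] by (simp add: q_def)
    qed
  qed
  thus thesis by (rule that)
qed

theorem theorem3p2:
  fixes p \<delta> :: real and m :: nat
    and f :: "real^'n \<Rightarrow> real"
    and h r :: "real \<Rightarrow> real^'n \<Rightarrow> real"
  assumes n: "2 \<le> CARD('n)"
    and p: "0 < p"
    and m: "m \<in> {1..CARD('n) - 1}"
    and h0_cont: "continuous_on (sphere 0 1) (h 0)"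
    and h0_pos: "\<And>v. v \<in> sphere 0 1 \<Longrightarrow> 0 < h 0 v"
    and f_cont: "continuous_on (sphere 0 1) f"
    and \<delta>: "0 < \<delta>"
    and ht: "\<And>t v. \<lbrakk>t \<in> {-\<delta><..<\<delta>}; v \<in> sphere 0 1\<rbrakk> \<Longrightarrow>
               h t v = (h 0 v powr p + t * f v + r t v) powr (1 / p)"
    and r0: "\<And>v. v \<in> sphere 0 1 \<Longrightarrow> r 0 v = 0"
    and r_lim: "uniform_limit (sphere 0 1) (\<lambda>t v. r t v / t) (\<lambda>_. 0) (at 0)"
  shows "((\<lambda>t. (dual_quermass m (wulff_shape (h t)) - dual_quermass m (wulff_shape (h 0))) / t)
           \<longlongrightarrow> real CARD('n) / p * (LINT u|affine_dual_curvature p m (wulff_shape (h 0)). f u))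
         (at 0)"
proof -
  obtain \<tau> c r' R where "wulff_variation h f p \<tau> c r' R"
    using wulff_variation_exists[OF p h0_cont h0_pos f_cont \<delta> ht r0 r_lim] by blast
  then interpret wulff_variation h f p \<tau> c r' R .
  show ?thesis by (rule dual_quermass_variation) (use m in auto)
qed

end
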